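(* Suppose the initial distribution $\mu=(\mathbf P,\nu)$ of $(\varphi(0),X(0))$ has density given, for all $i\in\mathcal S$ and $x>0$, by $\nu_i(x)=p_i\lambda e^{-\lambda x}$ for some $\lambda>0$ and $0\le p_i\le 1$, and that the boundary conditions $${}_{D^n}\nu_+(0)={}_{D^n}\mathbf P_-\,(|\mathbf R_-|^{-1}\mathbf T_{-+})(|\mathbf R_+|^{-1}\mathbf C_+)^{-1}$$ hold for all $n\ge 0$. Then, for any $y>0$ and any set $\mathcal A_v=[0,v]$ with $v>0$, $$\mu e^{Dy}(\mathcal A_v)=-\mu(\bar{\mathcal A_v})\,e^{(|\mathbf R|^{-1}\mathbf T+\lambda|\mathbf R|^{-1}\mathbf C)y}+\mu([0,\infty))\,e^{(|\mathbf R|^{-1}\mathbf T)y},$$ where $$\mu(\bar{\mathcal A_v})=\mu^{(0)}([0,\infty))-\mu^{(0)}(\mathcal A_v)=e^{-\lambda v}\frac{\nu(0)}{\lambda}$$ is the initial distribution of starting in $\bar{\mathcal A_v}=(v,\infty)$.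
   Context: Model. $\mathcal S$ is a finite set and $\{\varphi(t):t\ge 0\}$ is an irreducible continuous-time Markov chain on $\mathcal S$ with generator $\mathbf T=[T_{ij}]$. For every $i\in\mathcal S$ there are nonzero real rates $c_i,r_i$. The level $X(t)\ge 0$ is driven by $\varphi$: when $\varphi(t)=i$, $dX(t)/dt=c_i$ if $X(t)>0$ and $dX(t)/dt=\max\{0,c_i\}$ if $X(t)=0$. The rates $r_i$ drive a second level $Y$. For $y\ge 0$ let $\omega(y)=\inf\{t>0:\int_0^t|r_{\varphi(u)}|\,du=y\}$. Matrices. $\mathcal S_+=\{j:c_j>0\}$, $\mathcal S_-=\{j:c_j<0\}$, $\mathbf R=\mathrm{diag}(r_j)_{j\in\mathcal S}$, $\mathbf C=\mathrm{diag}(c_j)_{j\in\mathcal S}$, $\mathbf R_\pm=\mathrm{diag}(r_j)_{j\in\mathcal S_\pm}$, $\mathbf C_\pm=\mathrm{diag}(c_j)_{j\in\mathcal S_\pm}$; $|\cdot|$ of a diagonal matrix is the entrywise absolute value; $\mathbf T_{-+}=[T_{ij}]_{i\in\mathcal S_-,j\in\mathcal S_+}$. All vectors indexed by $\mathcal S$ are row vectors; subscripts $+,-$ on a vector denote its restriction to $\mathcal S_+,\mathcal S_-$. Measures. The initial probability distribution $\mu=[\mu_j]_{j\in\mathcal S}$ has density $\nu(x)=[\nu_j(x)]_{j\in\mathcal S}$ on $x>0$ and point mass $\mathbf P=[P_j]_{j\in\mathcal S}$ at $X(0)=0$, with $\mathbf P_+=\mathbf 0$; that is, $\mathbb P(\varphi(0)=j,X(0)\in[0,v])=\mu_j([0,v])=\int_0^v\nu_j(x)dx+P_j$.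 Write $\mu(\cdot)=[\mu_j(\cdot)]_j$, $\mu^{(0)}([0,v])=\int_0^v\nu(x)dx$, $\mu^{(0)}([0,\infty))=\int_0^\infty\nu(x)dx$, and $\nu(0)=\lim_{x\to0^+}\nu(x)$ (similarly for other densities). Operators. $\mu e^{Dy}(\mathcal A_v)$ is the row vector with $j$-th entry $$\sum_{i\in\mathcal S}\int_{[0,\infty)}d\mu_i(x)\,\mathbb P\big(\varphi(\omega(y))=j,\ X(\omega(y))\in\mathcal A_v\mid\varphi(0)=i,X(0)=x\big).$$ The generator $D$ of this semigroup (in the parameter $y$) acts on vectors of measures with density $\nu$ and atom at $0$ by $$(\mu D)_j([0,v])=\sum_{i\in\mathcal S}\frac{T_{ij}}{|r_i|}\mu_i([0,v])-\frac{c_j}{|r_j|}\nu_j(v),\qquad v>0.$$ For $n\ge0$, ${}_{D^n}\mu=\mu D^n$, with density ${}_{D^n}\nu(x)$ ($x>0$) and atom ${}_{D^n}\mathbf P$ at $0$, i.e. ${}_{D^n}\mu_j([0,v])=\int_0^v{}_{D^n}\nu_j(x)dx+{}_{D^n}P_j$ for all $v>0$ (for $n=0$ these are $\nu$ and $\mathbf P$). *)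

theory Defs
  imports "HOL-Probability.Probability"
begin

section \<open>Matrices\<close>

definition diag_mat :: "('s::finite \<Rightarrow> real) \<Rightarrow> real^'s^'s" where
  "diag_mat d = (\<chi> i j. if i = j then d i else 0)"

(* The library's ^ and exp do not apply here: multiplication on vec is componentwise. *)
primrec mpow :: "real^'s^'s \<Rightarrow> nat \<Rightarrow> real^'s^('s::finite)" where
  "mpow A 0 = mat 1"
| "mpow A (Suc k) = A ** mpow A k"

definition mexp :: "real^'s^'s \<Rightarrow> real^'s^('s::finite)" where
  "mexp A = (\<Sum>k. (1 / fact k) *\<^sub>R mpow A k)"

section \<open>The Markov chain and the level process\<close>

definition generator_matrix :: "real^'s^('s::finite) \<Rightarrow> bool" where
  "generator_matrix T \<longleftrightarrow>
     (\<forall>i j. i \<noteq> j \<longrightarrow> T $ i $ j \<ge> 0) \<and> (\<forall>i. (\<Sum>j\<in>UNIV. T $ i $ j) = 0)"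

definition irreducible_matrix :: "real^'s^('s::finite) \<Rightarrow> bool" where
  "irreducible_matrix T \<longleftrightarrow> (\<forall>i j. (i, j) \<in> {(a, b). a \<noteq> b \<and> T $ a $ b > 0}\<^sup>*)"

(* Right-continuous with left limits, for the discrete topology on the state space. *)
definition cadlag_path :: "(real \<Rightarrow> 's) \<Rightarrow> bool" where
  "cadlag_path f \<longleftrightarrow>
     (\<forall>t\<ge>0. eventually (\<lambda>u. f u = f t) (at_right t)) \<and>
     (\<forall>t>0. \<exists>s. eventually (\<lambda>u. f u = s) (at_left t))"

definition ctmc :: "'w measure \<Rightarrow> real^'s^'s \<Rightarrow> (real \<Rightarrow> 'w \<Rightarrow> 's::finite) \<Rightarrow> bool" where
  "ctmc M T \<phi> \<longleftrightarrow>
     prob_space M \<and>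
     (\<forall>t\<ge>0. \<phi> t \<in> measurable M (count_space UNIV)) \<and>
     (\<forall>w\<in>space M. cadlag_path (\<lambda>t. \<phi> t w)) \<and>
     (\<forall>n t s. t 0 = 0 \<longrightarrow> (\<forall>k<n. t k \<le> t (Suc k)) \<longrightarrow>
        measure M {w \<in> space M. \<forall>k\<le>n. \<phi> (t k) w = s k} =
        measure M {w \<in> space M. \<phi> 0 w = s 0} *
        (\<Prod>k<n. mexp ((t (Suc k) - t k) *\<^sub>R T) $ s k $ s (Suc k)))"

(* The derivative of the level is a right derivative: at jump times of the phase, and when
   the level reaches 0, the left and right derivatives differ. *)
definition level_path :: "('s \<Rightarrow> real) \<Rightarrow> (real \<Rightarrow> 's) \<Rightarrow> (real \<Rightarrow> real) \<Rightarrow> bool" where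
  "level_path c f X \<longleftrightarrow>
     continuous_on {0..} X \<and>
     (\<forall>t\<ge>0. X t \<ge> 0 \<and>
        (X has_real_derivative (if X t > 0 then c (f t) else max 0 (c (f t)))) (at_right t))"

(* Pr i x is the conditional law given phase i and level x at time 0; as a regular version of
   a conditional probability it is a Markov kernel in the initial level x. *)
definition fluid_queue ::
    "'w measure \<Rightarrow> ('s \<Rightarrow> real \<Rightarrow> 'w measure) \<Rightarrow> real^'s^'s \<Rightarrow> ('s \<Rightarrow> real) \<Rightarrow>
     (real \<Rightarrow> 'w \<Rightarrow> 's::finite) \<Rightarrow> (real \<Rightarrow> 'w \<Rightarrow> real) \<Rightarrow> bool" where
  "fluid_queue N Pr T c \<phi> X \<longleftrightarrow>
     (\<forall>i. Pr i \<in> measurable (restrict_space borel {0..}) (prob_algebra N)) \<and>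
     (\<forall>t\<ge>0. X t \<in> borel_measurable N) \<and>
     (\<forall>w\<in>space N. level_path c (\<lambda>t. \<phi> t w) (\<lambda>t. X t w)) \<and>
     (\<forall>i. \<forall>x\<ge>0. ctmc (Pr i x) T \<phi> \<and> (AE w in Pr i x. \<phi> 0 w = i \<and> X 0 w = x))"

definition hit_time :: "('s \<Rightarrow> real) \<Rightarrow> (real \<Rightarrow> 'w \<Rightarrow> 's) \<Rightarrow> real \<Rightarrow> 'w \<Rightarrow> real" where
  "hit_time r \<phi> y w = Inf {t. t > 0 \<and> (LBINT u:{0..t}. \<bar>r (\<phi> u w)\<bar>) = y}"

section \<open>Vectors of measures and the operators\<close>

definition initial_distribution :: "('s::finite \<Rightarrow> real measure) \<Rightarrow> bool" where
  "initial_distribution \<mu> \<longleftrightarrow>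
     (\<forall>i. sets (\<mu> i) = sets borel \<and> emeasure (\<mu> i) {..<0} = 0) \<and>
     (\<Sum>i\<in>UNIV. emeasure (\<mu> i) {0..}) = 1"

definition mass :: "('s::finite \<Rightarrow> real measure) \<Rightarrow> real set \<Rightarrow> real^'s" where
  "mass \<mu> A = (\<chi> j. measure (\<mu> j) A)"

(* The row vector obtained by applying exp(D y) to \<mu> and evaluating at A. *)
definition exp_D ::
    "('s \<Rightarrow> real \<Rightarrow> 'w measure) \<Rightarrow> ('s \<Rightarrow> real) \<Rightarrow> (real \<Rightarrow> 'w \<Rightarrow> 's::finite) \<Rightarrow>
     (real \<Rightarrow> 'w \<Rightarrow> real) \<Rightarrow> ('s \<Rightarrow> real measure) \<Rightarrow> real \<Rightarrow> real set \<Rightarrow> real^'s" where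
  "exp_D Pr r \<phi> X \<mu> y A =
     (\<chi> j. \<Sum>i\<in>UNIV. LINT x:{0..}|\<mu> i.
        measure (Pr i x) {w \<in> space (Pr i x).
          \<phi> (hit_time r \<phi> y w) w = j \<and> X (hit_time r \<phi> y w) w \<in> A})"

(* A vector of signed measures is represented by v \<mapsto> F v, its row vector of values on [0,v]. *)
definition apply_D ::
    "real^'s^'s \<Rightarrow> ('s \<Rightarrow> real) \<Rightarrow> ('s \<Rightarrow> real) \<Rightarrow> (real \<Rightarrow> real^'s) \<Rightarrow> (real \<Rightarrow> real^'s) \<Rightarrow>
     real \<Rightarrow> real^('s::finite)" where
  "apply_D T r c F \<nu> =
     (\<lambda>v. \<chi> j. (\<Sum>i\<in>UNIV. T $ i $ j / \<bar>r i\<bar> * F v $ i) - c j / \<bar>r j\<bar> * \<nu> v $ j)"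

(* D_iter T r c \<mu> \<nu> n represents D^n applied to \<mu>, where \<nu> k is the density of D^k applied
   to \<mu>. *)
primrec D_iter ::
    "real^'s^'s \<Rightarrow> ('s \<Rightarrow> real) \<Rightarrow> ('s \<Rightarrow> real) \<Rightarrow> ('s \<Rightarrow> real measure) \<Rightarrow>
     (nat \<Rightarrow> real \<Rightarrow> real^'s) \<Rightarrow> nat \<Rightarrow> real \<Rightarrow> real^('s::finite)" where
  "D_iter T r c \<mu> \<nu> 0 = (\<lambda>v. mass \<mu> {0..v})"
| "D_iter T r c \<mu> \<nu> (Suc n) = apply_D T r c (D_iter T r c \<mu> \<nu> n) (\<nu> n)"

definition has_density_atom ::
    "(real \<Rightarrow> real^'s) \<Rightarrow> (real \<Rightarrow> real^'s) \<Rightarrow> real^('s::finite) \<Rightarrow> bool" where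
  "has_density_atom F \<nu> P \<longleftrightarrow>
     (\<forall>j. \<forall>v>0. set_integrable lborel {0<..v} (\<lambda>x. \<nu> x $ j) \<and>
        F v $ j = (LBINT x:{0<..v}. \<nu> x $ j) + P $ j)"

(* Entrywise form, for j with c j > 0, of
     \<nu>_+(0) = P_- (|R_-|^(-1) T_(-+)) (|R_+|^(-1) C_+)^(-1). *)
definition boundary_condition ::
    "real^'s^'s \<Rightarrow> ('s \<Rightarrow> real) \<Rightarrow> ('s \<Rightarrow> real) \<Rightarrow> (real \<Rightarrow> real^'s) \<Rightarrow> real^('s::finite) \<Rightarrow> bool" where
  "boundary_condition T r c \<nu> P \<longleftrightarrow>
     (\<forall>j\<in>{j. c j > 0}.
        ((\<lambda>x. \<nu> x $ j) \<longlongrightarrow>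
           (\<Sum>i\<in>{i. c i < 0}. P $ i * (inverse \<bar>r i\<bar> * T $ i $ j)) *
             inverse (inverse \<bar>r j\<bar> * c j)) (at_right 0))"

end

theory Submission
  imports Defs
begin

text \<open>
  Put \<open>A = |R|\<^sup>-\<^sup>1 T\<close>, \<open>B = A + \<lambda> |R|\<^sup>-\<^sup>1 C\<close>, \<open>a = \<mu>([0, \<infinity>))\<close>, \<open>b = p\<close> and
  \<open>F(v, y) = a e\<^sup>A\<^sup>y - e\<^sup>-\<^sup>\<lambda>\<^sup>v b e\<^sup>B\<^sup>y\<close>. This is the claimed law. The densities of \<open>\<mu> D\<^sup>n\<close> are
  \<open>\<lambda> e\<^sup>-\<^sup>\<lambda>\<^sup>v b B\<^sup>n\<close>, so by induction on \<open>n\<close> the boundary conditions say that the atoms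
  \<open>a A\<^sup>n - b B\<^sup>n\<close> vanish on the phases with positive rate; hence so does \<open>F(0, y)\<close>.

  The random time change is avoided by treating the clock \<open>\<integral> |r|\<close> as a second level and computing,
  on a grid of width \<open>h\<close>, the expected time that the chain spends in phase \<open>j\<close> with level at most
  \<open>v\<close> and clock at most \<open>y\<close>. If level and clock are replaced by their Euler schemes along the
  grid, this occupation time satisfies an exact recursion, by the Markov property at the fixed grid
  times. Up to an error \<open>O(h)\<close> the recursion is solved by \<open>\<integral>\<^sub>0\<^sup>y F(v, u) du / |r\<^sub>j|\<close>. Pathwise the Euler
  schemes are within \<open>O(h)\<close> of the true processes, since there are finitely many jumps, so
  differentiating the occupation time in \<open>y\<close> over windows of width \<open>\<surd>h\<close> recovers the law at the
  hitting time of \<open>y\<close>.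
\<close>

section \<open>Exponentials of matrices\<close>


text \<open>The chain is given by its laws at deterministic times and its cadlag paths, so
  conditioning at the random time \<open>hit_time\<close> is avoided. Along a path, clock time spent
  in phase \<open>j\<close> is \<open>\<bar>r j\<bar>\<close> times real time; hence the occupation
  time up to clock \<open>y\<close> integrates the law at clock \<open>u\<close> over
  \<open>u \<le> y\<close>, divided by \<open>\<bar>r j\<bar>\<close>. No uniqueness theorem for the
  transport equation is used: the grid recursion starts from 0 and determines its own solution, and
  a Gronwall estimate compares that solution with \<open>H\<close>. The comparison requires
  \<open>H\<close>, extended by 0, to stay Lipschitz across \<open>v = 0\<close> for the upward
  phases, the only ones whose shifted level can become negative. This amounts to
  \<open>F(0, y) = 0\<close> there, and \<open>F(0, y)\<close> is the power series in
  \<open>y\<close> with the atoms divided by \<open>n!\<close> as coefficients: this is how boundary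
  conditions of every order enter. A window of width sqrt(h) turns the occupation error O(h) into
  O(sqrt(h)) after division. Placing it slightly after \<open>y\<close> puts its grid times in the
  stretch where right continuity fixes the phase, even if the phase jumps at the hitting time
  itself.\<close>

lemma mpow_commute: "A ** mpow A k = mpow A k ** A"
proof (induction k)
  case (Suc k)
  then show ?case by (simp only: mpow.simps) (metis matrix_mul_assoc)
qed simp

lemma mpow_scaleR: "mpow (t *\<^sub>R A) k = t ^ k *\<^sub>R mpow A k"
proof (induction k)
  case (Suc k)
  have "(t *\<^sub>R A) ** (t ^ k *\<^sub>R mpow A k) = t ^ Suc k *\<^sub>R (A ** mpow A k)"
    by (simp add: vec_eq_iff matrix_matrix_mult_def sum_distrib_left mult_ac)
  with Suc show ?case by simp
qed simp

text \<open>The sum of all absolute entries dominates every row sum, so each further factor costs at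
  most this sum. The bound is crude, but it makes the scalar exponential series a majorant for every
  entry.\<close>

lemma mpow_entry_bound:
  fixes A :: "real^'s^('s::finite)"
  shows "\<bar>mpow A k $ i $ j\<bar> \<le> (\<Sum>i\<in>UNIV. \<Sum>j\<in>UNIV. \<bar>A $ i $ j\<bar>) ^ k" (is "_ \<le> ?M ^ k")
proof (induction k arbitrary: i)
  case 0
  then show ?case by (simp add: mat_def)
next
  case (Suc k)
  have "\<bar>mpow A (Suc k) $ i $ j\<bar> \<le> (\<Sum>l\<in>UNIV. \<bar>A $ i $ l\<bar> * \<bar>mpow A k $ l $ j\<bar>)"
    by (simp add: matrix_matrix_mult_def abs_mult [symmetric] sum_abs)
  also have "\<dots> \<le> (\<Sum>l\<in>UNIV. \<bar>A $ i $ l\<bar> * ?M ^ k)"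
    by (intro sum_mono mult_left_mono Suc) auto
  also have "\<dots> = (\<Sum>l\<in>UNIV. \<bar>A $ i $ l\<bar>) * ?M ^ k"
    by (simp add: sum_distrib_right)
  also have "\<dots> \<le> ?M * ?M ^ k"
  proof (rule mult_right_mono)
    show "(\<Sum>l\<in>UNIV. \<bar>A $ i $ l\<bar>) \<le> ?M"
      by (rule member_le_sum) (auto intro: sum_nonneg)
  qed (auto intro!: zero_le_power sum_nonneg)
  finally show ?case by simp
qed

lemma mexp_entry_summable:
  fixes A :: "real^'s^('s::finite)"
  shows "summable (\<lambda>k. mpow A k $ i $ j / fact k * t ^ k)"
proof (rule summable_comparison_test')
  let ?M = "\<Sum>i\<in>UNIV. \<Sum>j\<in>UNIV. \<bar>A $ i $ j\<bar>"
  show "summable (\<lambda>k. inverse (fact k) * (?M * \<bar>t\<bar>) ^ k)"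
    by (rule summable_exp)
  show "norm (mpow A k $ i $ j / fact k * t ^ k) \<le> inverse (fact k) * (?M * \<bar>t\<bar>) ^ k" for k
    using mpow_entry_bound [of A k i j]
    by (simp add: abs_mult power_mult_distrib power_abs divide_inverse mult_ac mult_left_mono)
qed

text \<open>The series in \<open>mexp\<close> converges in the space of matrices; read entrywise it
  is a scalar power series in \<open>t\<close>, which opens the way to termwise
  differentiation.\<close>

lemma mexp_entry:
  fixes A :: "real^'s^('s::finite)"
  shows "mexp (t *\<^sub>R A) $ i $ j = (\<Sum>k. mpow A k $ i $ j / fact k * t ^ k)"
proof -
  have "(\<lambda>k. (1 / fact k) *\<^sub>R mpow (t *\<^sub>R A) k) sums
        (\<chi> i j. \<Sum>k. mpow A k $ i $ j / fact k * t ^ k)"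
    unfolding sums_def
  proof (intro vec_tendstoI)
    fix i j :: 's
    have "(\<lambda>k. mpow A k $ i $ j / fact k * t ^ k) sums (\<Sum>k. mpow A k $ i $ j / fact k * t ^ k)"
      by (rule summable_sums [OF mexp_entry_summable])
    then show "(\<lambda>n. (\<Sum>k<n. (1 / fact k) *\<^sub>R mpow (t *\<^sub>R A) k) $ i $ j) \<longlonglongrightarrow>
        (\<chi> i j. \<Sum>k. mpow A k $ i $ j / fact k * t ^ k) $ i $ j"
      by (simp add: sums_def mpow_scaleR mult_ac)
  qed
  then show ?thesis
    by (simp add: mexp_def sums_iff)
qed

lemma mexp_entry_deriv:
  fixes A :: "real^'s^('s::finite)"
  shows "((\<lambda>t. mexp (t *\<^sub>R A) $ i $ j) has_real_derivative
           (\<Sum>l\<in>UNIV. mexp (t *\<^sub>R A) $ i $ l * A $ l $ j)) (at t)"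
proof -
  let ?d = "\<lambda>k. mpow A k $ i $ j / fact k"
  have "((\<lambda>t. \<Sum>k. ?d k * t ^ k) has_field_derivative (\<Sum>k. diffs ?d k * t ^ k)) (at t)"
    by (rule termdiffs_strong_converges_everywhere) (rule mexp_entry_summable)
  moreover have "(\<Sum>k. diffs ?d k * t ^ k) = (\<Sum>l\<in>UNIV. mexp (t *\<^sub>R A) $ i $ l * A $ l $ j)"
  proof -
    have "diffs ?d k * t ^ k = (\<Sum>l\<in>UNIV. mpow A k $ i $ l / fact k * t ^ k * A $ l $ j)" for k
    proof -
      \<comment> \<open>The recursion of \<open>mpow\<close> multiplies on the left; the factor is
        moved to the right because the vectors applied later are rows.\<close>
      have "mpow A (Suc k) $ i $ j = (\<Sum>l\<in>UNIV. mpow A k $ i $ l * A $ l $ j)"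
        by (simp add: mpow_commute) (simp add: matrix_matrix_mult_def)
      then show ?thesis
        by (simp add: diffs_def sum_divide_distrib sum_distrib_right sum_distrib_left mult_ac del: of_nat_Suc mpow.simps)
    qed
    then have "(\<Sum>k. diffs ?d k * t ^ k) = (\<Sum>k. \<Sum>l\<in>UNIV. mpow A k $ i $ l / fact k * t ^ k * A $ l $ j)"
      by simp
    also have "\<dots> = (\<Sum>l\<in>UNIV. \<Sum>k. mpow A k $ i $ l / fact k * t ^ k * A $ l $ j)"
      by (rule suminf_sum) (intro summable_mult2 mexp_entry_summable)
    also have "\<dots> = (\<Sum>l\<in>UNIV. mexp (t *\<^sub>R A) $ i $ l * A $ l $ j)"
      by (simp only: mexp_entry suminf_mult2 [OF mexp_entry_summable])
    finally show ?thesis .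
  qed
  ultimately show ?thesis by (simp add: mexp_entry)
qed

lemma mexp_0: "mexp (0 *\<^sub>R A) = mat 1"
proof -
  have "(\<Sum>k. mpow A k $ i $ j / fact k * 0 ^ k) = mat 1 $ i $ j" for i j
    using powser_zero [of "\<lambda>k. mpow A k $ i $ j / fact k"] by simp
  then show ?thesis
    by (simp add: vec_eq_iff mexp_entry del: scaleR_zero_left)
qed

lemma row_mexp_deriv:
  fixes A :: "real^'s^('s::finite)"
  shows "((\<lambda>t. (a v* mexp (t *\<^sub>R A)) $ j) has_real_derivative
           ((a v* mexp (t *\<^sub>R A)) v* A) $ j) (at t)"
proof -
  have "((\<lambda>t. \<Sum>i\<in>UNIV. mexp (t *\<^sub>R A) $ i $ j * a $ i) has_real_derivative
         (\<Sum>i\<in>UNIV. (\<Sum>l\<in>UNIV. mexp (t *\<^sub>R A) $ i $ l * A $ l $ j) * a $ i)) (at t)"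
    by (intro DERIV_sum DERIV_cmult_right mexp_entry_deriv)
  also have "(\<Sum>i\<in>UNIV. (\<Sum>l\<in>UNIV. mexp (t *\<^sub>R A) $ i $ l * A $ l $ j) * a $ i) =
      (\<Sum>l\<in>UNIV. A $ l $ j * (\<Sum>i\<in>UNIV. mexp (t *\<^sub>R A) $ i $ l * a $ i))"
    by (simp add: sum_distrib_left sum_distrib_right mult_ac) (rule sum.swap)
  finally show ?thesis by (simp add: vector_matrix_mult_def mult_ac)
qed

lemma row_mexp_0 [simp]: "a v* mexp (0 *\<^sub>R A) = a"
  by (simp only: mexp_0 vector_matrix_mul_rid)

text \<open>The coefficients are the numbers that the boundary conditions control: if those of two
  such series agree in one coordinate for all \<open>k\<close>, then so do the exponentials in that
  coordinate.\<close>

lemma row_mexp_series: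
  fixes A :: "real^'s^('s::finite)"
  shows "(a v* mexp (t *\<^sub>R A)) $ j = (\<Sum>k. (a v* mpow A k) $ j / fact k * t ^ k)"
proof -
  have "(\<Sum>k. (a v* mpow A k) $ j / fact k * t ^ k) =
        (\<Sum>k. \<Sum>i\<in>UNIV. mpow A k $ i $ j / fact k * t ^ k * a $ i)"
    by (simp add: vector_matrix_mult_def sum_divide_distrib sum_distrib_left mult_ac)
  also have "\<dots> = (\<Sum>i\<in>UNIV. \<Sum>k. mpow A k $ i $ j / fact k * t ^ k * a $ i)"
    by (rule suminf_sum) (intro summable_mult2 mexp_entry_summable)
  also have "\<dots> = (a v* mexp (t *\<^sub>R A)) $ j"
    by (simp only: mexp_entry suminf_mult2 [OF mexp_entry_summable, symmetric]
          vector_matrix_mult_def vec_lambda_beta mult.commute [of "a $ _"])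
  finally show ?thesis ..
qed

text \<open>A Taylor bound for one transition step, from two mean value steps:
  \<open>f h - f 0 = h * g s\<close>, then \<open>g s - g 0 = s * g' u\<close>. Compactness of
  \<open>{0..1}\<close> bounds \<open>g'\<close>, and summing over the finitely many entries makes
  the constant uniform.\<close>

lemma mexp_first_order:
  fixes T :: "real^'s^('s::finite)"
  obtains K where "K \<ge> 0" and
    "\<And>h i j. 0 \<le> h \<Longrightarrow> h \<le> 1 \<Longrightarrow>
       \<bar>mexp (h *\<^sub>R T) $ i $ j - mat 1 $ i $ j - h * T $ i $ j\<bar> \<le> K * h\<^sup>2"
proof -
  define f where "f i j t = mexp (t *\<^sub>R T) $ i $ j" for i j t
  define g where "g i j t = (\<Sum>l\<in>UNIV. f i l t * T $ l $ j)" for i j t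
  define g' where "g' i j t = (\<Sum>l\<in>UNIV. g i l t * T $ l $ j)" for i j t
  have f: "(f i j has_real_derivative g i j t) (at t)" for i j t
    unfolding f_def g_def by (rule mexp_entry_deriv)
  have g: "(g i j has_real_derivative g' i j t) (at t)" for i j t
    unfolding g_def [abs_def] g'_def
    by (intro DERIV_sum DERIV_cmult_right f [unfolded g_def])
  have cont: "continuous_on {0..1} (g' i j)" for i j
    unfolding g'_def [abs_def]
    by (intro continuous_intros continuous_at_imp_continuous_on ballI DERIV_isCont [OF g])
  have "\<exists>K. \<forall>t\<in>{0..1}. \<bar>g' i j t\<bar> \<le> K" for i j
    using compact_imp_bounded [OF compact_continuous_image [OF cont compact_Icc]]
    by (auto simp: bounded_iff)
  then obtain K where K: "\<And>i j t. t \<in> {0..1} \<Longrightarrow> \<bar>g' i j t\<bar> \<le> K i j"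
    by metis
  define K0 where "K0 = (\<Sum>i\<in>UNIV. \<Sum>j\<in>UNIV. \<bar>K i j\<bar>)"
  have K0: "\<bar>g' i j t\<bar> \<le> K0" if "t \<in> {0..1}" for i j t
  proof -
    have "\<bar>K i j\<bar> \<le> (\<Sum>j\<in>UNIV. \<bar>K i j\<bar>)" by (rule member_le_sum) auto
    also have "\<dots> \<le> K0" unfolding K0_def by (rule member_le_sum) (auto intro: sum_nonneg)
    finally show ?thesis using K [OF that, of i j] by linarith
  qed
  show ?thesis
  proof
    show "K0 \<ge> 0" unfolding K0_def by (intro sum_nonneg) auto
    fix h i j assume h: "(0::real) \<le> h" "h \<le> 1"
    show "\<bar>mexp (h *\<^sub>R T) $ i $ j - mat 1 $ i $ j - h * T $ i $ j\<bar> \<le> K0 * h\<^sup>2"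
    proof (cases "h = 0")
      case True
      then show ?thesis using mexp_0 [of T] by simp
    next
      case False
      obtain s where s: "0 < s" "s < h" "f i j h - f i j 0 = (h - 0) * g i j s"
        using MVT2 [of 0 h "f i j" "g i j"] f h False by auto
      obtain u where u: "0 < u" "u < s" "g i j s - g i j 0 = (s - 0) * g' i j u"
        using MVT2 [of 0 s "g i j" "g' i j"] g s by auto
      have f0: "f i j 0 = mat 1 $ i $ j" for i j
        unfolding f_def by (simp only: mexp_0)
      have g0: "g i j 0 = T $ i $ j"
        by (simp add: g_def f0 mat_def if_distrib [of "\<lambda>x. x * _"] cong: if_cong)
      have "f i j h - mat 1 $ i $ j - h * T $ i $ j = h * (s * g' i j u)"
        using s u f0 g0 by (simp add: algebra_simps)
      also have "\<bar>\<dots>\<bar> \<le> h * (h * K0)"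
        unfolding abs_mult
        using s u h K0 [of u i j] by (intro mult_mono) auto
      finally show ?thesis by (simp add: f_def power2_eq_square mult_ac)
    qed
  qed
qed

section \<open>Error of the grid recursion\<close>


text \<open>
  The grid recursion for the discretised level and clock is compared with a function \<open>H\<close> that
  solves the corresponding transport equation. The local error is \<open>O(h\<^sup>2)\<close>, except within
  distance \<open>O(h)\<close> of the boundary \<open>v = 0\<close> or \<open>y = 0\<close>. There it is \<open>O(h)\<close>, but the
  diagonal term of the recursion vanishes there too, so these errors do not accumulate.
\<close>

locale transport =
  fixes T :: "real^'s^('s::finite)" and c d :: "'s \<Rightarrow> real"
    and F0 :: "real \<Rightarrow> 's \<Rightarrow> real" and H :: "real \<Rightarrow> real \<Rightarrow> 's \<Rightarrow> real"
    and L ym :: real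
  assumes d_nonneg: "\<And>i. 0 \<le> d i"
    and F0_lip: "\<And>v v' i. 0 \<le> v \<Longrightarrow> 0 \<le> v' \<Longrightarrow> \<bar>F0 v i - F0 v' i\<bar> \<le> L * \<bar>v - v'\<bar>"
    and F0_bound: "\<And>v i. 0 \<le> v \<Longrightarrow> \<bar>F0 v i\<bar> \<le> L"
    and H_lip: "\<And>v v' y y' i. 0 \<le> v \<Longrightarrow> 0 \<le> v' \<Longrightarrow> y \<in> {0..ym} \<Longrightarrow> y' \<in> {0..ym} \<Longrightarrow>
       \<bar>H v y i - H v' y' i\<bar> \<le> L * (\<bar>v - v'\<bar> + \<bar>y - y'\<bar>)"
    and H_bound: "\<And>v y i. 0 \<le> v \<Longrightarrow> y \<in> {0..ym} \<Longrightarrow> \<bar>H v y i\<bar> \<le> L"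
    and H_clock_0: "\<And>v i. 0 \<le> v \<Longrightarrow> H v 0 i = 0"
    and H_level_0: "\<And>y i. y \<in> {0..ym} \<Longrightarrow> c i > 0 \<Longrightarrow> H 0 y i = 0"
    and H_char: "\<And>v y h j. 0 \<le> v \<Longrightarrow> y \<in> {0..ym} \<Longrightarrow> 0 < h \<Longrightarrow> 0 \<le> v - c j * h \<Longrightarrow> 0 \<le> y - d j * h \<Longrightarrow>
       \<exists>s\<in>{0..h}. H v y j - H (v - c j * h) (y - d j * h) j =
         h * (F0 (v - c j * s) j + (\<Sum>i\<in>UNIV. T $ i $ j * H (v - c j * s) (y - d j * s) i))"
begin

text \<open>The extension by 0 mirrors that no occupation time accrues below level 0 or below clock
  0; the recursion evaluates its argument at shifted points that may leave the quadrant.\<close>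

definition Hx :: "real \<Rightarrow> real \<Rightarrow> 's \<Rightarrow> real" where
  "Hx v y i = (if v < 0 \<or> y < 0 then 0 else H v y i)"

lemma L_nonneg: "0 \<le> L"
  using F0_bound [of 0] by (meson abs_ge_zero order_refl order_trans)

text \<open>Extending by 0 is continuous across \<open>y = 0\<close> for every phase, but across
  \<open>v = 0\<close> only where \<open>H\<close> vanishes, that is for \<open>c i > 0\<close>. The
  last hypothesis always holds for \<open>v' = v - c i * h\<close>, since a phase with
  \<open>c i \<le> 0\<close> shifts the level upwards.\<close>

lemma Hx_lip:
  assumes "0 \<le> v" "y \<in> {0..ym}" "y' \<le> ym" "0 \<le> v' \<or> c i > 0"
  shows "\<bar>H v y i - Hx v' y' i\<bar> \<le> L * (\<bar>v - v'\<bar> + \<bar>y - y'\<bar>)"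
proof -
  consider "y' < 0" | "v' < 0" "c i > 0" | "0 \<le> v'" "0 \<le> y'" using assms by linarith
  then show ?thesis
  proof cases
    case 1
    have "\<bar>H v y i - H v 0 i\<bar> \<le> L * (\<bar>v - v\<bar> + \<bar>y - 0\<bar>)" using assms by (intro H_lip) auto
    also have "\<dots> \<le> L * (\<bar>v - v'\<bar> + \<bar>y - y'\<bar>)" using 1 assms L_nonneg by (intro mult_left_mono) auto
    finally show ?thesis using 1 assms by (simp add: Hx_def H_clock_0)
  next
    case 2
    have "\<bar>H v y i - H 0 y i\<bar> \<le> L * (\<bar>v - 0\<bar> + \<bar>y - y\<bar>)" using assms by (intro H_lip) auto
    also have "\<dots> \<le> L * (\<bar>v - v'\<bar> + \<bar>y - y'\<bar>)" using 2 assms L_nonneg by (intro mult_left_mono) auto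
    finally show ?thesis using 2 assms by (simp add: Hx_def H_level_0)
  next
    case 3
    then show ?thesis using H_lip [of v v' y y' i] assms by (simp add: Hx_def)
  qed
qed

lemma Hx_bound: "y \<le> ym \<Longrightarrow> \<bar>Hx v y i\<bar> \<le> L"
  using H_bound [of v y i] L_nonneg by (auto simp: Hx_def)

text \<open>In the interior, \<open>H_char\<close> gives the exact increment with source and
  coupling taken at an intermediate point of the characteristic of \<open>j\<close>. Moving these to
  the points used by the recursion costs O(h) by the Lipschitz bounds, and they carry a factor
  \<open>h\<close>. If the characteristic of \<open>j\<close> leaves the quadrant,
  \<open>H v y j\<close> itself is O(h), and so is every other term.\<close>

lemma consistency:
  obtains K where "K \<ge> 0"
    "\<And>h i j. 0 < h \<Longrightarrow> h \<le> 1 \<Longrightarrow> \<bar>mexp (h *\<^sub>R T) $ i $ j - mat 1 $ i $ j\<bar> \<le> K * h"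
    "\<And>h v y j. 0 < h \<Longrightarrow> h \<le> 1 \<Longrightarrow> 0 \<le> v \<Longrightarrow> y \<in> {0..ym} \<Longrightarrow>
       0 \<le> v - c j * h \<Longrightarrow> 0 \<le> y - d j * h \<Longrightarrow>
       \<bar>H v y j - (h * F0 v j + (\<Sum>i\<in>UNIV. mexp (h *\<^sub>R T) $ i $ j * Hx (v - c i * h) (y - d i * h) i))\<bar> \<le> K * h\<^sup>2"
    "\<And>h v y j. 0 < h \<Longrightarrow> h \<le> 1 \<Longrightarrow> 0 \<le> v \<Longrightarrow> y \<in> {0..ym} \<Longrightarrow>
       v - c j * h < 0 \<or> y - d j * h < 0 \<Longrightarrow>
       \<bar>H v y j - (h * F0 v j + (\<Sum>i\<in>UNIV. mexp (h *\<^sub>R T) $ i $ j * Hx (v - c i * h) (y - d i * h) i))\<bar> \<le> K * h"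
proof -
  obtain K1 where K1: "K1 \<ge> 0"
    "\<And>h i j. 0 \<le> h \<Longrightarrow> h \<le> 1 \<Longrightarrow> \<bar>mexp (h *\<^sub>R T) $ i $ j - mat 1 $ i $ j - h * T $ i $ j\<bar> \<le> K1 * h\<^sup>2"
    using mexp_first_order [of T] by blast
  define C where "C = (\<Sum>i\<in>UNIV. \<bar>c i\<bar> + d i)"
  have C: "\<bar>c i\<bar> + d i \<le> C" for i
    unfolding C_def by (rule member_le_sum) (use d_nonneg in auto)
  have C0: "0 \<le> C" unfolding C_def by (intro sum_nonneg) (use d_nonneg in auto)
  define M where "M = (\<Sum>i\<in>UNIV. \<Sum>j\<in>UNIV. \<bar>T $ i $ j\<bar>)"
  have M': "(\<Sum>i\<in>UNIV. \<bar>T $ i $ j\<bar>) \<le> M" for j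
    unfolding M_def by (intro sum_mono member_le_sum) auto
  have M: "\<bar>T $ i $ j\<bar> \<le> M" for i j
    by (rule order_trans [OF _ M']) (rule member_le_sum, auto)
  have M0: "0 \<le> M" unfolding M_def by (intro sum_nonneg) auto
  define n where "n = real CARD('s)"
  have n: "n \<ge> 0" by (simp add: n_def)
  define p where "p h i j = mexp (h *\<^sub>R T) $ i $ j" for h i j
  have p1: "\<bar>p h i j - mat 1 $ i $ j\<bar> \<le> (K1 + M) * h" if "0 < h" "h \<le> 1" for h i j
  proof -
    have "h\<^sup>2 \<le> h" using that by (simp add: power2_eq_square mult_left_le)
    then have "K1 * h\<^sup>2 \<le> K1 * h" using K1 by (intro mult_left_mono) auto
    moreover have "\<bar>h * T $ i $ j\<bar> \<le> h * M" unfolding abs_mult using that M by (intro mult_mono) auto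
    moreover have "\<bar>p h i j - mat 1 $ i $ j - h * T $ i $ j\<bar> \<le> K1 * h\<^sup>2"
      using K1(2) [of h i j] that by (simp add: p_def)
    ultimately show ?thesis by (simp add: algebra_simps)
  qed
  \<comment> \<open>\<open>K1 + M\<close> bounds the distance of the transition matrix from the
    identity. The interior error collects \<open>L * C\<close> (source),
    \<open>2 * L * C * M\<close> (coupling) and \<open>n * K1 * L\<close> (Taylor remainder); the
    boundary error collects \<open>L * C\<close> (size of \<open>H\<close>), \<open>L\<close>
    (source) and \<open>n * (K1 + M) * L\<close> (transitions).\<close>
  define K where "K = (K1 + M) + L * C + 2 * L * C * M + n * K1 * L + L + n * (K1 + M) * L"
  have nn: "0 \<le> L * C" "0 \<le> 2 * L * C * M" "0 \<le> n * K1 * L" "0 \<le> n * (K1 + M) * L"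
    using L_nonneg C0 M0 K1 n by auto
  have K: "K1 + M \<le> K" "L * C + 2 * L * C * M + n * K1 * L \<le> K" "L * C + L + n * (K1 + M) * L \<le> K"
    using L_nonneg M0 K1(1) nn unfolding K_def by auto
  have shift: "\<bar>v - (v - c i * h)\<bar> + \<bar>y - (y - d i * h)\<bar> \<le> C * h" if "0 \<le> h" for v y h i
  proof -
    have "\<bar>c i * h\<bar> + \<bar>d i * h\<bar> = (\<bar>c i\<bar> + d i) * h"
      using that d_nonneg [of i] by (simp add: abs_mult distrib_right)
    also have "\<dots> \<le> C * h" using C that by (intro mult_right_mono)
    finally show ?thesis by simp
  qed
  have mat_sum: "(\<Sum>i\<in>UNIV. mat 1 $ i $ j * g i) = g j" for j and g :: "'s \<Rightarrow> real"
    by (simp add: mat_def if_distrib [of "\<lambda>x. x * _"] cong: if_cong)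
  show ?thesis
  proof
    show "K \<ge> 0" using K(1) K1 M0 by linarith
    fix h :: real and i j assume "0 < h" "h \<le> 1"
    then show "\<bar>mexp (h *\<^sub>R T) $ i $ j - mat 1 $ i $ j\<bar> \<le> K * h"
      using p1 [of h i j] mult_right_mono [OF K(1), of h] by (simp add: p_def order_trans)
  next
    fix h v y :: real and j
    assume h: "0 < h" "h \<le> 1" and vy: "0 \<le> v" "y \<in> {0..ym}" and int: "0 \<le> v - c j * h" "0 \<le> y - d j * h"
    let ?g = "\<lambda>i. Hx (v - c i * h) (y - d i * h) i"
    obtain s where s: "s \<in> {0..h}" and eq: "H v y j - H (v - c j * h) (y - d j * h) j =
         h * (F0 (v - c j * s) j + (\<Sum>i\<in>UNIV. T $ i $ j * H (v - c j * s) (y - d j * s) i))"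
      using H_char [OF vy h(1) int] by blast
    let ?vs = "v - c j * s" and ?ys = "y - d j * s"
    \<comment> \<open>The intermediate point lies between the two ends of the characteristic, and
      both ends have nonnegative level.\<close>
    have "min v (v - c j * h) \<le> ?vs"
    proof (cases "c j \<ge> 0")
      case True then show ?thesis using s mult_left_mono [of s h "c j"] by auto
    next
      case False then show ?thesis using s by (auto simp: mult_nonpos_nonneg min_def)
    qed
    then have vs: "0 \<le> ?vs" using vy int by linarith
    have "d j * s \<le> d j * h" "0 \<le> d j * s" using s d_nonneg by (auto intro!: mult_left_mono)
    then have ys: "?ys \<in> {0..ym}" using vy int by auto
    have e1: "\<bar>F0 ?vs j - F0 v j\<bar> \<le> L * (C * h)"
    proof -
      have "\<bar>F0 ?vs j - F0 v j\<bar> \<le> L * \<bar>?vs - v\<bar>" using vs vy(1) by (rule F0_lip)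
      also have "\<bar>?vs - v\<bar> \<le> C * s" using shift [of s v j y] s by auto
      also have "C * s \<le> C * h" using s C0 by (intro mult_left_mono) auto
      finally show ?thesis using L_nonneg by (auto intro: mult_left_mono order_trans)
    qed
    have e2: "\<bar>H ?vs ?ys i - ?g i\<bar> \<le> 2 * L * (C * h)" for i
    proof -
      have "\<bar>H v y i - ?g i\<bar> \<le> L * (\<bar>v - (v - c i * h)\<bar> + \<bar>y - (y - d i * h)\<bar>)"
      proof (rule Hx_lip [OF vy])
        show "y - d i * h \<le> ym" using vy h d_nonneg [of i] by (auto intro: order_trans [of _ y])
        show "0 \<le> v - c i * h \<or> 0 < c i"
          using vy h by (cases "c i > 0") (auto simp: not_less mult_nonpos_nonneg intro: order_trans [of _ 0])
      qed
      also have "\<dots> \<le> L * (C * h)" using h by (intro mult_left_mono shift L_nonneg) auto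
      finally have 1: "\<bar>H v y i - ?g i\<bar> \<le> L * (C * h)" .
      have "\<bar>H v y i - H ?vs ?ys i\<bar> \<le> L * (\<bar>v - ?vs\<bar> + \<bar>y - ?ys\<bar>)"
        using vy vs ys by (intro H_lip)
      also have "\<dots> \<le> L * (C * s)" using s by (intro mult_left_mono shift L_nonneg) auto
      also have "\<dots> \<le> L * (C * h)" using s C0 by (intro mult_left_mono L_nonneg) auto
      finally show ?thesis using 1 by (simp add: algebra_simps)
    qed
    have gj: "?g j = H (v - c j * h) (y - d j * h) j" using int by (simp add: Hx_def)
    \<comment> \<open>The identity part of the transition matrix contributes exactly
      \<open>?g j\<close>, the value at the foot of the characteristic. What remains are the
      variation of the source, the variation of the coupling and the Taylor remainder.\<close>
    have "H v y j - (h * F0 v j + (\<Sum>i\<in>UNIV. p h i j * ?g i)) =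
       h * (F0 ?vs j - F0 v j) + h * (\<Sum>i\<in>UNIV. T $ i $ j * (H ?vs ?ys i - ?g i))
       - (\<Sum>i\<in>UNIV. (p h i j - mat 1 $ i $ j - h * T $ i $ j) * ?g i)"
    proof -
      have "(\<Sum>i\<in>UNIV. T $ i $ j * (H ?vs ?ys i - ?g i)) =
          (\<Sum>i\<in>UNIV. T $ i $ j * H ?vs ?ys i) - (\<Sum>i\<in>UNIV. T $ i $ j * ?g i)"
        by (simp only: right_diff_distrib sum_subtractf)
      moreover have "(\<Sum>i\<in>UNIV. (p h i j - mat 1 $ i $ j - h * T $ i $ j) * ?g i) =
          (\<Sum>i\<in>UNIV. p h i j * ?g i) - ?g j - h * (\<Sum>i\<in>UNIV. T $ i $ j * ?g i)"
        by (simp only: left_diff_distrib sum_subtractf mat_sum sum_distrib_left mult.assoc)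
      ultimately show ?thesis
        using eq unfolding gj [symmetric] by (simp only: right_diff_distrib distrib_left)
    qed
    also have "\<bar>\<dots>\<bar> \<le> h * (L * (C * h)) + h * (M * (2 * L * (C * h))) + n * (K1 * h\<^sup>2 * L)"
    proof -
      have "\<bar>h * (F0 ?vs j - F0 v j)\<bar> \<le> h * (L * (C * h))"
        using h e1 by (simp add: abs_mult)
      moreover have 2: "\<bar>\<Sum>i\<in>UNIV. T $ i $ j * (H ?vs ?ys i - ?g i)\<bar> \<le> M * (2 * L * (C * h))"
      proof -
        have "\<bar>\<Sum>i\<in>UNIV. T $ i $ j * (H ?vs ?ys i - ?g i)\<bar> \<le> (\<Sum>i\<in>UNIV. \<bar>T $ i $ j\<bar> * (2 * L * (C * h)))"
          by (rule order_trans [OF sum_abs sum_mono]) (use e2 in \<open>auto simp: abs_mult intro!: mult_left_mono\<close>)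
        also have "\<dots> \<le> M * (2 * L * (C * h))"
          unfolding sum_distrib_right [symmetric]
          using M' L_nonneg C0 h by (intro mult_right_mono) auto
        finally show ?thesis .
      qed
      moreover have "\<bar>\<Sum>i\<in>UNIV. (p h i j - mat 1 $ i $ j - h * T $ i $ j) * ?g i\<bar> \<le> n * (K1 * h\<^sup>2 * L)"
      proof -
        have "\<bar>\<Sum>i\<in>UNIV. (p h i j - mat 1 $ i $ j - h * T $ i $ j) * ?g i\<bar> \<le> (\<Sum>i\<in>(UNIV::'s set). K1 * h\<^sup>2 * L)"
        proof (rule order_trans [OF sum_abs sum_mono])
          fix i
          have "y - d i * h \<le> ym" using vy h d_nonneg [of i] by (auto intro: order_trans [of _ y])
          then show "\<bar>(p h i j - mat 1 $ i $ j - h * T $ i $ j) * ?g i\<bar> \<le> K1 * h\<^sup>2 * L"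
            unfolding abs_mult p_def using h K1 L_nonneg
            by (intro mult_mono Hx_bound K1(2)) auto
        qed
        then show ?thesis by (simp add: n_def)
      qed
      moreover from 2 have "\<bar>h * (\<Sum>i\<in>UNIV. T $ i $ j * (H ?vs ?ys i - ?g i))\<bar> \<le> h * (M * (2 * L * (C * h)))"
        unfolding abs_mult [of h] using h by (intro mult_mono) auto
      ultimately show ?thesis by linarith
    qed
    also have "\<dots> = (L * C + 2 * L * C * M + n * K1 * L) * h\<^sup>2"
      by (simp add: algebra_simps power2_eq_square)
    also have "\<dots> \<le> K * h\<^sup>2" using K(2) by (intro mult_right_mono) auto
    finally show "\<bar>H v y j - (h * F0 v j + (\<Sum>i\<in>UNIV. mexp (h *\<^sub>R T) $ i $ j * ?g i))\<bar> \<le> K * h\<^sup>2"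
      by (simp add: p_def)
  next
    fix h v y :: real and j
    assume h: "0 < h" "h \<le> 1" and vy: "0 \<le> v" "y \<in> {0..ym}" and bd: "v - c j * h < 0 \<or> y - d j * h < 0"
    let ?g = "\<lambda>i. Hx (v - c i * h) (y - d i * h) i"
    have ym: "y - d i * h \<le> ym" for i
      using vy h d_nonneg [of i] by (auto intro: order_trans [of _ y])
    have gj: "?g j = 0" using bd by (auto simp: Hx_def)
    have "\<bar>H v y j - ?g j\<bar> \<le> L * (\<bar>v - (v - c j * h)\<bar> + \<bar>y - (y - d j * h)\<bar>)"
    proof (rule Hx_lip [OF vy ym])
      show "0 \<le> v - c j * h \<or> 0 < c j"
        using vy h by (cases "c j > 0") (auto simp: not_less mult_nonpos_nonneg intro: order_trans [of _ 0])
    qed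
    also have "\<dots> \<le> L * (C * h)" using h by (intro mult_left_mono shift L_nonneg) auto
    finally have 1: "\<bar>H v y j\<bar> \<le> L * (C * h)" using gj by simp
    have 2: "\<bar>h * F0 v j\<bar> \<le> h * L" using h F0_bound [OF vy(1)] by (simp add: abs_mult)
    \<comment> \<open>Since \<open>?g j = 0\<close>, the identity matrix can be subtracted at no
      cost, which leaves coefficients of order \<open>h\<close>.\<close>
    have "(\<Sum>i\<in>UNIV. p h i j * ?g i) = (\<Sum>i\<in>UNIV. (p h i j - mat 1 $ i $ j) * ?g i)"
      using mat_sum [of j ?g] gj by (simp add: algebra_simps sum_subtractf)
    also have "\<bar>\<dots>\<bar> \<le> (\<Sum>i\<in>(UNIV::'s set). (K1 + M) * h * L)"
      by (rule order_trans [OF sum_abs sum_mono])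
        (use h K1(1) M0 L_nonneg p1 Hx_bound [OF ym] in \<open>auto simp: abs_mult intro!: mult_mono\<close>)
    finally have "\<bar>\<Sum>i\<in>UNIV. p h i j * ?g i\<bar> \<le> n * (K1 + M) * L * h" by (simp add: n_def mult_ac)
    with 1 2 have "\<bar>H v y j - (h * F0 v j + (\<Sum>i\<in>UNIV. p h i j * ?g i))\<bar> \<le> (L * C + L + n * (K1 + M) * L) * h"
      by (simp add: algebra_simps)
    also have "\<dots> \<le> K * h" using K(3) h by (intro mult_right_mono) auto
    finally show "\<bar>H v y j - (h * F0 v j + (\<Sum>i\<in>UNIV. mexp (h *\<^sub>R T) $ i $ j * ?g i))\<bar> \<le> K * h"
      by (simp add: p_def)
  qed
qed

text \<open>A discrete Gronwall estimate. The condition \<open>y \<le> real n * (m * h)\<close> says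
  that \<open>n\<close> steps are enough for the clock to reach \<open>y\<close>. It is inherited in
  the recursion, because each step lowers \<open>y\<close> by at least \<open>m * h\<close>; with no
  steps left it forces \<open>y = 0\<close>, where \<open>u\<close> and \<open>H\<close> both
  vanish.\<close>

lemma grid_error:
  obtains K where "K \<ge> 0"
    "\<And>h u n v y j. 0 < h \<Longrightarrow> h \<le> 1 \<Longrightarrow>
       (\<And>v y j. u 0 v y j = 0) \<Longrightarrow>
       (\<And>n v y j. v < 0 \<or> y < 0 \<Longrightarrow> u n v y j = 0) \<Longrightarrow>
       (\<And>n v y j. 0 \<le> v \<Longrightarrow> 0 \<le> y \<Longrightarrow> u (Suc n) v y j =
          h * F0 v j + (\<Sum>i\<in>UNIV. mexp (h *\<^sub>R T) $ i $ j * u n (v - c i * h) (y - d i * h) i)) \<Longrightarrow>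
       (\<And>i. m \<le> d i) \<Longrightarrow> 0 \<le> v \<Longrightarrow> y \<in> {0..ym} \<Longrightarrow> y \<le> real n * (m * h) \<Longrightarrow>
       \<bar>u n v y j - H v y j\<bar> \<le> K * h * (1 + K * h) ^ n"
proof -
  obtain K where K: "K \<ge> 0"
    "\<And>h i j. 0 < h \<Longrightarrow> h \<le> 1 \<Longrightarrow> \<bar>mexp (h *\<^sub>R T) $ i $ j - mat 1 $ i $ j\<bar> \<le> K * h"
    "\<And>h v y j. 0 < h \<Longrightarrow> h \<le> 1 \<Longrightarrow> 0 \<le> v \<Longrightarrow> y \<in> {0..ym} \<Longrightarrow>
       0 \<le> v - c j * h \<Longrightarrow> 0 \<le> y - d j * h \<Longrightarrow>
       \<bar>H v y j - (h * F0 v j + (\<Sum>i\<in>UNIV. mexp (h *\<^sub>R T) $ i $ j * Hx (v - c i * h) (y - d i * h) i))\<bar> \<le> K * h\<^sup>2"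
    "\<And>h v y j. 0 < h \<Longrightarrow> h \<le> 1 \<Longrightarrow> 0 \<le> v \<Longrightarrow> y \<in> {0..ym} \<Longrightarrow>
       v - c j * h < 0 \<or> y - d j * h < 0 \<Longrightarrow>
       \<bar>H v y j - (h * F0 v j + (\<Sum>i\<in>UNIV. mexp (h *\<^sub>R T) $ i $ j * Hx (v - c i * h) (y - d i * h) i))\<bar> \<le> K * h"
    using consistency by blast
  define n0 where "n0 = real CARD('s)"
  have n0: "n0 \<ge> 0" by (simp add: n0_def)
  \<comment> \<open>\<open>n0 * K\<close> pays for the transitions away from the identity and
    \<open>K\<close> for the local error, both relative to the inherited error. The summand 1
    ensures \<open>h \<le> b n\<close>, so that a local error of order \<open>h^2\<close> is at most
    a multiple of \<open>h * b n\<close>.\<close>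
  define K' where "K' = 2 * (K + n0 * K) + 1"
  have K': "K' \<ge> 1" "K \<le> K'" "2 * (K + n0 * K) \<le> K'" using K n0 by (auto simp: K'_def)
  show ?thesis
  proof
    show "K' \<ge> 0" using K' by simp
    fix h :: real and u :: "nat \<Rightarrow> real \<Rightarrow> real \<Rightarrow> 's \<Rightarrow> real" and n v y j
    assume h: "0 < h" "h \<le> 1" and u0: "\<And>v y j. u 0 v y j = 0"
      and uneg: "\<And>n v y j. v < 0 \<or> y < 0 \<Longrightarrow> u n v y j = 0"
      and urec: "\<And>n v y j. 0 \<le> v \<Longrightarrow> 0 \<le> y \<Longrightarrow> u (Suc n) v y j =
          h * F0 v j + (\<Sum>i\<in>UNIV. mexp (h *\<^sub>R T) $ i $ j * u n (v - c i * h) (y - d i * h) i)"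
      and m: "\<And>i. m \<le> d i"
    define p where "p i j = mexp (h *\<^sub>R T) $ i $ j" for i j
    define b where "b n = K' * h * (1 + K' * h) ^ n" for n
    have b: "K' * h \<le> b n" for n
      unfolding b_def using h K' one_le_power [of "1 + K' * h" n] mult_left_mono [of 1 "(1 + K' * h) ^ n" "K' * h"] by simp
    have b_Suc: "b (Suc n) = b n + K' * h * b n" for n by (simp add: b_def algebra_simps)
    have "\<bar>u n v y j - H v y j\<bar> \<le> b n"
      if "0 \<le> v" "y \<in> {0..ym}" "y \<le> real n * (m * h)" for n v y j
      using that
    proof (induction n arbitrary: v y j)
      case 0
      then have "y = 0" by auto
      then show ?case using 0 b [of 0] K' h by (simp add: u0 H_clock_0 b_def)
    next
      case (Suc n)
      let ?g = "\<lambda>i. Hx (v - c i * h) (y - d i * h) i"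
      let ?u = "\<lambda>i. u n (v - c i * h) (y - d i * h) i"
      have IH: "\<bar>?u i - ?g i\<bar> \<le> b n" for i
      proof (cases "v - c i * h < 0 \<or> y - d i * h < 0")
        case True
        then show ?thesis using uneg [OF True] b [of n] K' h
          by (auto simp: Hx_def intro: order_trans [of _ "K' * h"])
      next
        case False
        have "m * h \<le> d i * h" using m h by (intro mult_right_mono) auto
        then have "y - d i * h \<le> real n * (m * h)" using Suc.prems by (simp add: algebra_simps)
        moreover have "0 \<le> d i * h" using d_nonneg h by auto
        ultimately have "\<bar>?u i - H (v - c i * h) (y - d i * h) i\<bar> \<le> b n"
          using False Suc.prems by (intro Suc.IH) auto
        then show ?thesis using False by (simp add: Hx_def)
      qed
      have tri: "\<bar>x + y - z\<bar> \<le> \<bar>x\<bar> + \<bar>y\<bar> + \<bar>z\<bar>" for x y z :: real by linarith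
      have aux1: "s + d + e \<le> \<beta> + W"
        if "d \<le> 0" "e \<le> z" "z \<le> \<beta>" "0 \<le> q" "0 \<le> x" "s \<le> x" "2 * (x + q) \<le> W" for s d e x z \<beta> q W :: real
        using that by argo
      have aux2: "s + d + e \<le> \<beta> + W"
        if "e \<le> z" "z \<le> q" "0 \<le> q" "0 \<le> x" "s \<le> x" "2 * (x + q) \<le> W" "d \<le> \<beta>" for s d e x z \<beta> q W :: real
        using that by argo
      define R where "R = h * F0 v j + (\<Sum>i\<in>UNIV. p i j * ?g i)"
      have diff: "u (Suc n) v y j - H v y j = (\<Sum>i\<in>UNIV. (p i j - mat 1 $ i $ j) * (?u i - ?g i))
           + (?u j - ?g j) - (H v y j - R)"
      proof -
        have "(\<Sum>i\<in>UNIV. mat 1 $ i $ j * g i) = g j" for g :: "'s \<Rightarrow> real"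
          by (simp add: mat_def if_distrib [of "\<lambda>x. x * _"] cong: if_cong)
        from this [of ?g] this [of ?u] show ?thesis
          using urec [of v y n j] Suc.prems
          by (simp add: R_def p_def algebra_simps sum_subtractf sum.distrib)
      qed
      have "\<bar>\<Sum>i\<in>UNIV. (p i j - mat 1 $ i $ j) * (?u i - ?g i)\<bar> \<le> (\<Sum>i\<in>(UNIV::'s set). K * h * b n)"
        by (rule order_trans [OF sum_abs sum_mono])
          (use h K(1) IH K(2) [OF h] in \<open>auto simp: abs_mult p_def intro!: mult_mono\<close>)
      then have sum: "\<bar>\<Sum>i\<in>UNIV. (p i j - mat 1 $ i $ j) * (?u i - ?g i)\<bar> \<le> n0 * K * (h * b n)"
        by (simp add: n0_def mult_ac)
      have "0 \<le> K' * h" using K' h by simp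
      then have "0 \<le> b n" using b [of n] by linarith
      then have hb: "0 \<le> h * b n" "0 \<le> b n" using h by auto
      have "1 * h \<le> K' * h" using h by (intro mult_right_mono K'(1)) auto
      then have "h \<le> b n" using b [of n] by linarith
      then have hh: "h * h \<le> h * b n" using h by (intro mult_left_mono) auto
      have half: "2 * (n0 * K * (h * b n) + K * (h * b n)) \<le> K' * h * b n"
        using mult_right_mono [OF K'(3) hb(1)] by (simp add: algebra_simps)
      show ?case
      \<comment> \<open>Outside the quadrant the diagonal term inherits no error, so the whole
        allowance \<open>b n\<close> is free to absorb \<open>K * h\<close>. Otherwise the diagonal
        term uses up \<open>b n\<close>, and the local error has to fit into the increment
        \<open>K' * h * b n\<close>.\<close>
      proof (cases "v - c j * h < 0 \<or> y - d j * h < 0")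
        case True
        have "\<bar>?u j - ?g j\<bar> \<le> 0" using True uneg [OF True] by (auto simp: Hx_def)
        moreover have "\<bar>H v y j - R\<bar> \<le> K * h"
          unfolding R_def p_def using Suc.prems by (intro K(4) h True) auto
        moreover have "K * h \<le> b n"
          using b [of n] K'(2) h mult_right_mono [OF K'(2), of h] by linarith
        moreover have "0 \<le> K * (h * b n)" "0 \<le> n0 * K * (h * b n)" using K hb n0 by auto
        ultimately show ?thesis
          using sum half unfolding diff b_Suc by (intro order_trans [OF tri] aux1)
      next
        case False
        have "\<bar>H v y j - R\<bar> \<le> K * h\<^sup>2"
          unfolding R_def p_def using Suc.prems False by (intro K(3) h) auto
        moreover have "K * h\<^sup>2 \<le> K * (h * b n)"
          using mult_left_mono [OF hh K(1)] by (simp add: power2_eq_square)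
        moreover have "0 \<le> K * (h * b n)" "0 \<le> n0 * K * (h * b n)" using K hb n0 by auto
        ultimately show ?thesis
          using sum half IH [of j] unfolding diff b_Suc by (intro order_trans [OF tri] aux2)
      qed
    qed
    then show "0 \<le> v \<Longrightarrow> y \<in> {0..ym} \<Longrightarrow> y \<le> real n * (m * h) \<Longrightarrow>
       \<bar>u n v y j - H v y j\<bar> \<le> K' * h * (1 + K' * h) ^ n"
      by (simp add: b_def)
  qed
qed

end

section \<open>Paths of the level and of the clock\<close>


text \<open>A mean value inequality for one-sided derivatives, which may differ from the left ones
  at jumps. At the last point where \<open>g\<close> lies on or below the line of slope
  \<open>m + e\<close> through its starting value, a right derivative of at most \<open>m\<close>
  would keep \<open>g\<close> below that line a little longer, unless this point is
  \<open>b\<close>.\<close>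

lemma right_deriv_upper:
  fixes g :: "real \<Rightarrow> real"
  assumes ab: "a \<le> b" and cont: "continuous_on {a..b} g"
    and D: "\<And>t. a \<le> t \<Longrightarrow> t < b \<Longrightarrow> \<exists>D\<le>m. (g has_real_derivative D) (at_right t)"
  shows "g b - g a \<le> m * (b - a)"
proof -
  have "g b - g a \<le> m * (b - a) + e * (b - a)" if "e > 0" for e
  proof -
    define K where "K = {t \<in> {a..b}. g t \<le> g a + (m + e) * (t - a)}"
    have "closed K" unfolding K_def
      by (intro continuous_on_closed_Collect_le continuous_intros cont)
    moreover have "bounded K" by (rule bounded_subset [of "{a..b}"]) (auto simp: K_def)
    ultimately have "compact K" by (simp add: compact_eq_bounded_closed)
    moreover have "a \<in> K" using ab by (simp add: K_def)
    ultimately obtain t where t: "t \<in> K" "\<And>s. s \<in> K \<Longrightarrow> s \<le> t"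
      using compact_attains_sup [of K] by blast
    have "t = b"
    proof (rule ccontr)
      assume "t \<noteq> b"
      then have tb: "a \<le> t" "t < b" using t(1) by (auto simp: K_def)
      obtain D where D': "D \<le> m" "(g has_real_derivative D) (at_right t)"
        using D [OF tb] by blast
      then have "((\<lambda>s. (g s - g t) / (s - t)) \<longlongrightarrow> D) (at_right t)"
        by (simp add: has_field_derivative_iff)
      then have "eventually (\<lambda>s. (g s - g t) / (s - t) < m + e) (at_right t)"
        using D'(1) that by (intro order_tendstoD) auto
      moreover have "eventually (\<lambda>s. s \<in> {t<..<b}) (at_right t)"
        by (rule eventually_at_right_real [OF \<open>t < b\<close>])
      ultimately have "eventually (\<lambda>s. s \<in> {t<..<b} \<and> (g s - g t) / (s - t) < m + e) (at_right t)"
        by eventually_elim auto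
      then obtain s where s: "t < s" "s < b" "(g s - g t) / (s - t) < m + e"
        using eventually_happens trivial_limit_at_right_real by fastforce
      then have "g s - g t < (m + e) * (s - t)" by (simp add: divide_less_eq)
      moreover have "g t \<le> g a + (m + e) * (t - a)" using t by (simp add: K_def)
      ultimately have "g s \<le> g a + (m + e) * (s - a)" by (simp add: algebra_simps)
      then have "s \<in> K" using s tb by (auto simp: K_def)
      then show False using t(2) s by fastforce
    qed
    then show ?thesis using t(1) by (simp add: K_def algebra_simps)
  qed
  then have "g b - g a - m * (b - a) \<le> e" if "e > 0" for e
  proof -
    \<comment> \<open>The slack in the slope is rescaled so that the total slack is at most
      \<open>e\<close>; the summand 1 covers \<open>a = b\<close>.\<close>
    have "e / (b - a + 1) * (b - a) \<le> e" using that ab by (simp add: field_simps)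
    moreover have "g b - g a \<le> m * (b - a) + e / (b - a + 1) * (b - a)"
      by (rule \<open>\<And>e. e > 0 \<Longrightarrow> _\<close>) (use that ab in auto)
    ultimately show ?thesis by linarith
  qed
  then show ?thesis using field_le_epsilon [of "g b - g a - m * (b - a)" 0] by auto
qed

lemma right_deriv_lower:
  fixes g :: "real \<Rightarrow> real"
  assumes ab: "a \<le> b" and cont: "continuous_on {a..b} g"
    and D: "\<And>t. a \<le> t \<Longrightarrow> t < b \<Longrightarrow> \<exists>D\<ge>m. (g has_real_derivative D) (at_right t)"
  shows "g b - g a \<ge> m * (b - a)"
proof -
  have "- g b - (- g a) \<le> - m * (b - a)"
  proof (rule right_deriv_upper [OF ab])
    show "continuous_on {a..b} (\<lambda>x. - g x)" by (intro continuous_intros cont)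
    fix t assume "a \<le> t" "t < b"
    then obtain D where "D \<ge> m" "(g has_real_derivative D) (at_right t)" using D by blast
    then show "\<exists>D\<le>-m. ((\<lambda>x. - g x) has_real_derivative D) (at_right t)"
      by (intro exI [of _ "- D"]) (auto intro: DERIV_minus)
  qed
  then show ?thesis by simp
qed

section \<open>Reflected level paths with one-sided derivatives\<close>

context
  fixes c :: "'s \<Rightarrow> real" and f :: "real \<Rightarrow> 's" and X :: "real \<Rightarrow> real"
  assumes level: "level_path c f X"
begin

lemma level_nonneg: "t \<ge> 0 \<Longrightarrow> X t \<ge> 0"
  using level by (simp add: level_path_def)

lemma level_deriv:
  "t \<ge> 0 \<Longrightarrow> (X has_real_derivative (if X t > 0 then c (f t) else max 0 (c (f t)))) (at_right t)"
  using level by (simp add: level_path_def)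

lemma level_cont: "a \<ge> 0 \<Longrightarrow> continuous_on {a..b} X"
  using level continuous_on_subset [of "{0..}" X "{a..b}"] by (auto simp: level_path_def)

lemma level_path_lipschitz:
  assumes C: "\<And>i. \<bar>c i\<bar> \<le> C" and "0 \<le> a" "a \<le> b"
  shows "\<bar>X b - X a\<bar> \<le> C * (b - a)"
proof -
  let ?D = "\<lambda>t. if X t > 0 then c (f t) else max 0 (c (f t))"
  have D: "?D t \<le> C" "- C \<le> ?D t" for t
    using C [of "f t"] by auto
  have "X b - X a \<le> C * (b - a)"
  proof (rule right_deriv_upper)
    show "\<exists>D\<le>C. (X has_real_derivative D) (at_right t)" if "a \<le> t" for t
      using D(1) level_deriv [of t] that assms by (intro exI [of _ "?D t"] conjI) auto
  qed (use assms level_cont in auto)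
  moreover have "X b - X a \<ge> (- C) * (b - a)"
  proof (rule right_deriv_lower)
    show "\<exists>D\<ge>-C. (X has_real_derivative D) (at_right t)" if "a \<le> t" for t
      using D(2) level_deriv [of t] that assms by (intro exI [of _ "?D t"] conjI) auto
  qed (use assms level_cont in auto)
  ultimately show ?thesis by linarith
qed

text \<open>The right derivative is never below \<open>c i\<close>, which gives one inequality. For
  negative \<open>c i\<close> the path does not increase, so a positive end value means that 0 was
  never touched and the slope was exactly \<open>c i\<close>; an end value 0 agrees with the lower
  bound. The phase at \<open>b\<close> is left free, so \<open>b\<close> may be a jump time.\<close>

lemma level_path_step:
  assumes "0 \<le> a" "a \<le> b" and f: "\<And>t. a \<le> t \<Longrightarrow> t < b \<Longrightarrow> f t = i"
  shows "X b = max 0 (X a + c i * (b - a))"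
proof -
  have lower: "X b - X a \<ge> c i * (b - a)"
  proof (rule right_deriv_lower)
    fix t assume "a \<le> t" "t < b"
    then show "\<exists>D\<ge>c i. (X has_real_derivative D) (at_right t)"
      using level_deriv [of t] f [of t] assms by (intro exI conjI) (auto split: if_splits)
  qed (use assms level_cont in auto)
  have nonneg: "X a \<ge> 0" "X b \<ge> 0" using assms level_nonneg by auto
  show ?thesis
  proof (cases "c i \<ge> 0")
    case True
    have "X b - X a \<le> c i * (b - a)"
    proof (rule right_deriv_upper)
      fix t assume "a \<le> t" "t < b"
      then show "\<exists>D\<le>c i. (X has_real_derivative D) (at_right t)"
        using level_deriv [of t] f [of t] assms True by (intro exI conjI) (auto split: if_splits)
    qed (use assms level_cont in auto)
    with lower nonneg show ?thesis by auto
  next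
    case False
    have anti: "X b - X s \<le> 0 * (b - s)" if "a \<le> s" "s \<le> b" for s
    proof (rule right_deriv_upper)
      fix t assume "s \<le> t" "t < b"
      then show "\<exists>D\<le>0. (X has_real_derivative D) (at_right t)"
        using level_deriv [of t] f [of t] assms False that by (intro exI conjI) (auto split: if_splits)
    qed (use assms level_cont that in auto)
    show ?thesis
    proof (cases "X b > 0")
      case True
      have "X b - X a \<le> c i * (b - a)"
      proof (rule right_deriv_upper)
        fix t assume t: "a \<le> t" "t < b"
        then have "X t > 0" using anti [of t] True by simp
        then show "\<exists>D\<le>c i. (X has_real_derivative D) (at_right t)"
          using level_deriv [of t] f [of t] assms t by (intro exI conjI) (auto split: if_splits)
      qed (use assms level_cont in auto)
      with lower nonneg show ?thesis by auto
    next
      case False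
      with lower nonneg show ?thesis by auto
    qed
  qed
qed

end

text \<open>By bisection: near a point \<open>x\<close> the one-sided limits leave \<open>x\<close>
  as the only possible jump. The half-open interval fits right continuity, since a jump at
  \<open>a\<close> is already contained in \<open>f a\<close> while a jump at \<open>b\<close>
  separates the two values.\<close>

lemma cadlag_jumps:
  assumes f: "cadlag_path f" and "0 \<le> \<tau>"
  obtains J where "finite J"
    "\<And>a b. 0 \<le> a \<Longrightarrow> a \<le> b \<Longrightarrow> b \<le> \<tau> \<Longrightarrow> {a<..b} \<inter> J = {} \<Longrightarrow> f b = f a"
proof -
  \<comment> \<open>The local step of \<open>Bolzano\<close> also considers intervals that reach
    below 0, where nothing is known about \<open>f\<close>; the premise \<open>0 \<le> l\<close>
    exempts them.\<close>
  define Q where "Q l u \<longleftrightarrow> 0 \<le> l \<longrightarrow> (\<exists>J. finite J \<and>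
     (\<forall>a b. l \<le> a \<longrightarrow> a \<le> b \<longrightarrow> b \<le> u \<longrightarrow> {a<..b} \<inter> J = {} \<longrightarrow> f b = f a))" for l u :: real
  have "Q 0 \<tau>"
    using \<open>0 \<le> \<tau>\<close>
  proof (induction rule: Bolzano)
    case (trans l m u)
    show ?case unfolding Q_def
    proof
      assume "0 \<le> l"
      obtain J1 where J1: "finite J1"
        "\<forall>a b. l \<le> a \<longrightarrow> a \<le> b \<longrightarrow> b \<le> m \<longrightarrow> {a<..b} \<inter> J1 = {} \<longrightarrow> f b = f a"
        using trans(1) \<open>0 \<le> l\<close> unfolding Q_def by blast
      have "0 \<le> m" using trans(3) \<open>0 \<le> l\<close> by linarith
      then obtain J2 where J2: "finite J2"
        "\<forall>a b. m \<le> a \<longrightarrow> a \<le> b \<longrightarrow> b \<le> u \<longrightarrow> {a<..b} \<inter> J2 = {} \<longrightarrow> f b = f a"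
        using trans(2) unfolding Q_def by blast
      have "f b = f a" if "l \<le> a" "a \<le> b" "b \<le> u" "{a<..b} \<inter> (J1 \<union> J2) = {}" for a b
      proof -
        consider "b \<le> m" | "m \<le> a" | "a \<le> m" "m \<le> b" by linarith
        then show ?thesis
        proof cases
          case 1
          then show ?thesis using J1(2) that by blast
        next
          case 2
          then show ?thesis using J2(2) that by blast
        next
          case 3
          have "{a<..m} \<subseteq> {a<..b}" "{m<..b} \<subseteq> {a<..b}" using 3 by auto
          then have "{a<..m} \<inter> J1 = {}" "{m<..b} \<inter> J2 = {}" using that(4) by blast+
          then have "f m = f a" "f b = f m" using J1(2) J2(2) that 3 by blast+
          then show ?thesis by simp
        qed
      qed
      then show "\<exists>J. finite J \<and> (\<forall>a b. l \<le> a \<longrightarrow> a \<le> b \<longrightarrow> b \<le> u \<longrightarrow> {a<..b} \<inter> J = {} \<longrightarrow> f b = f a)"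
        using J1(1) J2(1) by (intro exI [of _ "J1 \<union> J2"]) blast
    qed
  next
    case (local x)
    have "eventually (\<lambda>t. f t = f x) (at_right x)"
      using f local unfolding cadlag_path_def by blast
    then obtain d1 where d1: "d1 > x" "\<And>t. x < t \<Longrightarrow> t < d1 \<Longrightarrow> f t = f x"
      unfolding eventually_at_right_field by auto
    obtain d2 s where d2: "d2 < x" "\<And>t. 0 \<le> t \<Longrightarrow> d2 < t \<Longrightarrow> t < x \<Longrightarrow> f t = s"
    proof (cases "x > 0")
      case True
      then obtain s where "eventually (\<lambda>u. f u = s) (at_left x)"
        using f unfolding cadlag_path_def by blast
      then show ?thesis
        using that [of _ s] unfolding eventually_at_left_field by auto
    next
      case False
      then show ?thesis using that [of "x - 1"] by auto
    qed
    show ?case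
    proof (intro exI [of _ "min (d1 - x) (x - d2)"] conjI allI impI)
      fix l u assume lu: "l \<le> x \<and> x \<le> u \<and> u - l < min (d1 - x) (x - d2)"
      have "f b = f a" if "0 \<le> l" "l \<le> a" "a \<le> b" "b \<le> u" "{a<..b} \<inter> {x} = {}" for a b
      proof (cases "b < x")
        case True
        then show ?thesis using d2(2) [of a] d2(2) [of b] that lu by auto
      next
        case False
        then have "x \<le> a" using that by auto
        then show ?thesis using d1(2) [of a] d1(2) [of b] that lu
          by (cases "a = x"; cases "b = x") auto
      qed
      then show "Q l u" unfolding Q_def by (intro impI exI [of _ "{x}"]) blast
    qed (use d1 d2 in auto)
  qed
  then show ?thesis using that unfolding Q_def by auto
qed

text \<open>The Euler scheme of the reflected motion. With the rates \<open>\<bar>r i\<bar>\<close>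
  and start 0 the reflection never acts, so the same scheme serves as the discretised clock.\<close>

primrec disc_level :: "('s \<Rightarrow> real) \<Rightarrow> real \<Rightarrow> (nat \<Rightarrow> 's) \<Rightarrow> real \<Rightarrow> nat \<Rightarrow> real" where
  "disc_level c h s x 0 = x"
| "disc_level c h s x (Suc k) = max 0 (disc_level c h s x k + c (s k) * h)"

text \<open>A grid step without a jump is exact, and \<open>max 0\<close> does not enlarge the error
  carried along; a step with a jump adds at most \<open>2 * C * h\<close>. The bound depends on the
  path through the number of jumps, which is enough for limits taken path by path.\<close>

lemma disc_level_error:
  fixes X :: "real \<Rightarrow> real"
  assumes level: "level_path c f X" and C: "\<And>i. \<bar>c i\<bar> \<le> C" and "finite J"
    and J: "\<And>a b. 0 \<le> a \<Longrightarrow> a \<le> b \<Longrightarrow> b \<le> \<tau> \<Longrightarrow> {a<..b} \<inter> J = {} \<Longrightarrow> f b = f a"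
    and h: "0 \<le> h" and k: "real k * h \<le> \<tau>"
  shows "\<bar>disc_level c h (\<lambda>k. f (real k * h)) (X 0) k - X (real k * h)\<bar> \<le> 2 * C * h * card J"
proof -
  let ?x = "disc_level c h (\<lambda>k. f (real k * h)) (X 0)"
  have C0: "0 \<le> C" using C [of undefined] by linarith
  have "\<bar>?x k - X (real k * h)\<bar> \<le> 2 * C * h * card (J \<inter> {0<..real k * h})"
    using k
  proof (induction k)
    case 0
    then show ?case by simp
  next
    case (Suc k)
    let ?a = "real k * h" and ?b = "real (Suc k) * h"
    have ab: "0 \<le> ?a" "?a \<le> ?b" "?b - ?a = h" using h by (auto simp: algebra_simps)
    have IH: "\<bar>?x k - X ?a\<bar> \<le> 2 * C * h * card (J \<inter> {0<..?a})"
      using Suc ab by simp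
    have "J \<inter> {0<..b} = (J \<inter> {0<..a}) \<union> (J \<inter> {a<..b})" if "0 \<le> a" "a \<le> b" for a b
      using that by auto
    then have split: "J \<inter> {0<..?b} = (J \<inter> {0<..?a}) \<union> (J \<inter> {?a<..?b})"
      using ab by blast
    have card: "card (J \<inter> {0<..?b}) = card (J \<inter> {0<..?a}) + card (J \<inter> {?a<..?b})"
      unfolding split using \<open>finite J\<close> by (intro card_Un_disjoint) auto
    show ?case
    proof (cases "J \<inter> {?a<..?b} = {}")
      case True
      have "f t = f ?a" if "?a \<le> t" "t < ?b" for t
      proof (rule J)
        show "{?a<..t} \<inter> J = {}" using True that by auto
      qed (use that ab(1) Suc.prems in linarith)+
      then have "X ?b = max 0 (X ?a + c (f ?a) * (?b - ?a))"
        by (rule level_path_step [OF level ab(1,2)])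
      then have "X ?b = max 0 (X ?a + c (f ?a) * h)" unfolding ab(3) .
      then have "\<bar>?x (Suc k) - X ?b\<bar> \<le> \<bar>?x k - X ?a\<bar>"
        by (auto simp: max_def)
      then show ?thesis using IH card True by simp
    next
      case False
      then have "card (J \<inter> {?a<..?b}) \<ge> 1"
        using \<open>finite J\<close> by (simp add: Suc_le_eq card_gt_0_iff)
      then have "real (card (J \<inter> {0<..?a})) + 1 \<le> card (J \<inter> {0<..?b})"
        using card by simp
      then have "2 * C * h * (real (card (J \<inter> {0<..?a})) + 1) \<le> 2 * C * h * card (J \<inter> {0<..?b})"
        using C0 h by (intro mult_left_mono) auto
      moreover have "\<bar>X ?b - X ?a\<bar> \<le> C * h"
        using level_path_lipschitz [OF level C, of ?a ?b] ab by simp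
      moreover have "\<bar>?x (Suc k) - ?x k\<bar> \<le> C * h"
      proof -
        have "?x k \<ge> 0"
          by (cases k) (use level_nonneg [OF level, of 0] in auto)
        moreover have "\<bar>c (f ?a) * h\<bar> \<le> C * h"
          using C [of "f ?a"] h by (simp add: abs_mult mult_right_mono)
        ultimately show ?thesis by (auto simp: max_def)
      qed
      ultimately show ?thesis using IH by (simp add: algebra_simps)
    qed
  qed
  also have "\<dots> \<le> 2 * C * h * card J"
    using C0 h \<open>finite J\<close> by (intro mult_left_mono) (auto intro: card_mono)
  finally show ?thesis .
qed


section \<open>The clock as a level path, and its hitting times\<close>

lemma cadlag_measurable:
  fixes g :: "'s \<Rightarrow> real"
  assumes f: "cadlag_path f"
  shows "set_borel_measurable borel {0..} (\<lambda>u. g (f u))"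
  unfolding set_borel_measurable_def
proof (rule borel_measurable_LIMSEQ_real)
  \<comment> \<open>Rounding up to the grid of mesh \<open>1 / real (Suc n)\<close> approaches
    \<open>u\<close> from the right, so right continuity in the discrete topology makes the
    approximations eventually equal to the limit. Each of them factors through an integer.\<close>
  let ?x = "\<lambda>n u. real_of_int \<lceil>real (Suc n) * u\<rceil> / real (Suc n)"
  fix u :: real
  show "(\<lambda>n. indicator {0..} u *\<^sub>R g (f (?x n u))) \<longlonglongrightarrow> indicator {0..} u *\<^sub>R g (f u)"
  proof (cases "0 \<le> u")
    case True
    obtain d where d: "d > u" "\<And>t. u < t \<Longrightarrow> t < d \<Longrightarrow> f t = f u"
      using f True unfolding cadlag_path_def eventually_at_right_field by blast
    have lim: "(\<lambda>n. u + 1 / real (Suc n)) \<longlonglongrightarrow> u + 0"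
      by (intro tendsto_intros LIMSEQ_Suc lim_1_over_n)
    have "eventually (\<lambda>n. u + 1 / real (Suc n) < d) sequentially"
      by (rule order_tendstoD(2) [OF lim]) (use d in simp)
    then have "eventually (\<lambda>n. f (?x n u) = f u) sequentially"
    proof eventually_elim
      case (elim n)
      have "real (Suc n) * u \<le> real_of_int \<lceil>real (Suc n) * u\<rceil>"
        "real_of_int \<lceil>real (Suc n) * u\<rceil> < real (Suc n) * u + 1" by linarith+
      then have "u \<le> ?x n u" "?x n u < u + 1 / real (Suc n)"
        by (simp_all add: field_simps del: of_nat_Suc)
      then show ?case using d(2) [of "?x n u"] elim by (cases "?x n u = u") auto
    qed
    then show ?thesis
      by (intro tendsto_eventually, elim eventually_mono) simp
  qed simp
next
  fix n :: nat
  have "(\<lambda>u. \<lceil>real (Suc n) * u\<rceil>) \<in> borel \<rightarrow>\<^sub>M count_space UNIV"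
    by measurable
  from measurable_compose [OF this, of "\<lambda>k. g (f (real_of_int k / real (Suc n)))" borel]
  have "(\<lambda>u. g (f (real_of_int \<lceil>real (Suc n) * u\<rceil> / real (Suc n)))) \<in> borel_measurable borel"
    by simp
  then show "(\<lambda>u. indicator {0..} u *\<^sub>R g (f (real_of_int \<lceil>real (Suc n) * u\<rceil> / real (Suc n))))
      \<in> borel_measurable borel"
    by (intro borel_measurable_scaleR) auto
qed

text \<open>Viewing the clock as a level with positive drift makes the Lipschitz bound and the Euler
  estimate proved for levels available for it. Since the integrand is constant just after
  \<open>t\<close>, the right difference quotients are eventually constant.\<close>

lemma clock_level_path:
  fixes r :: "'s::finite \<Rightarrow> real"
  assumes f: "cadlag_path f"
  shows "level_path (\<lambda>i. \<bar>r i\<bar>) f (\<lambda>t. LBINT u:{0..t}. \<bar>r (f u)\<bar>)"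
proof -
  define g where "g u = \<bar>r (f u)\<bar>" for u
  define Y where "Y t = (LBINT u:{0..t}. g u)" for t
  define R where "R = (\<Sum>i\<in>UNIV. \<bar>r i\<bar>)"
  have R: "\<bar>g u\<bar> \<le> R" for u
    unfolding R_def g_def by simp (rule member_le_sum, auto)
  have int: "set_integrable lborel {0..t} g" for t
    unfolding set_integrable_def
  proof (rule integrableI_bounded_set [where A = "{0..t}" and B = R])
    have "(\<lambda>x. indicator {0..t} x * (indicator {0..} x *\<^sub>R g x)) \<in> borel_measurable borel"
      using cadlag_measurable [OF f, of "\<lambda>i. \<bar>r i\<bar>"]
      by (intro borel_measurable_times) (auto simp: set_borel_measurable_def g_def)
    also have "(\<lambda>x. indicator {0..t} x * (indicator {0..} x *\<^sub>R g x)) = (\<lambda>x. indicator {0..t} x *\<^sub>R g x)"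
      by (auto simp: indicator_def)
    finally show "(\<lambda>x. indicator {0..t} x *\<^sub>R g x) \<in> borel_measurable lborel" by simp
  qed (use R in \<open>auto simp: indicator_def emeasure_lborel_Icc_eq\<close>)
  have Y: "Y t = integral {0..t} g" and HK: "g integrable_on {0..t}" for t
    using set_borel_integral_eq_integral [OF int] by (simp_all add: Y_def)
  have incr: "Y b = Y a + integral {a..b} g" and HK': "g integrable_on {a..b}"
    if "0 \<le> a" "a \<le> b" for a b
  proof -
    show "Y b = Y a + integral {a..b} g"
      unfolding Y by (rule Henstock_Kurzweil_Integration.integral_combine [symmetric]) (use that HK in auto)
    show "g integrable_on {a..b}"
      by (rule integrable_subinterval_real [OF HK [of b]]) (use that in auto)
  qed
  have lip: "\<bar>Y b - Y a\<bar> \<le> R * (b - a)" if "0 \<le> a" "a \<le> b" for a b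
  proof -
    have "norm (integral {a..b} g) \<le> R * measure lborel {a..b}"
      by (rule has_integral_bound_real [OF _ finite.emptyI integrable_integral [OF HK' [OF that]]])
        (use R order_trans [OF abs_ge_zero R] in auto)
    then show ?thesis using incr [OF that] that by simp
  qed
  show ?thesis
    unfolding level_path_def g_def [symmetric] Y_def [symmetric]
  proof (intro conjI allI impI)
    show "continuous_on {0..} Y"
    proof (rule lipschitz_on_continuous_on [of R], rule lipschitz_onI)
      show "dist (Y x) (Y y) \<le> R * dist x y" if "x \<in> {0..}" "y \<in> {0..}" for x y
        using lip [of x y] lip [of y x] that by (cases "x \<le> y") (auto simp: dist_real_def abs_minus_commute)
    qed (use R [of 0] in auto)
    fix t :: real assume t: "0 \<le> t"
    show "0 \<le> Y t"
      unfolding Y by (rule integral_nonneg [OF HK]) (auto simp: g_def)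
    obtain d where d: "d > t" "\<And>u. t < u \<Longrightarrow> u < d \<Longrightarrow> f u = f t"
      using f t unfolding cadlag_path_def eventually_at_right_field by blast
    have "(Y s - Y t) / (s - t) = \<bar>r (f t)\<bar>" if "s \<in> {t<..<d}" for s
    proof -
      have "integral {t..s} g = integral {t..s} (\<lambda>u. \<bar>r (f t)\<bar>)"
        by (rule integral_spike [of "{}"]) (use d that in \<open>auto simp: g_def order_le_less\<close>)
      then show ?thesis using incr [of t s] t that by simp
    qed
    then have "eventually (\<lambda>s. (Y s - Y t) / (s - t) = \<bar>r (f t)\<bar>) (at_right t)"
      using eventually_at_right_real [OF d(1)] by (auto elim: eventually_mono)
    then have "(Y has_real_derivative \<bar>r (f t)\<bar>) (at_right t)"
      unfolding has_field_derivative_iff by (rule tendsto_eventually)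
    then show "(Y has_real_derivative (if 0 < Y t then g t else max 0 (g t))) (at_right t)"
      by (simp add: g_def)
  qed
qed

lemma clock_growth:
  assumes level: "level_path (\<lambda>i. \<bar>r i\<bar>) f Y" and m: "\<And>i. m \<le> \<bar>r i\<bar>" and "0 \<le> a" "a \<le> b"
  shows "m * (b - a) \<le> Y b - Y a"
proof (rule right_deriv_lower)
  show "\<exists>D\<ge>m. (Y has_real_derivative D) (at_right t)" if "a \<le> t" for t
    using level_deriv [OF level, of t] m [of "f t"] that assms by (intro exI conjI) auto
qed (use assms level_cont [OF level] in auto)

text \<open>Finitely many nonzero rates are bounded away from 0, so the clock is unbounded and
  strictly increasing. The set under the infimum in \<open>hit_time\<close> is therefore a
  singleton, and no default value of \<open>Inf\<close> is involved.\<close>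

lemma hit_time_unique:
  fixes r :: "'s::finite \<Rightarrow> real"
  assumes f: "cadlag_path (\<lambda>t. \<phi> t w)" and r: "\<And>i. r i \<noteq> 0" and "y > 0"
  shows "hit_time r \<phi> y w > 0" "(LBINT u:{0..hit_time r \<phi> y w}. \<bar>r (\<phi> u w)\<bar>) = y"
proof -
  let ?Y = "\<lambda>t. LBINT u:{0..t}. \<bar>r (\<phi> u w)\<bar>"
  define m where "m = Min (range (\<lambda>i. \<bar>r i\<bar>))"
  have m: "m > 0" "\<And>i. m \<le> \<bar>r i\<bar>"
    using r by (auto simp: m_def)
  note level = clock_level_path [OF f, of r]
  note growth = clock_growth [OF level m(2)]
  have "AE u in lborel. indicator {0..0::real} u *\<^sub>R \<bar>r (\<phi> u w)\<bar> = 0"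
    using AE_lborel_singleton [of "0::real"] by eventually_elim auto
  then have Y0: "?Y 0 = 0" unfolding set_lebesgue_integral_def by (rule integral_eq_zero_AE)
  have "y \<le> ?Y (y / m)" using growth [of 0 "y / m"] m \<open>y > 0\<close> Y0 by simp
  then obtain t where t: "0 \<le> t" "?Y t = y"
    using IVT' [of ?Y 0 y "y / m"] Y0 \<open>y > 0\<close> m level_cont [OF level, of 0 "y / m"] by auto
  have "t > 0" using t Y0 \<open>y > 0\<close> by (metis less_eq_real_def less_irrefl)
  have "s = t" if "s > 0" "?Y s = y" for s
  proof -
    have "s \<le> t \<Longrightarrow> m * (t - s) \<le> 0" "t \<le> s \<Longrightarrow> m * (s - t) \<le> 0"
      using growth [of s t] growth [of t s] that t by linarith+
    then show ?thesis using m(1) by (cases "s \<le> t") (simp_all add: mult_le_0_iff)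
  qed
  then have "{t. t > 0 \<and> ?Y t = y} = {t}" using t \<open>t > 0\<close> by blast
  then have "hit_time r \<phi> y w = t" by (simp only: hit_time_def cInf_singleton)
  then show "hit_time r \<phi> y w > 0" "?Y (hit_time r \<phi> y w) = y" using t \<open>t > 0\<close> by simp_all
qed

text \<open>The increments that start at or below \<open>b\<close> telescope; the last of them may
  overshoot \<open>b\<close>, by at most one increment. Both cases are carried together because the
  induction passes from the first to the second when \<open>b\<close> is crossed.\<close>

lemma crossing_sum:
  fixes y :: "nat \<Rightarrow> real"
  assumes "y 0 = 0" and incr: "\<And>k. y k \<le> y (Suc k)" "\<And>k. y (Suc k) - y k \<le> d" and "0 \<le> b"
  shows "(y n \<le> b \<longrightarrow> (\<Sum>k<n. (y (Suc k) - y k) * of_bool (y k \<le> b)) = y n) \<and>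
    (b < y n \<longrightarrow> b \<le> (\<Sum>k<n. (y (Suc k) - y k) * of_bool (y k \<le> b)) \<and>
       (\<Sum>k<n. (y (Suc k) - y k) * of_bool (y k \<le> b)) \<le> b + d)"
proof (induction n)
  case 0
  then show ?case using assms by simp
next
  case (Suc n)
  show ?case
    using Suc incr [of n] by (cases "y n \<le> b"; cases "y (Suc n) \<le> b") auto
qed

text \<open>The overshoots at the two ends both lie in \<open>[0, d]\<close>, so their difference is
  at most \<open>d\<close>.\<close>

lemma window_sum:
  fixes y :: "nat \<Rightarrow> real"
  assumes "y 0 = 0" "\<And>k. y k \<le> y (Suc k)" "\<And>k. y (Suc k) - y k \<le> d"
    and "0 \<le> a" "a \<le> b" "b < y n"
  shows "\<bar>(\<Sum>k<n. (y (Suc k) - y k) * of_bool (a < y k \<and> y k \<le> b)) - (b - a)\<bar> \<le> d"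
proof -
  let ?S = "\<lambda>b. \<Sum>k<n. (y (Suc k) - y k) * of_bool (y k \<le> b)"
  have "(\<Sum>k<n. (y (Suc k) - y k) * of_bool (a < y k \<and> y k \<le> b)) = ?S b - ?S a"
    unfolding sum_subtractf [symmetric] using assms(5) by (intro sum.cong) (auto simp: of_bool_def)
  moreover have "a < y n" "0 \<le> b" using assms by linarith+
  moreover from this have "a \<le> ?S a" "?S a \<le> a + d" "b \<le> ?S b" "?S b \<le> b + d"
    using crossing_sum [of y d a n] crossing_sum [of y d b n] assms by blast+
  ultimately show ?thesis by linarith
qed

section \<open>The law of the queue\<close>


lemma disc_level_cong:
  "(\<And>l. l < k \<Longrightarrow> s l = s' l) \<Longrightarrow> disc_level c h s x k = disc_level c h s' x k"
  by (induction k) auto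

lemma disc_level_nonneg: "0 \<le> x \<Longrightarrow> 0 \<le> disc_level c h s x k"
  by (induction k) auto

text \<open>An event of the past that is decided by finitely many grid phases is a finite disjoint
  union of cylinders. On each cylinder the product formula gains exactly the factor from
  \<open>i\<close> to \<open>j\<close>, so the Markov property follows by summation, without
  conditional expectations.\<close>

lemma ctmc_skeleton_markov:
  fixes D :: "(nat \<Rightarrow> 's::finite) \<Rightarrow> bool"
  assumes ctmc: "ctmc M T \<phi>" and "0 \<le> h"
    and D: "\<And>s s'. (\<And>l. l \<le> k \<Longrightarrow> s l = s' l) \<Longrightarrow> D s = D s'"
  shows "measure M {w \<in> space M. D (\<lambda>l. \<phi> (real l * h) w) \<and> \<phi> (real k * h) w = i \<and> \<phi> (real (Suc k) * h) w = j} =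
         measure M {w \<in> space M. D (\<lambda>l. \<phi> (real l * h) w) \<and> \<phi> (real k * h) w = i} * mexp (h *\<^sub>R T) $ i $ j"
proof -
  interpret prob_space M using ctmc by (simp add: ctmc_def)
  let ?\<phi> = "\<lambda>l. \<phi> (real l * h)"
  have meas [measurable]: "?\<phi> l \<in> measurable M (count_space UNIV)" for l
    using ctmc \<open>0 \<le> h\<close> by (simp add: ctmc_def)
  have fdd: "prob {w \<in> space M. \<forall>l\<le>n. ?\<phi> l w = s l} =
      prob {w \<in> space M. ?\<phi> 0 w = s 0} * (\<Prod>l<n. mexp (h *\<^sub>R T) $ s l $ s (Suc l))" for n s
  proof -
    have "\<forall>n t s. t 0 = 0 \<longrightarrow> (\<forall>k<n. t k \<le> t (Suc k)) \<longrightarrow>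
        prob {w \<in> space M. \<forall>k\<le>n. \<phi> (t k) w = s k} =
        prob {w \<in> space M. \<phi> 0 w = s 0} * (\<Prod>k<n. mexp ((t (Suc k) - t k) *\<^sub>R T) $ s k $ s (Suc k))"
      using ctmc by (simp add: ctmc_def)
    from this [rule_format, of "\<lambda>l. real l * h" n s] show ?thesis
      using \<open>0 \<le> h\<close> by (simp add: distrib_right)
  qed
  \<comment> \<open>Extensional functions represent each finite history once, which makes
    \<open>S\<close> finite and the cylinders disjoint.\<close>
  define S where "S = {s \<in> {..k} \<rightarrow>\<^sub>E UNIV. D s \<and> s k = i}"
  have "finite S"
    unfolding S_def by (rule finite_subset [OF _ finite_PiE [of "{..k}" "\<lambda>_. UNIV"]]) auto
  define E where "E s = {w \<in> space M. \<forall>l\<le>k. ?\<phi> l w = s l}" for s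
  define E' where "E' s = {w \<in> space M. \<forall>l\<le>Suc k. ?\<phi> l w = (s(Suc k := j)) l}" for s
  have E'_eq: "E' s = E s \<inter> {w \<in> space M. ?\<phi> (Suc k) w = j}" for s
    by (auto simp: E'_def E_def le_Suc_eq)
  have disj: "disjoint_family_on E S"
    unfolding disjoint_family_on_def
  proof (intro ballI impI)
    fix s s' assume "s \<in> S" "s' \<in> S" "s \<noteq> s'"
    then obtain l where "l \<le> k" "s l \<noteq> s' l"
      unfolding S_def by (metis (no_types, lifting) PiE_ext atMost_iff mem_Collect_eq)
    then show "E s \<inter> E s' = {}" by (force simp: E_def)
  qed
  have disj': "disjoint_family_on E' S"
    using disj unfolding disjoint_family_on_def E'_eq by blast
  have "{w \<in> space M. \<forall>l\<le>n. ?\<phi> l w = s l} \<in> events" for n s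
    by measurable
  then have meas_E: "E ` S \<subseteq> events" "E' ` S \<subseteq> events"
    unfolding E_def E'_def by blast+
  have U: "{w \<in> space M. D (\<lambda>l. ?\<phi> l w) \<and> ?\<phi> k w = i} = (\<Union>s\<in>S. E s)" (is "?L = _")
  proof (intro equalityI subsetI)
    fix w assume w: "w \<in> ?L"
    let ?s = "restrict (\<lambda>l. ?\<phi> l w) {..k}"
    have "D ?s = D (\<lambda>l. ?\<phi> l w)" by (rule D) simp
    then have "?s \<in> S" using w by (auto simp: S_def)
    moreover have "w \<in> E ?s" using w by (auto simp: E_def)
    ultimately show "w \<in> (\<Union>s\<in>S. E s)" by blast
  next
    fix w assume "w \<in> (\<Union>s\<in>S. E s)"
    then obtain s where s: "s \<in> S" "w \<in> E s" by blast
    then have "D (\<lambda>l. ?\<phi> l w) = D s" by (intro D) (auto simp: E_def)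
    then show "w \<in> ?L" using s by (auto simp: S_def E_def)
  qed
  have U': "{w \<in> space M. D (\<lambda>l. ?\<phi> l w) \<and> ?\<phi> k w = i \<and> ?\<phi> (Suc k) w = j} = (\<Union>s\<in>S. E' s)"
  proof -
    have "{w \<in> space M. D (\<lambda>l. ?\<phi> l w) \<and> ?\<phi> k w = i \<and> ?\<phi> (Suc k) w = j} =
        {w \<in> space M. D (\<lambda>l. ?\<phi> l w) \<and> ?\<phi> k w = i} \<inter> {w \<in> space M. ?\<phi> (Suc k) w = j}"
      by auto
    then show ?thesis unfolding U E'_eq by blast
  qed
  have step: "prob (E' s) = prob (E s) * mexp (h *\<^sub>R T) $ i $ j" if "s \<in> S" for s
  proof -
    have "prob (E' s) = prob {w \<in> space M. ?\<phi> 0 w = s 0} *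
        ((\<Prod>l<k. mexp (h *\<^sub>R T) $ s l $ s (Suc l)) * mexp (h *\<^sub>R T) $ s k $ j)"
      unfolding E'_def fdd by (simp add: prod.lessThan_Suc)
    then show ?thesis using that by (simp add: E_def fdd S_def)
  qed
  show ?thesis
    unfolding U U' using step
    by (simp add: finite_measure_finite_Union [OF \<open>finite S\<close> meas_E(1) disj]
        finite_measure_finite_Union [OF \<open>finite S\<close> meas_E(2) disj'] sum_distrib_right)
qed

section \<open>The mixture of the conditional laws over the initial distribution\<close>

locale fluid_start =
  fixes T :: "real^'s^('s::finite)" and c :: "'s \<Rightarrow> real"
    and N :: "'w measure" and Pr :: "'s \<Rightarrow> real \<Rightarrow> 'w measure"
    and \<phi> :: "real \<Rightarrow> 'w \<Rightarrow> 's" and X :: "real \<Rightarrow> 'w \<Rightarrow> real"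
    and \<mu> :: "'s \<Rightarrow> real measure"
  assumes queue: "fluid_queue N Pr T c \<phi> X" and init: "initial_distribution \<mu>"
begin

lemma kernel: "Pr i \<in> measurable (restrict_space borel {0..}) (prob_algebra N)"
  using queue by (simp add: fluid_queue_def)

lemma ctmc: "0 \<le> x \<Longrightarrow> ctmc (Pr i x) T \<phi>"
  and AE_start: "0 \<le> x \<Longrightarrow> AE w in Pr i x. \<phi> 0 w = i \<and> X 0 w = x"
  using queue by (simp_all add: fluid_queue_def)

lemma prob: "0 \<le> x \<Longrightarrow> prob_space (Pr i x)"
  using ctmc by (simp add: ctmc_def)

lemma sets_Pr: "0 \<le> x \<Longrightarrow> sets (Pr i x) = sets N"
  using measurable_space [OF kernel, of x] by (simp add: space_restrict_space space_prob_algebra)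

lemma space_Pr: "0 \<le> x \<Longrightarrow> space (Pr i x) = space N"
  by (rule sets_eq_imp_space_eq) (rule sets_Pr)

lemma cadlag: "w \<in> space N \<Longrightarrow> cadlag_path (\<lambda>t. \<phi> t w)"
  using ctmc [of 0] space_Pr [of 0] by (simp add: ctmc_def)

lemma level: "w \<in> space N \<Longrightarrow> level_path c (\<lambda>t. \<phi> t w) (\<lambda>t. X t w)"
  using queue by (simp add: fluid_queue_def)

lemma phase_measurable [measurable]: "0 \<le> t \<Longrightarrow> \<phi> t \<in> measurable N (count_space UNIV)"
proof -
  assume "0 \<le> t"
  moreover have "\<forall>t\<ge>0. \<phi> t \<in> measurable (Pr undefined 0) (count_space UNIV)"
    using ctmc [of 0 undefined] unfolding ctmc_def by blast
  ultimately have "\<phi> t \<in> measurable (Pr undefined 0) (count_space UNIV)" by blast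
  then show ?thesis
    by (simp add: measurable_cong_sets [OF sets_Pr [of 0 undefined] refl])
qed

lemma level_measurable [measurable]: "0 \<le> t \<Longrightarrow> X t \<in> borel_measurable N"
  using queue by (simp add: fluid_queue_def)

lemma sets_\<mu> [measurable_cong]: "sets (\<mu> i) = sets borel"
  using init by (simp add: initial_distribution_def)

lemma finite_\<mu>: "finite_measure (\<mu> i)"
proof
  have "emeasure (\<mu> i) (space (\<mu> i)) = emeasure (\<mu> i) ({..<0} \<union> {0..})"
    using sets_eq_imp_space_eq [OF sets_\<mu>, of i] by (intro arg_cong2 [of _ _ _ _ emeasure]) auto
  also have "\<dots> = emeasure (\<mu> i) {..<0} + emeasure (\<mu> i) {0..}"
    by (rule plus_emeasure [symmetric]) (auto simp: sets_\<mu>)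
  also have "\<dots> \<le> 0 + 1"
  proof (rule add_mono)
    have "emeasure (\<mu> i) {0..} \<le> (\<Sum>i\<in>UNIV. emeasure (\<mu> i) {0..})" by (rule member_le_sum) auto
    then show "emeasure (\<mu> i) {0..} \<le> 1" using init by (simp add: initial_distribution_def)
  qed (use init in \<open>simp add: initial_distribution_def\<close>)
  finally show "emeasure (\<mu> i) (space (\<mu> i)) \<noteq> \<infinity>" by (auto simp: top_unique)
qed

text \<open>Mixing the conditional laws over the initial state makes every entry of
  \<open>exp_D\<close> the probability of one event under one measure, so that dominated convergence
  applies to functionals of the path.\<close>

definition law :: "'w measure" where
  "law = measure_of (space N) (sets N) (\<lambda>E. \<Sum>i\<in>UNIV. \<integral>\<^sup>+x\<in>{0..}. emeasure (Pr i x) E \<partial>\<mu> i)"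

lemma sets_law [simp, measurable_cong]: "sets law = sets N"
  and space_law [simp]: "space law = space N"
  by (simp_all add: law_def)

lemma kernel_measurable:
  assumes "E \<in> sets N"
  shows "(\<lambda>x. emeasure (Pr i x) E * indicator {0..} x) \<in> borel_measurable (\<mu> i)"
proof -
  have "(\<lambda>x. emeasure (Pr i x) E) \<in> borel_measurable (restrict_space borel {0..})"
    using measurable_emeasure_kernel [OF measurable_prob_algebraD [OF kernel] assms] .
  then have "(\<lambda>x. emeasure (Pr i x) E * indicator {0..} x) \<in> borel_measurable borel"
    by (subst (asm) borel_measurable_restrict_space_iff_ennreal) auto
  then show ?thesis by (simp cong: measurable_cong_sets add: sets_\<mu>)
qed

lemma emeasure_law:
  assumes "E \<in> sets N"
  shows "emeasure law E = (\<Sum>i\<in>UNIV. \<integral>\<^sup>+x\<in>{0..}. emeasure (Pr i x) E \<partial>\<mu> i)"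
proof (rule emeasure_measure_of [OF law_def])
  show "sets N \<subseteq> Pow (space N)" by (rule sets.space_closed)
  show "positive (sets law) (\<lambda>E. \<Sum>i\<in>UNIV. \<integral>\<^sup>+x\<in>{0..}. emeasure (Pr i x) E \<partial>\<mu> i)"
    by (simp add: positive_def)
  show "E \<in> sets law" using assms by simp
  show "countably_additive (sets law) (\<lambda>E. \<Sum>i\<in>UNIV. \<integral>\<^sup>+x\<in>{0..}. emeasure (Pr i x) E \<partial>\<mu> i)"
  proof (rule countably_additiveI)
    fix A :: "nat \<Rightarrow> _" assume A: "range A \<subseteq> sets law" "disjoint_family A"
    have "(\<Sum>n. \<Sum>i\<in>UNIV. \<integral>\<^sup>+x\<in>{0..}. emeasure (Pr i x) (A n) \<partial>\<mu> i) =
        (\<Sum>i\<in>UNIV. \<Sum>n. \<integral>\<^sup>+x\<in>{0..}. emeasure (Pr i x) (A n) \<partial>\<mu> i)"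
      by (rule suminf_sum) auto
    also have "\<dots> = (\<Sum>i\<in>UNIV. \<integral>\<^sup>+x. (\<Sum>n. emeasure (Pr i x) (A n) * indicator {0..} x) \<partial>\<mu> i)"
      by (intro sum.cong refl nn_integral_suminf [symmetric] kernel_measurable) (use A in auto)
    also have "\<dots> = (\<Sum>i\<in>UNIV. \<integral>\<^sup>+x\<in>{0..}. emeasure (Pr i x) (\<Union>n. A n) \<partial>\<mu> i)"
    proof (intro sum.cong refl nn_integral_cong)
      fix i x
      show "(\<Sum>n. emeasure (Pr i x) (A n) * indicator {0..} x) = emeasure (Pr i x) (\<Union>n. A n) * indicator {0..} x"
      proof (cases "0 \<le> x")
        case True
        then show ?thesis using A sets_Pr [OF True] by (simp add: suminf_emeasure)
      qed simp
    qed
    finally show "(\<Sum>n. \<Sum>i\<in>UNIV. \<integral>\<^sup>+x\<in>{0..}. emeasure (Pr i x) (A n) \<partial>\<mu> i) =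
        (\<Sum>i\<in>UNIV. \<integral>\<^sup>+x\<in>{0..}. emeasure (Pr i x) (\<Union>n. A n) \<partial>\<mu> i)" .
  qed
qed

lemma measure_law:
  assumes E: "E \<in> sets N"
  shows "measure law E = (\<Sum>i\<in>UNIV. LINT x:{0..}|\<mu> i. measure (Pr i x) E)"
proof -
  have "(\<integral>\<^sup>+x\<in>{0..}. emeasure (Pr i x) E \<partial>\<mu> i) = ennreal (LINT x:{0..}|\<mu> i. measure (Pr i x) E)" for i
  proof -
    interpret finite_measure "\<mu> i" by (rule finite_\<mu>)
    have eq: "emeasure (Pr i x) E * indicator {0..} x = ennreal (indicator {0..} x *\<^sub>R measure (Pr i x) E)" for x
      by (cases "0 \<le> x") (auto simp: prob finite_measure.emeasure_eq_measure prob_space.finite_measure)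
    have "(\<lambda>x. ennreal (indicator {0..} x *\<^sub>R measure (Pr i x) E)) \<in> borel_measurable (\<mu> i)"
      using kernel_measurable [OF E, of i] unfolding eq .
    from borel_measurable_enn2real [OF this]
    have "(\<lambda>x. indicator {0..} x *\<^sub>R measure (Pr i x) E) \<in> borel_measurable (\<mu> i)" by simp
    then have "integrable (\<mu> i) (\<lambda>x. indicator {0..} x *\<^sub>R measure (Pr i x) E)"
      by (rule integrable_const_bound [of _ 1, rotated])
        (auto intro!: AE_I2 simp: indicator_def prob prob_space.prob_le_1)
    then show ?thesis
      unfolding eq set_lebesgue_integral_def by (rule nn_integral_eq_integral) auto
  qed
  then have "emeasure law E = ennreal (\<Sum>i\<in>UNIV. LINT x:{0..}|\<mu> i. measure (Pr i x) E)"
    by (simp add: emeasure_law [OF E] sum_ennreal set_lebesgue_integral_def)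
  moreover have "0 \<le> (\<Sum>i\<in>UNIV. LINT x:{0..}|\<mu> i. measure (Pr i x) E)"
    by (simp add: sum_nonneg set_lebesgue_integral_def)
  ultimately show ?thesis by (simp add: measure_def)
qed

lemma prob_law: "prob_space law"
proof
  have "(\<integral>\<^sup>+x\<in>{0..}. emeasure (Pr i x) (space N) \<partial>\<mu> i) = emeasure (\<mu> i) {0..}" for i
  proof -
    have "emeasure (Pr i x) (space N) * indicator {0..} x = indicator {0..} x" for x
      using prob_space.emeasure_space_1 [OF prob, of x i] space_Pr [of x i] by (cases "0 \<le> x") auto
    then show ?thesis by (simp add: sets_\<mu>)
  qed
  then show "emeasure law (space law) = 1"
    using init by (simp add: emeasure_law initial_distribution_def)
qed

lemma law_start:
  assumes "0 \<le> v"
  shows "measure law {w \<in> space N. \<phi> 0 w = j \<and> X 0 w \<le> v} = measure (\<mu> j) {0..v}"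
proof -
  have *: "measure (Pr i x) {w \<in> space N. \<phi> 0 w = j \<and> X 0 w \<le> v} = of_bool (i = j \<and> x \<le> v)" if "0 \<le> x" for i x
  proof -
    interpret prob_space "Pr i x" using that by (rule prob)
    have "prob {w \<in> space N. \<phi> 0 w = j \<and> X 0 w \<le> v} = prob (if i = j \<and> x \<le> v then space N else {})"
    proof (rule finite_measure_eq_AE)
      show "AE w in Pr i x. (w \<in> {w \<in> space N. \<phi> 0 w = j \<and> X 0 w \<le> v}) =
          (w \<in> (if i = j \<and> x \<le> v then space N else {}))"
        using AE_start [OF that, of i] AE_space by eventually_elim (use space_Pr [OF that] in auto)
    qed (auto simp: sets_Pr [OF that])
    then show ?thesis using prob_space space_Pr [OF that, of i] by auto
  qed
  have "measure law {w \<in> space N. \<phi> 0 w = j \<and> X 0 w \<le> v} =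
      (\<Sum>i\<in>UNIV. LINT x:{0..}|\<mu> i. measure (Pr i x) {w \<in> space N. \<phi> 0 w = j \<and> X 0 w \<le> v})"
    by (rule measure_law) measurable
  also have "\<dots> = (\<Sum>i\<in>UNIV. if i = j then measure (\<mu> j) {0..v} else 0)"
  proof (intro sum.cong refl)
    fix i
    have "(LINT x:{0..}|\<mu> i. measure (Pr i x) {w \<in> space N. \<phi> 0 w = j \<and> X 0 w \<le> v}) =
        (LINT x|\<mu> i. of_bool (i = j) * indicator {0..v} x)"
      unfolding set_lebesgue_integral_def
      by (intro Bochner_Integration.integral_cong) (auto simp: * indicator_def)
    also have "\<dots> = (if i = j then measure (\<mu> j) {0..v} else 0)"
      using sets_eq_imp_space_eq [OF sets_\<mu>, of i] by (auto simp: sets_\<mu>)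
    finally show "(LINT x:{0..}|\<mu> i. measure (Pr i x) {w \<in> space N. \<phi> 0 w = j \<and> X 0 w \<le> v}) =
        (if i = j then measure (\<mu> j) {0..v} else 0)" .
  qed
  finally show ?thesis by simp
qed

text \<open>Under \<open>Pr i0 x\<close> the starting level is almost surely the constant
  \<open>x\<close>, so the event depends on the grid phases only and the skeleton property applies.
  Its factor does not depend on \<open>x\<close> and comes out of the integral. The two
  measurability hypotheses cover the event before and after this replacement.\<close>

lemma law_markov:
  fixes D :: "real \<Rightarrow> (nat \<Rightarrow> 's) \<Rightarrow> bool"
  assumes "0 \<le> h" and D: "\<And>x s s'. (\<And>l. l \<le> k \<Longrightarrow> s l = s' l) \<Longrightarrow> D x s = D x s'"
    and meas: "{w \<in> space N. D (X 0 w) (\<lambda>l. \<phi> (real l * h) w)} \<in> sets N"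
      "\<And>x. {w \<in> space N. D x (\<lambda>l. \<phi> (real l * h) w)} \<in> sets N"
  shows "measure law {w \<in> space N. D (X 0 w) (\<lambda>l. \<phi> (real l * h) w) \<and> \<phi> (real k * h) w = i \<and> \<phi> (real (Suc k) * h) w = j} =
         measure law {w \<in> space N. D (X 0 w) (\<lambda>l. \<phi> (real l * h) w) \<and> \<phi> (real k * h) w = i} * mexp (h *\<^sub>R T) $ i $ j"
proof -
  let ?D = "\<lambda>w x. D x (\<lambda>l. \<phi> (real l * h) w)"
  let ?A = "\<lambda>w. \<phi> (real k * h) w = i \<and> \<phi> (real (Suc k) * h) w = j"
  let ?B = "\<lambda>w. \<phi> (real k * h) w = i"
  have phm [measurable]: "\<phi> (real l * h) \<in> measurable N (count_space UNIV)" for l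
    by (rule phase_measurable) (use \<open>0 \<le> h\<close> in auto)
  have [measurable]: "Measurable.pred N (\<lambda>w. ?D w (X 0 w))" "Measurable.pred N (\<lambda>w. ?D w x)" for x
    using meas by (simp_all add: pred_def)
  have [measurable]: "\<phi> (real (Suc k) * h) \<in> measurable N (count_space UNIV)"
    by (rule phm)
  have *: "measure (Pr i0 x) {w \<in> space N. ?D w (X 0 w) \<and> ?A w} =
      measure (Pr i0 x) {w \<in> space N. ?D w (X 0 w) \<and> ?B w} * mexp (h *\<^sub>R T) $ i $ j" if "0 \<le> x" for i0 x
  proof -
    interpret prob_space "Pr i0 x" using that by (rule prob)
    have eq: "measure (Pr i0 x) {w \<in> space N. ?D w (X 0 w) \<and> R w} = measure (Pr i0 x) {w \<in> space N. ?D w x \<and> R w}"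
      if [measurable]: "Measurable.pred N R" for R
    proof (rule finite_measure_eq_AE)
      show "AE w in Pr i0 x. (w \<in> {w \<in> space N. ?D w (X 0 w) \<and> R w}) = (w \<in> {w \<in> space N. ?D w x \<and> R w})"
        using AE_start [OF \<open>0 \<le> x\<close>, of i0] by eventually_elim auto
    qed (simp_all add: sets_Pr \<open>0 \<le> x\<close>)
    have "measure (Pr i0 x) {w \<in> space N. ?D w (X 0 w) \<and> ?A w} = measure (Pr i0 x) {w \<in> space N. ?D w x \<and> ?A w}"
      by (rule eq) measurable
    also have "\<dots> = measure (Pr i0 x) {w \<in> space N. ?D w x \<and> ?B w} * mexp (h *\<^sub>R T) $ i $ j"
      unfolding space_Pr [OF that, of i0, symmetric]
      by (rule ctmc_skeleton_markov [OF ctmc [OF that] \<open>0 \<le> h\<close>]) (rule D)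
    also have "measure (Pr i0 x) {w \<in> space N. ?D w x \<and> ?B w} = measure (Pr i0 x) {w \<in> space N. ?D w (X 0 w) \<and> ?B w}"
      by (rule eq [symmetric]) measurable
    finally show ?thesis .
  qed
  have "measure law {w \<in> space N. ?D w (X 0 w) \<and> ?A w} =
      (\<Sum>i0\<in>UNIV. LINT x:{0..}|\<mu> i0. measure (Pr i0 x) {w \<in> space N. ?D w (X 0 w) \<and> ?A w})"
    by (rule measure_law) measurable
  also have "\<dots> = (\<Sum>i0\<in>UNIV. (LINT x:{0..}|\<mu> i0. measure (Pr i0 x) {w \<in> space N. ?D w (X 0 w) \<and> ?B w}) * mexp (h *\<^sub>R T) $ i $ j)"
  proof (intro sum.cong refl)
    fix i0
    have "(LINT x:{0..}|\<mu> i0. measure (Pr i0 x) {w \<in> space N. ?D w (X 0 w) \<and> ?A w}) =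
       (LINT x:{0..}|\<mu> i0. measure (Pr i0 x) {w \<in> space N. ?D w (X 0 w) \<and> ?B w} * mexp (h *\<^sub>R T) $ i $ j)"
      unfolding set_lebesgue_integral_def
      by (intro Bochner_Integration.integral_cong refl) (auto simp: indicator_def * simp del: of_nat_Suc)
    also have "\<dots> = (LINT x:{0..}|\<mu> i0. measure (Pr i0 x) {w \<in> space N. ?D w (X 0 w) \<and> ?B w}) * mexp (h *\<^sub>R T) $ i $ j"
      by (rule set_integral_mult_left)
    finally show "(LINT x:{0..}|\<mu> i0. measure (Pr i0 x) {w \<in> space N. ?D w (X 0 w) \<and> ?A w}) =
      (LINT x:{0..}|\<mu> i0. measure (Pr i0 x) {w \<in> space N. ?D w (X 0 w) \<and> ?B w}) * mexp (h *\<^sub>R T) $ i $ j" .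
  qed
  also have "\<dots> = measure law {w \<in> space N. ?D w (X 0 w) \<and> ?B w} * mexp (h *\<^sub>R T) $ i $ j"
    unfolding sum_distrib_right [symmetric] by (subst measure_law) measurable
  finally show ?thesis .
qed

end

section \<open>Crossing windows\<close>


lemma disc_clock_step:
  "0 \<le> h \<Longrightarrow> disc_level (\<lambda>i. \<bar>r i\<bar>) h s 0 (Suc k) - disc_level (\<lambda>i. \<bar>r i\<bar>) h s 0 k = \<bar>r (s k)\<bar> * h"
  using disc_level_nonneg [of 0 "\<lambda>i. \<bar>r i\<bar>" h s k] by simp

lemma disc_clock_growth:
  assumes "0 \<le> h" and m: "\<And>i. m \<le> \<bar>r i\<bar>"
  shows "real k * (m * h) \<le> disc_level (\<lambda>i. \<bar>r i\<bar>) h s 0 k"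
proof (induction k)
  case (Suc k)
  have "m * h \<le> \<bar>r (s k)\<bar> * h" using assms by (intro mult_right_mono)
  then show ?case using Suc disc_clock_step [OF assms(1), of r s k] by (simp add: algebra_simps)
qed simp

lemma eventually_small:
  fixes K b :: real
  assumes "0 < b"
  shows "eventually (\<lambda>n. K * (1 / real (Suc n)) < b) sequentially"
proof (rule order_tendstoD)
  have "(\<lambda>n. K * (1 / real (Suc n))) \<longlonglongrightarrow> K * 0"
    by (intro tendsto_intros LIMSEQ_Suc lim_1_over_n)
  then show "(\<lambda>n. K * (1 / real (Suc n))) \<longlonglongrightarrow> 0" by simp
qed (rule assms)

text \<open>
  \<open>y\<close> is hit at time \<open>\<omega>\<close>. With grid width \<open>\<epsilon>\<^sup>2\<close> the discretisation error is \<open>O(\<epsilon>\<^sup>2)\<close>,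
  so the grid times at which the discretised clock is in \<open>]y + \<epsilon>, y + 2\<epsilon>]\<close> lie
  after \<open>\<omega>\<close> and converge to it.
\<close>

locale crossing_path =
  fixes f :: "real \<Rightarrow> 's::finite" and c r :: "'s \<Rightarrow> real" and X Y :: "real \<Rightarrow> real" and y \<omega> :: real
  assumes cadlag: "cadlag_path f" and level: "level_path c f X"
    and clock: "level_path (\<lambda>i. \<bar>r i\<bar>) f Y" and Y0: "Y 0 = 0"
    and r: "\<And>i. r i \<noteq> 0" and y: "0 < y" and \<omega>: "0 \<le> \<omega>" "Y \<omega> = y"
begin

abbreviation (input) \<epsilon> :: "nat \<Rightarrow> real" where "\<epsilon> n \<equiv> 1 / real (Suc n)"
abbreviation (input) xd :: "nat \<Rightarrow> nat \<Rightarrow> real" where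
  "xd n k \<equiv> disc_level c ((\<epsilon> n)\<^sup>2) (\<lambda>l. f (real l * (\<epsilon> n)\<^sup>2)) (X 0) k"
abbreviation (input) yd :: "nat \<Rightarrow> nat \<Rightarrow> real" where
  "yd n k \<equiv> disc_level (\<lambda>i. \<bar>r i\<bar>) ((\<epsilon> n)\<^sup>2) (\<lambda>l. f (real l * (\<epsilon> n)\<^sup>2)) 0 k"

lemma window_near:
  assumes "0 < \<delta>"
  shows "eventually (\<lambda>n. \<forall>k. y + \<epsilon> n < yd n k \<and> yd n k \<le> y + 2 * \<epsilon> n \<longrightarrow>
           f (real k * (\<epsilon> n)\<^sup>2) = f \<omega> \<and> \<bar>xd n k - X \<omega>\<bar> < \<delta>) sequentially"
proof -
  define m where "m = Min (range (\<lambda>i. \<bar>r i\<bar>))"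
  have m: "m > 0" "\<And>i. m \<le> \<bar>r i\<bar>"
    using r by (auto simp: m_def)
  define R where "R = (\<Sum>i\<in>UNIV. \<bar>r i\<bar>)"
  have R: "\<bar>\<bar>r i\<bar>\<bar> \<le> R" for i unfolding R_def by simp (rule member_le_sum, auto)
  define C where "C = (\<Sum>i\<in>UNIV. \<bar>c i\<bar>)"
  have C: "\<bar>c i\<bar> \<le> C" for i unfolding C_def by (rule member_le_sum) auto
  have C0: "0 \<le> C" unfolding C_def by (rule sum_nonneg) auto
  have R0: "0 \<le> R" unfolding R_def by (rule sum_nonneg) auto
  \<comment> \<open>The discretised clock gains at least \<open>m\<close> per unit of time, so a
    grid time in the window, where the clock is at most \<open>y + 2\<close>, cannot exceed
    \<open>\<tau>\<close>. Only the jumps up to this horizon matter.\<close>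
  define \<tau> where "\<tau> = (y + 2) / m"
  have "0 \<le> \<tau>" using y m by (simp add: \<tau>_def)
  obtain J where J: "finite J"
    "\<And>a b. 0 \<le> a \<Longrightarrow> a \<le> b \<Longrightarrow> b \<le> \<tau> \<Longrightarrow> {a<..b} \<inter> J = {} \<Longrightarrow> f b = f a"
    using cadlag_jumps [OF cadlag \<open>0 \<le> \<tau>\<close>] by blast
  have "eventually (\<lambda>t. f t = f \<omega>) (at_right \<omega>)"
    using cadlag \<omega>(1) unfolding cadlag_path_def by blast
  then obtain e where e: "e > \<omega>" "\<And>t. \<omega> < t \<Longrightarrow> t < e \<Longrightarrow> f t = f \<omega>"
    unfolding eventually_at_right_field by auto
  \<comment> \<open>The first condition makes the Euler error of the clock smaller than the gap
    \<open>\<epsilon> n\<close> between \<open>y\<close> and the window, the second keeps the window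
    before the next jump after \<open>\<omega>\<close>, and the third brings the level within
    \<open>\<delta>\<close>.\<close>
  have "eventually (\<lambda>n. 2 * R * card J * \<epsilon> n < 1) sequentially"
    "eventually (\<lambda>n. 3 / m * \<epsilon> n < e - \<omega>) sequentially"
    "eventually (\<lambda>n. (2 * C * card J + 3 * C / m) * \<epsilon> n < \<delta>) sequentially"
    by (rule eventually_small; use e assms in simp)+
  then show ?thesis
  proof eventually_elim
    case (elim n)
    define \<eta> where "\<eta> = \<epsilon> n"
    have "0 < \<eta>" "\<eta> \<le> 1" by (auto simp: \<eta>_def)
    then have \<eta>: "0 < \<eta>" "\<eta> \<le> 1" "0 \<le> \<eta>\<^sup>2" "\<eta>\<^sup>2 \<le> \<eta>"
      by (auto simp: power2_eq_square mult_left_le)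
    note elim = elim [folded \<eta>_def]
    show ?case unfolding \<eta>_def [symmetric]
    proof (intro allI impI)
      fix k
      let ?t = "real k * \<eta>\<^sup>2"
      let ?x = "disc_level c (\<eta>\<^sup>2) (\<lambda>l. f (real l * \<eta>\<^sup>2)) (X 0) k"
      let ?y = "disc_level (\<lambda>i. \<bar>r i\<bar>) (\<eta>\<^sup>2) (\<lambda>l. f (real l * \<eta>\<^sup>2)) 0 k"
      assume win: "y + \<eta> < ?y \<and> ?y \<le> y + 2 * \<eta>"
      have t0: "0 \<le> ?t" using \<eta> by simp
      have "real k * (m * \<eta>\<^sup>2) \<le> ?y" by (rule disc_clock_growth) (use m \<eta> in auto)
      then have "?t * m \<le> y + 2" using win \<eta> by (simp add: mult_ac)
      then have \<tau>: "?t \<le> \<tau>" using m by (simp add: \<tau>_def pos_le_divide_eq)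
      \<comment> \<open>With a clock error below \<open>\<eta>\<close>, the window from
        \<open>y + \<eta>\<close> to \<open>y + 2 * \<eta>\<close> confines the true clock strictly
        between \<open>y\<close> and \<open>y + 3 * \<eta>\<close>; hence the 3 in the distance to
        \<open>\<omega>\<close>.\<close>
      have "\<bar>?y - Y ?t\<bar> \<le> 2 * R * \<eta>\<^sup>2 * card J"
        using disc_level_error [OF clock R J \<eta>(3) \<tau>] by (simp only: Y0)
      also have "\<dots> = (2 * R * card J * \<eta>) * \<eta>" by (simp add: power2_eq_square)
      also have "\<dots> < 1 * \<eta>" using elim(1) \<eta> by (intro mult_strict_right_mono) auto
      finally have Yt: "y < Y ?t" "Y ?t < y + 3 * \<eta>" using win by auto
      have "?t > \<omega>"
      proof (rule ccontr)
        assume "\<not> ?t > \<omega>"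
        then have "m * (\<omega> - ?t) \<le> Y \<omega> - Y ?t" "0 \<le> m * (\<omega> - ?t)"
          using clock_growth [OF clock m(2) t0] m by auto
        then show False using Yt \<omega> by simp
      qed
      have "m * (?t - \<omega>) \<le> Y ?t - Y \<omega>"
        using clock_growth [OF clock m(2) \<omega>(1)] \<open>?t > \<omega>\<close> by simp
      then have "m * (?t - \<omega>) < 3 * \<eta>" using Yt \<omega> by simp
      then have dist: "?t - \<omega> < 3 / m * \<eta>" using m by (simp add: field_simps)
      have "f ?t = f \<omega>" using e \<open>?t > \<omega>\<close> dist elim(2) by simp
      moreover have "\<bar>?x - X \<omega>\<bar> < \<delta>"
      proof -
        have "\<bar>?x - X ?t\<bar> \<le> 2 * C * \<eta>\<^sup>2 * card J"
          by (rule disc_level_error [OF level C J \<eta>(3) \<tau>])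
        also have "\<dots> = 2 * C * card J * \<eta>\<^sup>2" by simp
        also have "\<dots> \<le> 2 * C * card J * \<eta>" using \<eta> C0 by (intro mult_left_mono) auto
        finally have 1: "\<bar>?x - X ?t\<bar> \<le> 2 * C * card J * \<eta>" .
        have "\<bar>X ?t - X \<omega>\<bar> \<le> C * (?t - \<omega>)"
          by (rule level_path_lipschitz [OF level C]) (use \<omega> \<open>?t > \<omega>\<close> in auto)
        also have "\<dots> \<le> C * (3 / m * \<eta>)" using dist C0 by (intro mult_left_mono) auto
        finally have "\<bar>X ?t - X \<omega>\<bar> \<le> C * (3 / m * \<eta>)" .
        then have "\<bar>?x - X \<omega>\<bar> \<le> (2 * C * card J + 3 * C / m) * \<eta>"
          using 1 by (simp add: algebra_simps)
        then show ?thesis using elim(3) by simp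
      qed
      ultimately show "f ?t = f \<omega> \<and> \<bar>?x - X \<omega>\<bar> < \<delta>" ..
    qed
  qed
qed

text \<open>A grid step in phase \<open>j\<close> advances the clock by
  \<open>\<bar>r j\<bar> * (\<epsilon> n)^2\<close>; divided by the window width
  \<open>\<epsilon> n\<close> this is the weight. So \<open>S\<close> is the share of the window
  spent in phase \<open>j\<close> with level at most \<open>v\<close>.\<close>

definition S :: "(nat \<Rightarrow> nat) \<Rightarrow> real \<Rightarrow> 's \<Rightarrow> nat \<Rightarrow> real" where
  "S len v j n = (\<Sum>k<len n. \<bar>r j\<bar> * \<epsilon> n *
     of_bool (f (real k * (\<epsilon> n)\<^sup>2) = j \<and> xd n k \<le> v \<and> y + \<epsilon> n < yd n k \<and> yd n k \<le> y + 2 * \<epsilon> n))"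

lemma S_nonneg: "0 \<le> S len v j n"
  unfolding S_def by (intro sum_nonneg) auto

text \<open>Over all phases the weights are clock increments divided by \<open>\<epsilon> n\<close>.
  They add up to window width over \<open>\<epsilon> n\<close>, that is 1, up to a single
  increment.\<close>

lemma window_total:
  assumes "\<And>i. \<bar>r i\<bar> \<le> R" and "y + 2 * \<epsilon> n < yd n (len n)"
  shows "\<bar>(\<Sum>k<len n. \<bar>r (f (real k * (\<epsilon> n)\<^sup>2))\<bar> * \<epsilon> n * of_bool (y + \<epsilon> n < yd n k \<and> yd n k \<le> y + 2 * \<epsilon> n)) - 1\<bar>
      \<le> R * \<epsilon> n" (is "\<bar>?s - 1\<bar> \<le> _")
proof -
  define \<eta> where "\<eta> = \<epsilon> n"
  have \<eta>: "0 < \<eta>" "0 \<le> \<eta>\<^sup>2" by (auto simp: \<eta>_def)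
  let ?y = "disc_level (\<lambda>i. \<bar>r i\<bar>) (\<eta>\<^sup>2) (\<lambda>l. f (real l * \<eta>\<^sup>2)) 0"
  have step: "?y (Suc k) - ?y k = \<bar>r (f (real k * \<eta>\<^sup>2))\<bar> * \<eta>\<^sup>2" for k
    by (rule disc_clock_step) (rule \<eta>)
  have "\<bar>(\<Sum>k<len n. (?y (Suc k) - ?y k) * of_bool (y + \<eta> < ?y k \<and> ?y k \<le> y + 2 * \<eta>)) - (y + 2 * \<eta> - (y + \<eta>))\<bar> \<le> R * \<eta>\<^sup>2"
  proof (rule window_sum)
    show "?y k \<le> ?y (Suc k)" for k
      using step [of k] \<eta> by (simp del: disc_level.simps add: algebra_simps)
    show "?y (Suc k) - ?y k \<le> R * \<eta>\<^sup>2" for k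
      unfolding step using assms \<eta> by (intro mult_right_mono)
    show "y + 2 * \<eta> < ?y (len n)" using assms(2) by (simp only: \<eta>_def)
  qed (use y \<eta>(1) in auto)
  also have "(\<Sum>k<len n. (?y (Suc k) - ?y k) * of_bool (y + \<eta> < ?y k \<and> ?y k \<le> y + 2 * \<eta>)) = \<eta> * ?s"
    unfolding step \<eta>_def [symmetric] sum_distrib_left by (simp add: power2_eq_square mult_ac)
  finally have "\<bar>\<eta> * (?s - 1)\<bar> \<le> \<eta> * (R * \<eta>)" by (simp add: power2_eq_square algebra_simps)
  then show ?thesis using \<eta> unfolding abs_mult \<eta>_def [symmetric] by simp
qed

lemma S_upper:
  assumes "\<And>i. \<bar>r i\<bar> \<le> R" and "y + 2 * \<epsilon> n < yd n (len n)"
  shows "S len v j n \<le> 1 + R * \<epsilon> n"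
proof -
  have "S len v j n \<le> (\<Sum>k<len n. \<bar>r (f (real k * (\<epsilon> n)\<^sup>2))\<bar> * \<epsilon> n * of_bool (y + \<epsilon> n < yd n k \<and> yd n k \<le> y + 2 * \<epsilon> n))"
    unfolding S_def by (intro sum_mono) auto
  then show ?thesis using window_total [where len = len and n = n, OF assms] by linarith
qed

text \<open>Close to the hitting time every term of the window counts, so the share equals the
  total. The inequality for the level is strict because a discretised level near \<open>v\<close>
  may lie on either side of it; the case \<open>X \<omega> = v\<close> is settled only later,
  through continuity of the limit law.\<close>

lemma S_tendsto_1:
  assumes len: "\<And>n. y + 2 * \<epsilon> n < yd n (len n)" and "f \<omega> = j" "X \<omega> < v"
  shows "S len v j \<longlonglongrightarrow> 1"
proof (rule tendsto_sandwich)
  define R where "R = (\<Sum>i\<in>UNIV. \<bar>r i\<bar>)"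
  have R: "\<bar>r i\<bar> \<le> R" for i unfolding R_def by (rule member_le_sum, auto)
  have "eventually (\<lambda>n. \<bar>S len v j n - 1\<bar> \<le> R * \<epsilon> n) sequentially"
  proof (rule eventually_mono)
    show "eventually (\<lambda>n. \<forall>k. y + \<epsilon> n < yd n k \<and> yd n k \<le> y + 2 * \<epsilon> n \<longrightarrow>
           f (real k * (\<epsilon> n)\<^sup>2) = f \<omega> \<and> \<bar>xd n k - X \<omega>\<bar> < v - X \<omega>) sequentially"
      by (rule window_near) (use assms(3) in simp)
  next
    fix n assume *: "\<forall>k. y + \<epsilon> n < yd n k \<and> yd n k \<le> y + 2 * \<epsilon> n \<longrightarrow>
           f (real k * (\<epsilon> n)\<^sup>2) = f \<omega> \<and> \<bar>xd n k - X \<omega>\<bar> < v - X \<omega>"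
    have "S len v j n = (\<Sum>k<len n. \<bar>r (f (real k * (\<epsilon> n)\<^sup>2))\<bar> * \<epsilon> n * of_bool (y + \<epsilon> n < yd n k \<and> yd n k \<le> y + 2 * \<epsilon> n))"
      unfolding S_def
    proof (intro sum.cong refl)
      fix k
      show "\<bar>r j\<bar> * \<epsilon> n * of_bool (f (real k * (\<epsilon> n)\<^sup>2) = j \<and> xd n k \<le> v \<and> y + \<epsilon> n < yd n k \<and> yd n k \<le> y + 2 * \<epsilon> n) =
        \<bar>r (f (real k * (\<epsilon> n)\<^sup>2))\<bar> * \<epsilon> n * of_bool (y + \<epsilon> n < yd n k \<and> yd n k \<le> y + 2 * \<epsilon> n)"
        using *[rule_format, of k] assms(2)
        by (cases "y + \<epsilon> n < yd n k \<and> yd n k \<le> y + 2 * \<epsilon> n") auto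
    qed
    then show "\<bar>S len v j n - 1\<bar> \<le> R * \<epsilon> n"
      using window_total [where len = len and n = n, OF R len] by simp
  qed
  then show "eventually (\<lambda>n. 1 - R * \<epsilon> n \<le> S len v j n) sequentially"
    "eventually (\<lambda>n. S len v j n \<le> 1 + R * \<epsilon> n) sequentially"
    by (auto elim!: eventually_mono)
  have "(\<lambda>n. 1 - R * \<epsilon> n) \<longlonglongrightarrow> 1 - R * 0" "(\<lambda>n. 1 + R * \<epsilon> n) \<longlonglongrightarrow> 1 + R * 0"
    by (intro tendsto_intros LIMSEQ_Suc lim_1_over_n)+
  then show "(\<lambda>n. 1 - R * \<epsilon> n) \<longlonglongrightarrow> 1" "(\<lambda>n. 1 + R * \<epsilon> n) \<longlonglongrightarrow> 1" by simp_all
qed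

lemma S_tendsto_0:
  assumes "f \<omega> \<noteq> j \<or> v < X \<omega>"
  shows "S len v j \<longlonglongrightarrow> 0"
proof (rule tendsto_eventually)
  define \<delta> where "\<delta> = (if v < X \<omega> then X \<omega> - v else 1)"
  have "0 < \<delta>" by (auto simp: \<delta>_def)
  from window_near [OF this] show "eventually (\<lambda>n. S len v j n = 0) sequentially"
  proof eventually_elim
    case (elim n)
    show ?case
      unfolding S_def
    proof (intro sum.neutral ballI)
      fix k
      show "\<bar>r j\<bar> * \<epsilon> n * of_bool (f (real k * (\<epsilon> n)\<^sup>2) = j \<and> xd n k \<le> v \<and> y + \<epsilon> n < yd n k \<and> yd n k \<le> y + 2 * \<epsilon> n) = 0"
      proof (cases "y + \<epsilon> n < yd n k \<and> yd n k \<le> y + 2 * \<epsilon> n")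
        case True
        then have "f (real k * (\<epsilon> n)\<^sup>2) = f \<omega>" "\<bar>xd n k - X \<omega>\<bar> < \<delta>" using elim by blast+
        then have "\<not> (f (real k * (\<epsilon> n)\<^sup>2) = j \<and> xd n k \<le> v)"
          using assms unfolding \<delta>_def by (cases "v < X \<omega>") auto
        then show ?thesis by auto
      qed simp
    qed
  qed
qed

end


section \<open>Expected occupation times on the grid and expectations of windows\<close>

locale fluid_clock = fluid_start T c N Pr \<phi> X \<mu>
  for T :: "real^'s^('s::finite)" and c :: "'s \<Rightarrow> real"
    and N :: "'w measure" and Pr :: "'s \<Rightarrow> real \<Rightarrow> 'w measure"
    and \<phi> :: "real \<Rightarrow> 'w \<Rightarrow> 's" and X :: "real \<Rightarrow> 'w \<Rightarrow> real"
    and \<mu> :: "'s \<Rightarrow> real measure" +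
  fixes r :: "'s \<Rightarrow> real"
  assumes r: "\<And>i. r i \<noteq> 0"
begin

definition dlevel :: "real \<Rightarrow> nat \<Rightarrow> 'w \<Rightarrow> real" where
  "dlevel h k w = disc_level c h (\<lambda>l. \<phi> (real l * h) w) (X 0 w) k"

definition dclock :: "real \<Rightarrow> nat \<Rightarrow> 'w \<Rightarrow> real" where
  "dclock h k w = disc_level (\<lambda>i. \<bar>r i\<bar>) h (\<lambda>l. \<phi> (real l * h) w) 0 k"

lemma disc_level_measurable [measurable]:
  assumes "0 \<le> h" and [measurable]: "g \<in> borel_measurable N"
  shows "(\<lambda>w. disc_level d h (\<lambda>l. \<phi> (real l * h) w) (g w) k) \<in> borel_measurable N"
proof (induction k)
  case (Suc k)
  have "(\<lambda>w. d (\<phi> (real k * h) w)) \<in> borel_measurable N"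
    by (rule measurable_compose [OF phase_measurable]) (use assms(1) in auto)
  then show ?case using Suc by simp
qed simp

lemma dlevel_measurable [measurable]: "0 \<le> h \<Longrightarrow> dlevel h k \<in> borel_measurable N"
  unfolding dlevel_def [abs_def] by measurable

lemma dclock_measurable [measurable]: "0 \<le> h \<Longrightarrow> dclock h k \<in> borel_measurable N"
  unfolding dclock_def [abs_def] by measurable

lemma grid_phase_measurable [measurable]: "0 \<le> h \<Longrightarrow> \<phi> (real k * h) \<in> measurable N (count_space UNIV)"
  by (rule phase_measurable) auto

text \<open>Each grid point stands for a time span \<open>h\<close>, so this is the expected
  occupation time during the first \<open>n\<close> steps. Once the clock has passed
  \<open>y\<close> on all paths, further steps add nothing.\<close>

definition occ :: "real \<Rightarrow> nat \<Rightarrow> real \<Rightarrow> real \<Rightarrow> 's \<Rightarrow> real" where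
  "occ h n v y j = h * (\<Sum>k<n. measure law {w \<in> space N. \<phi> (real k * h) w = j \<and> dlevel h k w \<le> v \<and> dclock h k w \<le> y})"

lemma occ_0: "occ h 0 v y j = 0"
  by (simp add: occ_def)

lemma occ_neg:
  assumes "v < 0 \<or> y < 0"
  shows "occ h n v y j = 0"
proof -
  have "{w \<in> space N. \<phi> (real k * h) w = j \<and> dlevel h k w \<le> v \<and> dclock h k w \<le> y} = {}" for k
  proof -
    have "0 \<le> dlevel h k w" "0 \<le> dclock h k w" if "w \<in> space N" for w
      using level_nonneg [OF level [OF that], of 0]
      by (auto simp: dlevel_def dclock_def intro: disc_level_nonneg)
    then show ?thesis using assms by force
  qed
  then show ?thesis by (simp only: occ_def measure_empty sum.neutral_const mult_zero_right)
qed

text \<open>A forward equation: the summand at 0 is the initial law, and each later summand is split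
  by the phase \<open>i\<close> one step earlier. That phase fixes the increments of level and
  clock, and the transition to \<open>j\<close> is independent of the past given
  \<open>i\<close>.\<close>

lemma occ_Suc:
  assumes h: "0 \<le> h" and vy: "0 \<le> v" "0 \<le> y"
  shows "occ h (Suc n) v y j = h * measure (\<mu> j) {0..v} +
    (\<Sum>i\<in>UNIV. mexp (h *\<^sub>R T) $ i $ j * occ h n (v - c i * h) (y - \<bar>r i\<bar> * h) i)"
proof -
  interpret law: prob_space law by (rule prob_law)
  note [measurable] = grid_phase_measurable [OF h] dlevel_measurable [OF h] dclock_measurable [OF h]
  let ?E = "\<lambda>k v y j. {w \<in> space N. \<phi> (real k * h) w = j \<and> dlevel h k w \<le> v \<and> dclock h k w \<le> y}"
  have start: "measure law (?E 0 v y j) = measure (\<mu> j) {0..v}"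
    using law_start [OF vy(1), of j] vy by (simp add: dlevel_def dclock_def)
  have step: "measure law (?E (Suc k) v y j) =
      (\<Sum>i\<in>UNIV. mexp (h *\<^sub>R T) $ i $ j * measure law (?E k (v - c i * h) (y - \<bar>r i\<bar> * h) i))" for k
  proof -
    let ?A = "\<lambda>i. {w \<in> space N. (dlevel h k w \<le> v - c i * h \<and> dclock h k w \<le> y - \<bar>r i\<bar> * h) \<and>
         \<phi> (real k * h) w = i \<and> \<phi> (real (Suc k) * h) w = j}"
    \<comment> \<open>As \<open>0 \<le> v\<close> and \<open>0 \<le> y\<close>, the truncation
      \<open>max 0\<close> does not affect these inequalities.\<close>
    have "dlevel h (Suc k) w \<le> v \<longleftrightarrow> dlevel h k w \<le> v - c (\<phi> (real k * h) w) * h"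
      "dclock h (Suc k) w \<le> y \<longleftrightarrow> dclock h k w \<le> y - \<bar>r (\<phi> (real k * h) w)\<bar> * h" for w
      using vy by (auto simp: dlevel_def dclock_def)
    then have "?E (Suc k) v y j = (\<Union>i\<in>UNIV. ?A i)"
      by (auto simp del: of_nat_Suc)
    moreover have "measure law (\<Union>i\<in>UNIV. ?A i) = (\<Sum>i\<in>UNIV. measure law (?A i))"
    proof (rule law.finite_measure_finite_Union)
      have "?A i \<in> sets law" for i unfolding sets_law by measurable
      then show "range ?A \<subseteq> sets law" by (rule image_subsetI)
      show "disjoint_family ?A" unfolding disjoint_family_on_def by blast
    qed simp
    moreover have "measure law (?A i) =
        measure law {w \<in> space N. (dlevel h k w \<le> v - c i * h \<and> dclock h k w \<le> y - \<bar>r i\<bar> * h) \<and> \<phi> (real k * h) w = i} *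
        mexp (h *\<^sub>R T) $ i $ j" for i
    proof -
      let ?D = "\<lambda>x s. disc_level c h s x k \<le> v - c i * h \<and> disc_level (\<lambda>i. \<bar>r i\<bar>) h s 0 k \<le> y - \<bar>r i\<bar> * h"
      have "measure law {w \<in> space N. ?D (X 0 w) (\<lambda>l. \<phi> (real l * h) w) \<and> \<phi> (real k * h) w = i \<and> \<phi> (real (Suc k) * h) w = j} =
         measure law {w \<in> space N. ?D (X 0 w) (\<lambda>l. \<phi> (real l * h) w) \<and> \<phi> (real k * h) w = i} * mexp (h *\<^sub>R T) $ i $ j"
      proof (rule law_markov [OF h])
        show "?D x s = ?D x s'" if "\<And>l. l \<le> k \<Longrightarrow> s l = s' l" for x s s'
          using disc_level_cong [of k s s'] that by (metis less_imp_le)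
        show "{w \<in> space N. ?D (X 0 w) (\<lambda>l. \<phi> (real l * h) w)} \<in> sets N"
          using h by measurable
        show "{w \<in> space N. ?D x (\<lambda>l. \<phi> (real l * h) w)} \<in> sets N" for x
          using h by measurable
      qed
      then show ?thesis by (simp only: dlevel_def dclock_def)
    qed
    moreover have "{w \<in> space N. (dlevel h k w \<le> v - c i * h \<and> dclock h k w \<le> y - \<bar>r i\<bar> * h) \<and> \<phi> (real k * h) w = i} =
        ?E k (v - c i * h) (y - \<bar>r i\<bar> * h) i" for i
      by auto
    ultimately show ?thesis by (simp only: mult.commute)
  qed
  have "occ h (Suc n) v y j = h * measure law (?E 0 v y j) + h * (\<Sum>k<n. measure law (?E (Suc k) v y j))"
    unfolding occ_def sum.lessThan_Suc_shift distrib_left ..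
  also have "h * (\<Sum>k<n. measure law (?E (Suc k) v y j)) =
      (\<Sum>i\<in>UNIV. mexp (h *\<^sub>R T) $ i $ j * occ h n (v - c i * h) (y - \<bar>r i\<bar> * h) i)"
    unfolding step occ_def sum_distrib_left
    by (subst sum.swap) (simp add: mult_ac)
  finally show ?thesis unfolding start .
qed

definition window :: "(nat \<Rightarrow> nat) \<Rightarrow> real \<Rightarrow> real \<Rightarrow> 's \<Rightarrow> nat \<Rightarrow> 'w \<Rightarrow> real" where
  "window len y v j n w = crossing_path.S (\<lambda>t. \<phi> t w) c r (\<lambda>t. X t w) y len v j n"

lemma crossing:
  assumes "w \<in> space N" "0 < y"
  shows "crossing_path (\<lambda>t. \<phi> t w) c r (\<lambda>t. X t w) (\<lambda>t. LBINT u:{0..t}. \<bar>r (\<phi> u w)\<bar>) y (hit_time r \<phi> y w)"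
proof
  note hit = hit_time_unique [where \<phi> = \<phi> and r = r, OF cadlag [OF assms(1)] r assms(2)]
  show "0 \<le> hit_time r \<phi> y w" "(LBINT u:{0..hit_time r \<phi> y w}. \<bar>r (\<phi> u w)\<bar>) = y"
    using hit by simp_all
  have "AE u in lborel. indicator {0..0::real} u *\<^sub>R \<bar>r (\<phi> u w)\<bar> = 0"
    using AE_lborel_singleton [of "0::real"] by eventually_elim auto
  then show "(LBINT u:{0..0}. \<bar>r (\<phi> u w)\<bar>) = 0"
    unfolding set_lebesgue_integral_def by (rule integral_eq_zero_AE)
qed (use assms r cadlag level clock_level_path [OF cadlag] in auto)

lemma window_eq:
  assumes "w \<in> space N" "0 < y"
  shows "window len y v j n w = (\<Sum>k<len n. \<bar>r j\<bar> * (1 / real (Suc n)) *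
     indicator {w \<in> space N. \<phi> (real k * (1 / real (Suc n))\<^sup>2) w = j \<and> dlevel ((1 / real (Suc n))\<^sup>2) k w \<le> v \<and>
       y + 1 / real (Suc n) < dclock ((1 / real (Suc n))\<^sup>2) k w \<and> dclock ((1 / real (Suc n))\<^sup>2) k w \<le> y + 2 * (1 / real (Suc n))} w)"
  unfolding window_def crossing_path.S_def [OF crossing [OF assms]]
  using assms(1) by (intro sum.cong refl) (simp add: indicator_def dlevel_def dclock_def of_bool_def)

text \<open>The mean share of a window is a difference quotient of \<open>occ\<close> in the clock
  variable, scaled by \<open>\<bar>r j\<bar>\<close>: membership in the window is the difference of
  two events with bounded clock, and \<open>real (Suc n)\<close> is the reciprocal of the window
  width.\<close>

lemma window_integral:
  assumes "0 < y"
  shows "integrable law (window len y v j n)"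
    and "(\<integral>w. window len y v j n w \<partial>law) = \<bar>r j\<bar> * real (Suc n) *
      (occ ((1 / real (Suc n))\<^sup>2) (len n) v (y + 2 * (1 / real (Suc n))) j -
       occ ((1 / real (Suc n))\<^sup>2) (len n) v (y + 1 / real (Suc n)) j)"
proof -
  interpret law: prob_space law by (rule prob_law)
  define \<eta> where "\<eta> = 1 / real (Suc n)"
  have \<eta>: "0 < \<eta>" "0 \<le> \<eta>\<^sup>2" "real (Suc n) * \<eta> = 1" by (auto simp: \<eta>_def)
  note [measurable] = grid_phase_measurable [OF \<eta>(2)] dlevel_measurable [OF \<eta>(2)] dclock_measurable [OF \<eta>(2)]
  let ?W = "\<lambda>k. {w \<in> space N. \<phi> (real k * \<eta>\<^sup>2) w = j \<and> dlevel (\<eta>\<^sup>2) k w \<le> v \<and>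
       y + \<eta> < dclock (\<eta>\<^sup>2) k w \<and> dclock (\<eta>\<^sup>2) k w \<le> y + 2 * \<eta>}"
  let ?E = "\<lambda>k y. {w \<in> space N. \<phi> (real k * \<eta>\<^sup>2) w = j \<and> dlevel (\<eta>\<^sup>2) k w \<le> v \<and> dclock (\<eta>\<^sup>2) k w \<le> y}"
  have [measurable]: "?W k \<in> sets N" "?E k y' \<in> sets N" for k y' by measurable
  have eq: "window len y v j n w = (\<Sum>k<len n. \<bar>r j\<bar> * \<eta> * indicator (?W k) w)" if "w \<in> space law" for w
    unfolding \<eta>_def by (rule window_eq) (use that assms in auto)
  have int: "integrable law (\<lambda>w. \<Sum>k<len n. \<bar>r j\<bar> * \<eta> * indicator (?W k) w)"
    by (intro Bochner_Integration.integrable_sum integrable_mult_right integrable_real_indicator)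
      (simp_all add: less_top [symmetric])
  have W: "measure law (?W k) = measure law (?E k (y + 2 * \<eta>)) - measure law (?E k (y + \<eta>))" for k
  proof -
    have eq: "?W k = ?E k (y + 2 * \<eta>) - ?E k (y + \<eta>)" by auto
    show ?thesis unfolding eq by (rule law.finite_measure_Diff) (use \<eta> in auto)
  qed
  show "integrable law (window len y v j n)"
    using int by (subst Bochner_Integration.integrable_cong [OF refl eq]) auto
  have "(\<integral>w. window len y v j n w \<partial>law) = (\<integral>w. (\<Sum>k<len n. \<bar>r j\<bar> * \<eta> * indicator (?W k) w) \<partial>law)"
    by (intro Bochner_Integration.integral_cong refl eq)
  also have "\<dots> = (\<Sum>k<len n. \<bar>r j\<bar> * \<eta> * measure law (?W k))"
    by (subst Bochner_Integration.integral_sum) (auto simp: less_top [symmetric])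
  also have "\<dots> = \<bar>r j\<bar> * \<eta> * ((\<Sum>k<len n. measure law (?E k (y + 2 * \<eta>))) - (\<Sum>k<len n. measure law (?E k (y + \<eta>))))"
    unfolding W sum_distrib_left [symmetric] sum_subtractf ..
  also have "\<dots> = \<bar>r j\<bar> * real (Suc n) * (occ (\<eta>\<^sup>2) (len n) v (y + 2 * \<eta>) j - occ (\<eta>\<^sup>2) (len n) v (y + \<eta>) j)"
  proof -
    have e: "real (Suc n) * \<eta>\<^sup>2 = \<eta>"
      using \<eta>(3) by (simp only: power2_eq_square mult.assoc [symmetric] mult_1_left)
    have "\<bar>r j\<bar> * \<eta> * (a - b) = \<bar>r j\<bar> * real (Suc n) * (\<eta>\<^sup>2 * a - \<eta>\<^sup>2 * b)" for a b
      unfolding right_diff_distrib [symmetric] mult.assoc [symmetric]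
      unfolding mult.assoc [of _ "real (Suc n)"] e ..
    then show ?thesis unfolding occ_def .
  qed
  finally show "(\<integral>w. window len y v j n w \<partial>law) = \<bar>r j\<bar> * real (Suc n) *
      (occ ((1 / real (Suc n))\<^sup>2) (len n) v (y + 2 * (1 / real (Suc n))) j -
       occ ((1 / real (Suc n))\<^sup>2) (len n) v (y + 1 / real (Suc n)) j)"
    unfolding \<eta>_def .
qed

text \<open>The limit \<open>G\<close> stays abstract: only convergence of the window expectations
  at positive levels is used. The bound on \<open>len\<close> ensures that after
  \<open>len n\<close> steps the discretised clock has left the window on every path.\<close>

context
  fixes y :: real and len :: "nat \<Rightarrow> nat" and j :: 's and G :: "real \<Rightarrow> real" and m :: real
  assumes y: "0 < y"
    and m: "\<And>i. m \<le> \<bar>r i\<bar>"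
    and len: "\<And>n. y + 2 * (1 / real (Suc n)) < real (len n) * (m * (1 / real (Suc n))\<^sup>2)"
    and lim: "\<And>v. 0 < v \<Longrightarrow> (\<lambda>n. \<integral>w. window len y v j n w \<partial>law) \<longlonglongrightarrow> G v"
begin

abbreviation (input) "level_hit w \<equiv> X (hit_time r \<phi> y w) w"
abbreviation (input) "phase_hit w \<equiv> \<phi> (hit_time r \<phi> y w) w"

lemma window_len:
  "y + 2 * (1 / real (Suc n)) < disc_level (\<lambda>i. \<bar>r i\<bar>) ((1 / real (Suc n))\<^sup>2) s 0 (len n)"
  using len [of n] disc_clock_growth [of "(1 / real (Suc n))\<^sup>2" m r "len n" s] m by auto

lemma window_nonneg: "w \<in> space N \<Longrightarrow> 0 \<le> window len y v j n w"
  unfolding window_def using crossing_path.S_nonneg [OF crossing [OF _ y]] .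

lemma window_upper: "w \<in> space N \<Longrightarrow> window len y v j n w \<le> 1 + (\<Sum>i\<in>UNIV. \<bar>r i\<bar>) * (1 / real (Suc n))"
  unfolding window_def
proof (rule crossing_path.S_upper [OF crossing [OF _ y]])
  show "\<bar>r i\<bar> \<le> (\<Sum>i\<in>UNIV. \<bar>r i\<bar>)" for i by (rule member_le_sum) auto
qed (assumption | rule window_len)+

lemma window_tendsto_1:
  "w \<in> space N \<Longrightarrow> phase_hit w = j \<Longrightarrow> level_hit w < v \<Longrightarrow> (\<lambda>n. window len y v j n w) \<longlonglongrightarrow> 1"
  unfolding window_def
  by (rule crossing_path.S_tendsto_1 [OF crossing [OF _ y]]) (auto simp only: window_len)

lemma window_tendsto_0:
  "w \<in> space N \<Longrightarrow> phase_hit w \<noteq> j \<or> v < level_hit w \<Longrightarrow> (\<lambda>n. window len y v j n w) \<longlonglongrightarrow> 0"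
  unfolding window_def
  by (rule crossing_path.S_tendsto_0 [OF crossing [OF _ y]])

text \<open>Measurability is obtained without measurability of the hitting time. Window shares are
  finite sums over grid events, and their limits 1 and 0, separated by 1/2, decide the event. The
  levels \<open>v + 1 / real (Suc k)\<close> avoid the undecided borderline.\<close>

lemma hit_event_sets: "{w \<in> space N. phase_hit w = j \<and> level_hit w \<le> v} \<in> sets N"
proof -
  have [measurable]: "window len y v' j n \<in> borel_measurable N" for v' n
    using borel_measurable_integrable [OF window_integral(1) [OF y]]
    by (simp cong: measurable_cong_sets)
  have "{w \<in> space N. phase_hit w = j \<and> level_hit w \<le> v} =
      {w \<in> space N. \<forall>k::nat. \<exists>n0. \<forall>n\<ge>n0. 1 / 2 < window len y (v + 1 / real (Suc k)) j n w}" (is "?L = ?R")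
  proof (intro equalityI subsetI)
    fix w assume w: "w \<in> ?L"
    have "\<exists>n0. \<forall>n\<ge>n0. 1 / 2 < window len y (v + 1 / real (Suc k)) j n w" for k
    proof -
      have "0 < 1 / real (Suc k)" by simp
      then have "level_hit w < v + 1 / real (Suc k)" using w by (simp only: mem_Collect_eq) linarith
      then have "(\<lambda>n. window len y (v + 1 / real (Suc k)) j n w) \<longlonglongrightarrow> 1"
        by (intro window_tendsto_1) (use w in auto)
      then have "eventually (\<lambda>n. 1 / 2 < window len y (v + 1 / real (Suc k)) j n w) sequentially"
        by (rule order_tendstoD) simp
      then show ?thesis by (simp add: eventually_sequentially)
    qed
    then show "w \<in> ?R" using w by auto
  next
    fix w assume w: "w \<in> ?R"
    show "w \<in> ?L"
    proof (rule ccontr)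
      assume "w \<notin> ?L"
      then have "phase_hit w \<noteq> j \<or> v < level_hit w" using w by auto
      then obtain k where k: "phase_hit w \<noteq> j \<or> v + 1 / real (Suc k) < level_hit w"
        using reals_Archimedean [of "level_hit w - v"] by (auto simp: inverse_eq_divide algebra_simps)
      have "(\<lambda>n. window len y (v + 1 / real (Suc k)) j n w) \<longlonglongrightarrow> 0"
        by (rule window_tendsto_0) (use w k in auto)
      then have "eventually (\<lambda>n. window len y (v + 1 / real (Suc k)) j n w < 1 / 2) sequentially"
        by (rule order_tendstoD) simp
      then obtain n1 where "\<And>n. n \<ge> n1 \<Longrightarrow> window len y (v + 1 / real (Suc k)) j n w < 1 / 2"
        by (auto simp: eventually_sequentially)
      moreover obtain n0 where "\<And>n. n \<ge> n0 \<Longrightarrow> 1 / 2 < window len y (v + 1 / real (Suc k)) j n w"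
        using w by blast
      ultimately have "1 / 2 < window len y (v + 1 / real (Suc k)) j (max n0 n1) w"
        "window len y (v + 1 / real (Suc k)) j (max n0 n1) w < 1 / 2" by simp_all
      then show False by linarith
    qed
  qed
  also have "?R \<in> sets N" by measurable
  finally show ?thesis .
qed

text \<open>On the event the share at the larger level \<open>v'\<close> tends to 1, and elsewhere
  it is nonnegative, so its expectation dominates the probability in the limit.\<close>

lemma hit_event_upper:
  assumes "v < v'" "0 < v'"
  shows "measure law {w \<in> space N. phase_hit w = j \<and> level_hit w \<le> v} \<le> G v'"
proof -
  interpret law: prob_space law by (rule prob_law)
  let ?E = "{w \<in> space N. phase_hit w = j \<and> level_hit w \<le> v}"
  define R where "R = (\<Sum>i\<in>UNIV. \<bar>r i\<bar>)"
  have R0: "0 \<le> R" unfolding R_def by (rule sum_nonneg) auto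
  have E: "?E \<in> sets law" using hit_event_sets by simp
  have int: "integrable law (window len y v' j n)" for n by (rule window_integral(1) [OF y])
  have "(\<lambda>n. \<integral>w. indicator ?E w * window len y v' j n w \<partial>law) \<longlonglongrightarrow> (\<integral>w. indicator ?E w \<partial>law)"
  proof (rule integral_dominated_convergence [where w = "\<lambda>_. 1 + R"])
    show "AE w in law. (\<lambda>n. indicator ?E w * window len y v' j n w) \<longlonglongrightarrow> indicator ?E w"
    proof (rule AE_I2)
      fix w assume w: "w \<in> space law"
      show "(\<lambda>n. indicator ?E w * window len y v' j n w) \<longlonglongrightarrow> indicator ?E w"
      proof (cases "w \<in> ?E")
        case True
        then have "(\<lambda>n. window len y v' j n w) \<longlonglongrightarrow> 1"
          by (intro window_tendsto_1) (use assms in auto)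
        then show ?thesis using True by simp
      qed simp
    qed
    show "AE w in law. norm (indicator ?E w * window len y v' j n w) \<le> 1 + R" for n
    proof (rule AE_I2)
      fix w assume w: "w \<in> space law"
      have "R * (1 / real (Suc n)) \<le> R * 1" using R0 by (intro mult_left_mono) auto
      then show "norm (indicator ?E w * window len y v' j n w) \<le> 1 + R"
        using window_nonneg [of w v' n] window_upper [of w v' n] w R0
        by (auto simp: indicator_def R_def [symmetric])
    qed
  qed (use E int in \<open>auto intro!: borel_measurable_times\<close>)
  then have "(\<lambda>n. \<integral>w. indicator ?E w * window len y v' j n w \<partial>law) \<longlonglongrightarrow> measure law ?E"
    using E by simp
  then show ?thesis
  proof (rule LIMSEQ_le [OF _ lim [OF assms(2)]], intro exI allI impI)
    fix n
    show "(\<integral>w. indicator ?E w * window len y v' j n w \<partial>law) \<le> (\<integral>w. window len y v' j n w \<partial>law)"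
    proof (rule integral_mono)
      show "integrable law (\<lambda>w. indicator ?E w * window len y v' j n w)"
        using integrable_mult_indicator [OF E int] by simp
      show "indicator ?E w * window len y v' j n w \<le> window len y v' j n w" if "w \<in> space law" for w
        using window_nonneg [of w v' n] that by (auto simp: indicator_def)
    qed (rule int)
  qed
qed

text \<open>Off the event the share at the smaller level \<open>v'\<close> tends to 0, and on it the
  share exceeds 1 by at most one weighted step, which vanishes in the limit.\<close>

lemma hit_event_lower:
  assumes "v' < v" "0 < v'"
  shows "G v' \<le> measure law {w \<in> space N. phase_hit w = j \<and> level_hit w \<le> v}"
proof -
  interpret law: prob_space law by (rule prob_law)
  let ?E = "{w \<in> space N. phase_hit w = j \<and> level_hit w \<le> v}"
  let ?E' = "space N - ?E"
  define R where "R = (\<Sum>i\<in>UNIV. \<bar>r i\<bar>)"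
  have R0: "0 \<le> R" unfolding R_def by (rule sum_nonneg) auto
  have E: "?E \<in> sets law" "?E' \<in> sets law" using hit_event_sets by auto
  have int: "integrable law (window len y v' j n)" for n by (rule window_integral(1) [OF y])
  have "(\<lambda>n. \<integral>w. indicator ?E' w * window len y v' j n w \<partial>law) \<longlonglongrightarrow> (\<integral>w. 0 \<partial>law)"
  proof (rule integral_dominated_convergence [where w = "\<lambda>_. 1 + R"])
    show "AE w in law. (\<lambda>n. indicator ?E' w * window len y v' j n w) \<longlonglongrightarrow> 0"
    proof (rule AE_I2)
      fix w assume w: "w \<in> space law"
      show "(\<lambda>n. indicator ?E' w * window len y v' j n w) \<longlonglongrightarrow> 0"
      proof (cases "w \<in> ?E'")
        case True
        then have "(\<lambda>n. window len y v' j n w) \<longlonglongrightarrow> 0"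
          by (intro window_tendsto_0) (use assms in auto)
        then show ?thesis using True by simp
      qed simp
    qed
    show "AE w in law. norm (indicator ?E' w * window len y v' j n w) \<le> 1 + R" for n
    proof (rule AE_I2)
      fix w assume w: "w \<in> space law"
      have "R * (1 / real (Suc n)) \<le> R * 1" using R0 by (intro mult_left_mono) auto
      then show "norm (indicator ?E' w * window len y v' j n w) \<le> 1 + R"
        using window_nonneg [of w v' n] window_upper [of w v' n] w R0
        by (auto simp: indicator_def R_def [symmetric])
    qed
  qed (use E int in \<open>auto intro!: borel_measurable_times\<close>)
  then have off: "(\<lambda>n. \<integral>w. indicator ?E' w * window len y v' j n w \<partial>law) \<longlonglongrightarrow> 0" by simp
  have "(\<lambda>n. (1 + R * (1 / real (Suc n))) * measure law ?E + (\<integral>w. indicator ?E' w * window len y v' j n w \<partial>law))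
      \<longlonglongrightarrow> (1 + R * 0) * measure law ?E + 0"
    by (intro tendsto_intros LIMSEQ_Suc lim_1_over_n off)
  then have "G v' \<le> (1 + R * 0) * measure law ?E + 0"
  proof (rule LIMSEQ_le [OF lim [OF assms(2)]], intro exI allI impI)
    fix n
    have int': "integrable law (\<lambda>w. indicator ?E' w * window len y v' j n w)"
      using integrable_mult_indicator [OF E(2) int] by simp
    have intE: "integrable law (\<lambda>w. (1 + R * (1 / real (Suc n))) * indicator ?E w)"
      using E by (intro integrable_mult_right integrable_real_indicator) (simp_all add: less_top [symmetric])
    have "(\<integral>w. window len y v' j n w \<partial>law) \<le>
        (\<integral>w. (1 + R * (1 / real (Suc n))) * indicator ?E w + indicator ?E' w * window len y v' j n w \<partial>law)"
    proof (rule integral_mono [OF int])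
      show "integrable law (\<lambda>w. (1 + R * (1 / real (Suc n))) * indicator ?E w + indicator ?E' w * window len y v' j n w)"
        by (intro Bochner_Integration.integrable_add intE int')
      show "window len y v' j n w \<le> (1 + R * (1 / real (Suc n))) * indicator ?E w + indicator ?E' w * window len y v' j n w"
        if "w \<in> space law" for w
        using window_upper [of w v' n] that by (auto simp: indicator_def R_def [symmetric])
    qed
    also have "\<dots> = (1 + R * (1 / real (Suc n))) * measure law ?E + (\<integral>w. indicator ?E' w * window len y v' j n w \<partial>law)"
      using E by (subst Bochner_Integration.integral_add [OF intE int']) simp
    finally show "(\<integral>w. window len y v' j n w \<partial>law) \<le>
        (1 + R * (1 / real (Suc n))) * measure law ?E + (\<integral>w. indicator ?E' w * window len y v' j n w \<partial>law)" .
  qed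
  then show ?thesis by simp
qed

text \<open>The two bounds compare the probability with \<open>G\<close> strictly to the right and
  to the left of \<open>v\<close>; continuity closes the gap.\<close>

lemma hit_event_measure:
  assumes "0 < v" "isCont G v"
  shows "measure law {w \<in> space N. phase_hit w = j \<and> level_hit w \<le> v} = G v"
proof (rule antisym)
  let ?q = "measure law {w \<in> space N. phase_hit w = j \<and> level_hit w \<le> v}"
  have lim: "(G \<longlongrightarrow> G v) (at_right v)" "(G \<longlongrightarrow> G v) (at_left v)"
    using assms(2) by (auto simp: isCont_def intro: tendsto_mono [OF at_le])
  show "?q \<le> G v"
    by (rule tendsto_lowerbound [OF lim(1)])
      (use assms in \<open>auto simp: eventually_at_right_field intro!: exI [of _ "v + 1"] hit_event_upper\<close>)
  show "G v \<le> ?q"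
    by (rule tendsto_upperbound [OF lim(2)])
      (use assms in \<open>auto simp: eventually_at_left_field intro!: exI [of _ 0] hit_event_lower\<close>)
qed

end

end


section \<open>Row vectors times the scaled generator and rate matrices\<close>

lemma matrix_inv_diag_mat:
  assumes "\<And>i. d i \<noteq> 0"
  shows "matrix_inv (diag_mat d) = diag_mat (\<lambda>i. 1 / d i)"
proof -
  have inv: "diag_mat d ** diag_mat (\<lambda>i. 1 / d i) = mat 1" "diag_mat (\<lambda>i. 1 / d i) ** diag_mat d = mat 1"
    using assms by (simp_all add: vec_eq_iff diag_mat_def mat_def matrix_matrix_mult_def
        if_distrib [of "\<lambda>x. x * _"] cong: if_cong)
  have "\<exists>M. diag_mat d ** M = mat 1 \<and> M ** diag_mat d = mat 1"
    using inv by blast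
  then have "diag_mat d ** matrix_inv (diag_mat d) = mat 1"
    unfolding matrix_inv_def by (rule someI2_ex) simp
  then have "diag_mat (\<lambda>i. 1 / d i) ** (diag_mat d ** matrix_inv (diag_mat d)) = diag_mat (\<lambda>i. 1 / d i)"
    by simp
  then show ?thesis by (simp add: matrix_mul_assoc inv)
qed

lemma row_scaled_generator:
  fixes T :: "real^'s^('s::finite)"
  assumes "\<And>i. r i \<noteq> 0"
  shows "(a v* (matrix_inv (diag_mat (\<lambda>i. \<bar>r i\<bar>)) ** T)) $ j = (\<Sum>i\<in>UNIV. T $ i $ j / \<bar>r i\<bar> * a $ i)"
proof -
  have "matrix_inv (diag_mat (\<lambda>i. \<bar>r i\<bar>)) = diag_mat (\<lambda>i. 1 / \<bar>r i\<bar>)"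
    using assms by (intro matrix_inv_diag_mat) simp
  then show ?thesis
    by (simp add: diag_mat_def vector_matrix_mult_def matrix_matrix_mult_def
      if_distrib [of "\<lambda>x. _ * x"] mult_ac cong: if_cong)
qed

lemma row_scaled_rates:
  fixes c r :: "'s::finite \<Rightarrow> real"
  assumes "\<And>i. r i \<noteq> 0"
  shows "(a v* (matrix_inv (diag_mat (\<lambda>i. \<bar>r i\<bar>)) ** diag_mat c)) $ j = c j / \<bar>r j\<bar> * a $ j"
proof -
  have "matrix_inv (diag_mat (\<lambda>i. \<bar>r i\<bar>)) = diag_mat (\<lambda>i. 1 / \<bar>r i\<bar>)"
    using assms by (intro matrix_inv_diag_mat) simp
  then have "matrix_inv (diag_mat (\<lambda>i. \<bar>r i\<bar>)) ** diag_mat c = diag_mat (\<lambda>i. c i / \<bar>r i\<bar>)"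
    by (simp add: diag_mat_def vec_eq_iff matrix_matrix_mult_def
        if_distrib [of "\<lambda>x. x * _"] cong: if_cong)
  then show ?thesis
    by (simp add: vector_matrix_mult_def diag_mat_def if_distrib [of "\<lambda>x. _ * x"] cong: if_cong)
qed

lemma row_mult_add: "a v* (A + (B :: real^'s^('s::finite))) = a v* A + a v* B"
  by (simp add: vec_eq_iff vector_matrix_mult_def algebra_simps sum.distrib)

lemma row_mult_scaleR_right: "a v* (k *\<^sub>R (B :: real^'s^('s::finite))) = k *\<^sub>R (a v* B)"
  by (simp add: vec_eq_iff vector_matrix_mult_def sum_distrib_left mult_ac)

lemma row_mult_scaleR_left: "(k *\<^sub>R a) v* (B :: real^'s^('s::finite)) = k *\<^sub>R (a v* B)"
  by (simp add: vec_eq_iff vector_matrix_mult_def sum_distrib_left mult_ac)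

section \<open>Densities\<close>

text \<open>Setting the density to 0 at the origin turns an integral over a half-open interval into
  one over a closed interval, to which the results on indefinite integrals apply.\<close>

lemma density_primitive:
  fixes g :: "real \<Rightarrow> real"
  assumes int: "\<And>v. 0 < v \<Longrightarrow> set_integrable lborel {0<..v} g"
  defines "G \<equiv> \<lambda>x. if 0 < x then g x else 0"
  shows "0 < v \<Longrightarrow> G integrable_on {0..v}" "0 < v \<Longrightarrow> (LBINT x:{0<..v}. g x) = integral {0..v} G"
proof -
  have eq: "indicator {0..v} x *\<^sub>R G x = indicator {0<..v} x *\<^sub>R g x" for x
    by (auto simp: G_def indicator_def)
  assume v: "0 < v"
  have *: "set_integrable lborel {0..v} G"
    using int [OF v] unfolding set_integrable_def eq .
  show "G integrable_on {0..v}" using set_borel_integral_eq_integral(1) [OF *] .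
  show "(LBINT x:{0<..v}. g x) = integral {0..v} G"
    using set_borel_integral_eq_integral(2) [OF *] unfolding set_lebesgue_integral_def eq .
qed

lemma density_integral_continuous:
  fixes g :: "real \<Rightarrow> real"
  assumes int: "\<And>v. 0 < v \<Longrightarrow> set_integrable lborel {0<..v} g" and "0 < v"
  shows "isCont (\<lambda>v. LBINT x:{0<..v}. g x) v"
proof -
  let ?G = "\<lambda>x. if 0 < x then g x else 0"
  have "continuous_on {0..v + 1} (\<lambda>v. integral {0..v} ?G)"
    by (rule indefinite_integral_continuous_1) (rule density_primitive(1) [OF int], use \<open>0 < v\<close> in auto)
  then have "continuous_on {0<..<v + 1} (\<lambda>v. integral {0..v} ?G)"
    by (rule continuous_on_subset) auto
  then have "continuous_on {0<..<v + 1} (\<lambda>v. LBINT x:{0<..v}. g x)"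
    by (rule continuous_on_eq) (auto simp: density_primitive(2) [OF int])
  then show ?thesis
    using \<open>0 < v\<close> by (simp add: continuous_on_eq_continuous_at)
qed

lemma density_tendsto_0:
  fixes g :: "real \<Rightarrow> real"
  assumes int: "\<And>v. 0 < v \<Longrightarrow> set_integrable lborel {0<..v} g"
  shows "((\<lambda>v. LBINT x:{0<..v}. g x) \<longlongrightarrow> 0) (at_right 0)"
proof -
  let ?G = "\<lambda>x. if 0 < x then g x else 0"
  have "continuous_on {0..1} (\<lambda>v. integral {0..v} ?G)"
    by (rule indefinite_integral_continuous_1) (rule density_primitive(1) [OF int], auto)
  then have "((\<lambda>v. integral {0..v} ?G) \<longlongrightarrow> integral {0..0} ?G) (at 0 within {0..1})"
    unfolding continuous_on_def by (rule bspec) simp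
  then have "((\<lambda>v. integral {0..v} ?G) \<longlongrightarrow> 0) (at_right 0)"
    by (simp add: at_within_Icc_at_right)
  then show ?thesis
    by (rule Lim_transform_eventually)
      (auto simp: eventually_at_right_field density_primitive(2) [OF int] intro!: exI [of _ 1])
qed

text \<open>An integral determines a density only almost everywhere; continuity lets differentiation
  recover every value. The atom is what remains as \<open>v\<close> tends to 0 from the
  right.\<close>

lemma exponential_density:
  fixes g :: "real \<Rightarrow> real"
  assumes int: "\<And>v. 0 < v \<Longrightarrow> set_integrable lborel {0<..v} g"
    and cont: "\<And>v. 0 < v \<Longrightarrow> isCont g v"
    and F: "\<And>v. 0 < v \<Longrightarrow> a - exp (- l * v) * b = (LBINT x:{0<..v}. g x) + P"
  shows "0 < v \<Longrightarrow> g v = l * exp (- l * v) * b" and "P = a - b"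
proof -
  let ?G = "\<lambda>x. if 0 < x then g x else 0"
  show "g v = l * exp (- l * v) * b" if v: "0 < v"
  proof -
    \<comment> \<open>The interval keeps away from 0, where \<open>?G\<close> may jump, and has
      \<open>v\<close> in its interior, so that the derivative is two-sided.\<close>
    have contG: "continuous_on {v/2..v+1} ?G"
      by (rule continuous_on_eq [of _ g]) (use v cont in \<open>auto intro!: continuous_at_imp_continuous_on\<close>)
    have "((\<lambda>w. integral {v/2..w} ?G) has_real_derivative ?G v) (at v within {v/2..v+1})"
      by (rule integral_has_real_derivative [OF contG]) (use v in auto)
    then have "((\<lambda>w. integral {v/2..w} ?G) has_real_derivative g v) (at v)"
      using v by (simp add: at_within_Icc_at)
    then have "((\<lambda>w. integral {0..v/2} ?G + integral {v/2..w} ?G + P) has_real_derivative g v) (at v)"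
      by (auto intro!: derivative_eq_intros)
    then have "((\<lambda>w. a - exp (- l * w) * b) has_real_derivative g v) (at v)"
    proof (rule has_field_derivative_transform_within_open [of _ _ _ "{v/2<..}"])
      fix w assume w: "w \<in> {v/2<..}"
      have "integral {0..v/2} ?G + integral {v/2..w} ?G = integral {0..w} ?G"
        by (rule Henstock_Kurzweil_Integration.integral_combine)
          (use v w density_primitive(1) [OF int, of w] in auto)
      also have "\<dots> = (LBINT x:{0<..w}. g x)"
        using density_primitive(2) [OF int, of w] w v by simp
      finally show "integral {0..v/2} ?G + integral {v/2..w} ?G + P = a - exp (- l * w) * b"
        using F [of w] w v by simp
    qed (use v in auto)
    moreover have "((\<lambda>w. a - exp (- l * w) * b) has_real_derivative l * exp (- l * v) * b) (at v)"
      by (auto intro!: derivative_eq_intros)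
    ultimately show ?thesis by (rule DERIV_unique)
  qed
  have "((\<lambda>v. a - exp (- l * v) * b) \<longlongrightarrow> a - exp (- l * 0) * b) (at_right 0)"
    by (intro tendsto_intros)
  moreover have "((\<lambda>v. a - exp (- l * v) * b) \<longlongrightarrow> 0 + P) (at_right 0)"
    by (rule Lim_transform_eventually [OF tendsto_add [OF density_tendsto_0 [OF int] tendsto_const [of P]]])
      (auto simp: eventually_at_right_field F [symmetric] intro!: exI [of _ 1])
  ultimately have "a - exp (- l * 0) * b = 0 + P"
    by (rule tendsto_unique [OF trivial_limit_at_right_real])
  then show "P = a - b" by simp
qed

lemma set_integral_exp_tail:
  fixes l :: real
  assumes "0 < l"
  shows "set_integrable lborel {c<..} (\<lambda>x. exp (- l * x))" "(LBINT x:{c<..}. exp (- l * x)) = exp (- l * c) / l"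
proof -
  have "((\<lambda>x. exp (- l * x)) has_integral exp (- l * c) / l) {c..}"
    using assms by (rule has_integral_exp_minus_to_infinity)
  then have "((\<lambda>x. if x \<in> {c..} then exp (- l * x) else 0) has_integral exp (- l * c) / l) UNIV"
    unfolding has_integral_restrict_UNIV by simp
  then have *: "((\<lambda>x. indicator {c<..} x * exp (- l * x)) has_integral exp (- l * c) / l) UNIV"
    by (rule has_integral_spike [of "{c}", rotated 2]) auto
  have "has_bochner_integral lborel (\<lambda>x. indicator {c<..} x * exp (- l * x)) (exp (- l * c) / l)"
  proof (rule has_bochner_integral_nn_integral)
    show "(\<integral>\<^sup>+ x. ennreal (indicator {c<..} x * exp (- l * x)) \<partial>lborel) = ennreal (exp (- l * c) / l)"
      by (rule nn_integral_has_integral_lborel [OF _ _ *]) auto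
  qed (use assms in auto)
  then show "set_integrable lborel {c<..} (\<lambda>x. exp (- l * x))" "(LBINT x:{c<..}. exp (- l * x)) = exp (- l * c) / l"
    by (auto simp: set_integrable_def set_lebesgue_integral_def has_bochner_integral_iff)
qed

text \<open>Primitives are used instead of an expression with the inverse of \<open>A\<close>,
  because a scaled generator annihilates the constant column and is singular. The last property is
  the differential equation of the exponential in integrated form.\<close>

lemma row_mexp_primitive:
  fixes A :: "real^'s^('s::finite)"
  obtains I :: "real \<Rightarrow> 's \<Rightarrow> real" where
    "\<And>j. I 0 j = 0"
    "\<And>t j. t \<in> {0..ym} \<Longrightarrow> ((\<lambda>t. I t j) has_real_derivative (a v* mexp (t *\<^sub>R A)) $ j) (at t)"
    "\<And>t j. t \<in> {0..ym} \<Longrightarrow> (\<Sum>i\<in>UNIV. A $ i $ j * I t i) = (a v* mexp (t *\<^sub>R A)) $ j - a $ j"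
proof -
  let ?\<alpha> = "\<lambda>t j. (a v* mexp (t *\<^sub>R A)) $ j"
  \<comment> \<open>Integration starts at -1 so that the derivative at \<open>t = 0\<close> is
    two-sided as well; the second integral restores \<open>I 0 j = 0\<close>.\<close>
  define I where "I t j = integral {-1..t} (\<lambda>t. ?\<alpha> t j) - integral {-1..0} (\<lambda>t. ?\<alpha> t j)" for t j
  have I0: "I 0 j = 0" for j by (simp add: I_def)
  have deriv: "((\<lambda>t. I t j) has_real_derivative ?\<alpha> t j) (at t)" if "t \<in> {0..ym}" for t j
  proof -
    have "continuous_on {-1..ym+1} (\<lambda>t. ?\<alpha> t j)"
      by (intro continuous_at_imp_continuous_on ballI DERIV_isCont [OF row_mexp_deriv])
    then have "((\<lambda>t. integral {-1..t} (\<lambda>t. ?\<alpha> t j)) has_real_derivative ?\<alpha> t j) (at t within {-1..ym+1})"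
      by (rule integral_has_real_derivative) (use that in auto)
    then have "((\<lambda>t. integral {-1..t} (\<lambda>t. ?\<alpha> t j)) has_real_derivative ?\<alpha> t j) (at t)"
      using that by (simp add: at_within_Icc_at)
    then show ?thesis unfolding I_def by (auto intro!: derivative_eq_intros)
  qed
  have "(\<Sum>i\<in>UNIV. A $ i $ j * I t i) = ?\<alpha> t j - a $ j" if t: "t \<in> {0..ym}" for t j
  proof (cases "t = 0")
    case True
    then show ?thesis using row_mexp_0 [of a A] by (simp add: I0 del: row_mexp_0)
  next
    case False
    let ?D = "\<lambda>t. (\<Sum>i\<in>UNIV. A $ i $ j * I t i) - ?\<alpha> t j"
    have "\<exists>z>0. z < t \<and> ?D t - ?D 0 = (t - 0) * ((\<Sum>i\<in>UNIV. A $ i $ j * ?\<alpha> z i) - ((a v* mexp (z *\<^sub>R A)) v* A) $ j)"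
      by (rule MVT2) (use t False in \<open>auto intro!: DERIV_diff DERIV_sum DERIV_cmult deriv row_mexp_deriv\<close>)
    moreover have "(\<Sum>i\<in>UNIV. A $ i $ j * ?\<alpha> z i) = ((a v* mexp (z *\<^sub>R A)) v* A) $ j" for z
      by (simp add: vector_matrix_mult_def mult_ac)
    moreover have "?D 0 = - a $ j"
      by (simp only: I0 row_mexp_0) simp
    ultimately show ?thesis by auto
  qed
  with I0 deriv show ?thesis by (rule that [of I])
qed


section \<open>The explicit solution\<close>

locale solution =
  fixes T :: "real^'s^('s::finite)" and c r :: "'s \<Rightarrow> real"
    and a b :: "real^'s" and lam :: real and A B :: "real^'s^'s"
  assumes r: "\<And>i. r i \<noteq> 0" and lam: "0 < lam"
    and A: "\<And>i j. A $ i $ j = T $ i $ j / \<bar>r i\<bar>"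
    and B: "\<And>x j. (x v* B) $ j = (x v* A) $ j + lam * (c j / \<bar>r j\<bar> * x $ j)"
    and boundary: "\<And>k j. 0 < c j \<Longrightarrow> (a v* mpow A k) $ j = (b v* mpow B k) $ j"
begin

definition F :: "real \<Rightarrow> real \<Rightarrow> 's \<Rightarrow> real" where
  "F v y j = (a v* mexp (y *\<^sub>R A)) $ j - exp (- lam * v) * (b v* mexp (y *\<^sub>R B)) $ j"

lemma F_0: "F v 0 j = a $ j - exp (- lam * v) * b $ j"
  unfolding F_def row_mexp_0 ..

lemma exp_lipschitz:
  assumes "0 \<le> v" "0 \<le> v'"
  shows "\<bar>exp (- lam * v) - exp (- lam * v')\<bar> \<le> lam * \<bar>v - v'\<bar>"
proof -
  have *: "\<bar>exp (- lam * v) - exp (- lam * v')\<bar> \<le> lam * \<bar>v - v'\<bar>" if v: "0 \<le> v" "v < v'" for v v'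
  proof -
    have "\<exists>z>v. z < v' \<and> exp (- lam * v') - exp (- lam * v) = (v' - v) * (- lam * exp (- lam * z))"
      by (rule MVT2) (use v in \<open>auto intro!: derivative_eq_intros\<close>)
    then obtain z where z: "v < z" "exp (- lam * v') - exp (- lam * v) = (v' - v) * (- lam * exp (- lam * z))"
      by blast
    have "exp (- lam * z) \<le> 1" using z v lam by simp
    then have "lam * exp (- lam * z) \<le> lam" using lam by simp
    then have "(v' - v) * (lam * exp (- lam * z)) \<le> (v' - v) * lam" using v by (intro mult_left_mono) auto
    moreover have "0 \<le> (v' - v) * (lam * exp (- lam * z))" using v lam by auto
    ultimately show ?thesis using z v by (simp add: mult_ac)
  qed
  consider "v < v'" | "v' < v" | "v = v'" by linarith
  then show ?thesis
    using *[of v v'] *[of v' v] assms by cases (auto simp: abs_minus_commute)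
qed

text \<open>\<open>H\<close> is the integral of \<open>F\<close> over the clock, divided by
  \<open>\<bar>r j\<bar>\<close>. Along the characteristic of \<open>j\<close>, the factor
  \<open>exp (- lam * v)\<close> is differentiated at speed \<open>c j\<close>, which yields the
  term \<open>lam * c j / \<bar>r j\<bar>\<close> by which \<open>B\<close> differs from
  \<open>A\<close>; the rest is the integrated equation of the two exponentials. The mean value
  theorem then gives the form required by \<open>transport\<close>.\<close>

lemma occupation_density:
  assumes ym: "0 \<le> ym"
  obtains H :: "real \<Rightarrow> real \<Rightarrow> 's \<Rightarrow> real" and L :: real where
    "transport T c (\<lambda>i. \<bar>r i\<bar>) (\<lambda>v. F v 0) H L ym"
    "\<And>v y j. y \<in> {0..ym} \<Longrightarrow> ((\<lambda>y. H v y j) has_real_derivative F v y j / \<bar>r j\<bar>) (at y)"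
proof -
  obtain IA where IA: "\<And>j. IA 0 j = (0::real)"
    "\<And>t j. t \<in> {0..ym} \<Longrightarrow> ((\<lambda>t. IA t j) has_real_derivative (a v* mexp (t *\<^sub>R A)) $ j) (at t)"
    "\<And>t j. t \<in> {0..ym} \<Longrightarrow> (\<Sum>i\<in>UNIV. A $ i $ j * IA t i) = (a v* mexp (t *\<^sub>R A)) $ j - a $ j"
    using row_mexp_primitive [of ym a A] by blast
  obtain IB where IB: "\<And>j. IB 0 j = (0::real)"
    "\<And>t j. t \<in> {0..ym} \<Longrightarrow> ((\<lambda>t. IB t j) has_real_derivative (b v* mexp (t *\<^sub>R B)) $ j) (at t)"
    "\<And>t j. t \<in> {0..ym} \<Longrightarrow> (\<Sum>i\<in>UNIV. B $ i $ j * IB t i) = (b v* mexp (t *\<^sub>R B)) $ j - b $ j"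
    using row_mexp_primitive [of ym b B] by blast
  define H where "H v y j = (IA y j - exp (- lam * v) * IB y j) / \<bar>r j\<bar>" for v y j
  have H_deriv: "((\<lambda>y. H v y j) has_real_derivative F v y j / \<bar>r j\<bar>) (at y)" if "y \<in> {0..ym}" for v y j
    unfolding H_def F_def by (intro DERIV_cdivide DERIV_diff DERIV_cmult IA IB that)
  have bounded: "\<exists>M. \<forall>t\<in>{0..ym}. \<bar>(x v* mexp (t *\<^sub>R M')) $ j\<bar> \<le> M" for x :: "real^'s" and M' j
  proof -
    have "continuous_on {0..ym} (\<lambda>t. (x v* mexp (t *\<^sub>R M')) $ j)"
      by (intro continuous_at_imp_continuous_on ballI DERIV_isCont [OF row_mexp_deriv])
    from compact_imp_bounded [OF compact_continuous_image [OF this compact_Icc]]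
    show ?thesis by (auto simp: bounded_iff)
  qed
  obtain MA where MA: "\<And>t j. t \<in> {0..ym} \<Longrightarrow> \<bar>(a v* mexp (t *\<^sub>R A)) $ j\<bar> \<le> MA j"
    using bounded [of a A] by metis
  obtain MB where MB: "\<And>t j. t \<in> {0..ym} \<Longrightarrow> \<bar>(b v* mexp (t *\<^sub>R B)) $ j\<bar> \<le> MB j"
    using bounded [of b B] by metis
  define M where "M = (\<Sum>j\<in>UNIV. \<bar>MA j\<bar> + \<bar>MB j\<bar>)"
  have M: "\<bar>(a v* mexp (t *\<^sub>R A)) $ j\<bar> \<le> M" "\<bar>(b v* mexp (t *\<^sub>R B)) $ j\<bar> \<le> M" if "t \<in> {0..ym}" for t j
  proof -
    have "\<bar>MA j\<bar> + \<bar>MB j\<bar> \<le> M" unfolding M_def by (rule member_le_sum) auto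
    then show "\<bar>(a v* mexp (t *\<^sub>R A)) $ j\<bar> \<le> M" "\<bar>(b v* mexp (t *\<^sub>R B)) $ j\<bar> \<le> M"
      using MA [OF that, of j] MB [OF that, of j] by linarith+
  qed
  have M0: "0 \<le> M" unfolding M_def by (intro sum_nonneg) auto
  have lip: "\<bar>I y j - I y' j\<bar> \<le> M * \<bar>y - y'\<bar>"
    if I: "\<And>t j. t \<in> {0..ym} \<Longrightarrow> ((\<lambda>t. I t j) has_real_derivative D t j) (at t)"
      and D: "\<And>t j. t \<in> {0..ym} \<Longrightarrow> \<bar>D t j\<bar> \<le> M" and y: "y \<in> {0..ym}" "y' \<in> {0..ym}"
    for I D :: "real \<Rightarrow> 's \<Rightarrow> real" and y y' j
  proof -
    have *: "\<bar>I y' j - I y j\<bar> \<le> M * (y' - y)" if y: "y \<in> {0..ym}" "y' \<in> {0..ym}" "y < y'" for y y'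
    proof -
      have "\<exists>z>y. z < y' \<and> I y' j - I y j = (y' - y) * D z j"
        by (rule MVT2) (use y I in auto)
      then obtain z where z: "y < z" "z < y'" "I y' j - I y j = (y' - y) * D z j" by blast
      have "\<bar>D z j\<bar> \<le> M" using D [of z j] z y by auto
      then have "(y' - y) * \<bar>D z j\<bar> \<le> (y' - y) * M" using y by (intro mult_left_mono) auto
      then show ?thesis unfolding z(3) abs_mult using y by (simp add: mult.commute)
    qed
    consider "y < y'" | "y' < y" | "y = y'" by linarith
    then show ?thesis
      using *[of y y'] *[of y' y] y by cases (auto simp: abs_minus_commute)
  qed
  note IA_lip = lip [of IA "\<lambda>t j. (a v* mexp (t *\<^sub>R A)) $ j", OF IA(2) M(1)]
  note IB_lip = lip [of IB "\<lambda>t j. (b v* mexp (t *\<^sub>R B)) $ j", OF IB(2) M(2)]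
  have IB_bound: "\<bar>IB y j\<bar> \<le> M * ym" if "y \<in> {0..ym}" for y j
  proof -
    have "\<bar>IB y j - IB 0 j\<bar> \<le> M * \<bar>y - 0\<bar>" by (rule IB_lip) (use that in auto)
    also have "\<dots> \<le> M * ym" using that M0 by (intro mult_left_mono) auto
    finally show ?thesis by (simp add: IB(1))
  qed
  have IA_bound: "\<bar>IA y j\<bar> \<le> M * ym" if "y \<in> {0..ym}" for y j
  proof -
    have "\<bar>IA y j - IA 0 j\<bar> \<le> M * \<bar>y - 0\<bar>" by (rule IA_lip) (use that in auto)
    also have "\<dots> \<le> M * ym" using that M0 by (intro mult_left_mono) auto
    finally show ?thesis by (simp add: IA(1))
  qed
  define m where "m = Min (range (\<lambda>i. \<bar>r i\<bar>))"
  have m: "m > 0" "\<And>i. m \<le> \<bar>r i\<bar>" using r by (auto simp: m_def)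
  have div: "\<bar>x / \<bar>r j\<bar>\<bar> \<le> K / m" if "\<bar>x\<bar> \<le> K" for x K j
    unfolding abs_divide using m m(2) [of j] that by (intro frac_le) auto
  define S where "S = (\<Sum>j\<in>UNIV. \<bar>a $ j\<bar> + \<bar>b $ j\<bar>)"
  have S: "\<bar>a $ j\<bar> + \<bar>b $ j\<bar> \<le> S" for j unfolding S_def by (rule member_le_sum) auto
  have S0: "0 \<le> S" unfolding S_def by (intro sum_nonneg) auto
  \<comment> \<open>The numerator of \<open>H\<close> has Lipschitz constant \<open>2 * M\<close> in
    the clock and \<open>lam * (M * ym)\<close> in the level, and is bounded by
    \<open>2 * (M * ym)\<close>.\<close>
  define L1 where "L1 = 2 * M + lam * (M * ym) + 2 * (M * ym)"
  have L1: "0 \<le> L1" "2 * M \<le> L1" "lam * (M * ym) \<le> L1" "2 * (M * ym) \<le> L1"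
    unfolding L1_def using M0 ym lam by (auto intro!: add_nonneg_nonneg mult_nonneg_nonneg)
  define L where "L = L1 / m + S * lam + S"
  have L: "L1 / m \<le> L" "S * lam \<le> L" "S \<le> L" unfolding L_def using L1 S0 lam m by auto
  have exp1: "\<bar>exp (- lam * v)\<bar> \<le> 1" if "0 \<le> v" for v using that lam by simp
  have "transport T c (\<lambda>i. \<bar>r i\<bar>) (\<lambda>v. F v 0) H L ym"
  proof
    fix v v' :: real and i :: 's assume v: "0 \<le> v" "0 \<le> v'"
    have "\<bar>F v 0 i - F v' 0 i\<bar> = \<bar>b $ i\<bar> * \<bar>exp (- lam * v) - exp (- lam * v')\<bar>"
      unfolding F_0 abs_mult [symmetric] by (simp add: algebra_simps abs_minus_commute)
    also have "\<dots> \<le> S * (lam * \<bar>v - v'\<bar>)"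
      using S [of i] S0 by (intro mult_mono exp_lipschitz v) auto
    also have "\<dots> \<le> L * \<bar>v - v'\<bar>" using mult_right_mono [OF L(2), of "\<bar>v - v'\<bar>"] by (simp add: mult_ac)
    finally show "\<bar>F v 0 i - F v' 0 i\<bar> \<le> L * \<bar>v - v'\<bar>" .
  next
    fix v :: real and i :: 's assume v: "0 \<le> v"
    have "\<bar>exp (- lam * v) * b $ i\<bar> \<le> 1 * \<bar>b $ i\<bar>"
      unfolding abs_mult using exp1 [OF v] by (intro mult_right_mono) auto
    then show "\<bar>F v 0 i\<bar> \<le> L" unfolding F_0 using S [of i] L(3) by linarith
  next
    fix v v' y y' :: real and i :: 's
    assume v: "0 \<le> v" "0 \<le> v'" and y: "y \<in> {0..ym}" "y' \<in> {0..ym}"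
    have "\<bar>(IA y i - exp (- lam * v) * IB y i) - (IA y' i - exp (- lam * v') * IB y' i)\<bar> \<le>
        L1 * (\<bar>v - v'\<bar> + \<bar>y - y'\<bar>)"
    proof -
      have "\<bar>IA y i - IA y' i\<bar> \<le> M * \<bar>y - y'\<bar>" by (rule IA_lip [OF _ _ y])
      moreover have "\<bar>exp (- lam * v') * (IB y i - IB y' i)\<bar> \<le> 1 * (M * \<bar>y - y'\<bar>)"
        unfolding abs_mult using exp1 [OF v(2)] IB_lip [OF _ _ y, of i] by (intro mult_mono) auto
      moreover have "\<bar>(exp (- lam * v) - exp (- lam * v')) * IB y i\<bar> \<le> (lam * \<bar>v - v'\<bar>) * (M * ym)"
        unfolding abs_mult using exp_lipschitz [OF v] IB_bound [OF y(1), of i] lam by (intro mult_mono) auto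
      moreover have "(IA y i - exp (- lam * v) * IB y i) - (IA y' i - exp (- lam * v') * IB y' i) =
          (IA y i - IA y' i) - exp (- lam * v') * (IB y i - IB y' i) - (exp (- lam * v) - exp (- lam * v')) * IB y i"
        by (simp add: algebra_simps)
      ultimately have "\<bar>(IA y i - exp (- lam * v) * IB y i) - (IA y' i - exp (- lam * v') * IB y' i)\<bar> \<le>
          M * \<bar>y - y'\<bar> + M * \<bar>y - y'\<bar> + (lam * \<bar>v - v'\<bar>) * (M * ym)" by linarith
      also have "\<dots> = lam * (M * ym) * \<bar>v - v'\<bar> + 2 * M * \<bar>y - y'\<bar>" by (simp add: mult_ac)
      also have "\<dots> \<le> L1 * \<bar>v - v'\<bar> + L1 * \<bar>y - y'\<bar>"
        using L1 by (intro add_mono mult_right_mono) auto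
      finally show ?thesis by (simp add: distrib_left)
    qed
    from div [OF this, of i] have "\<bar>H v y i - H v' y' i\<bar> \<le> L1 / m * (\<bar>v - v'\<bar> + \<bar>y - y'\<bar>)"
      unfolding H_def diff_divide_distrib [symmetric] by simp
    also have "\<dots> \<le> L * (\<bar>v - v'\<bar> + \<bar>y - y'\<bar>)" using L(1) by (intro mult_right_mono) auto
    finally show "\<bar>H v y i - H v' y' i\<bar> \<le> L * (\<bar>v - v'\<bar> + \<bar>y - y'\<bar>)" .
  next
    fix v y :: real and i :: 's assume v: "0 \<le> v" and y: "y \<in> {0..ym}"
    have "\<bar>exp (- lam * v) * IB y i\<bar> \<le> 1 * (M * ym)"
      unfolding abs_mult using exp1 [OF v] IB_bound [OF y, of i] by (intro mult_mono) auto
    then have "\<bar>IA y i - exp (- lam * v) * IB y i\<bar> \<le> L1"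
      using IA_bound [OF y, of i] L1(4) by linarith
    then show "\<bar>H v y i\<bar> \<le> L"
      unfolding H_def using div [of "IA y i - exp (- lam * v) * IB y i" L1 i] L(1) by linarith
  next
    show "H v 0 i = 0" for v i by (simp add: H_def IA(1) IB(1))
  next
    fix y :: real and i :: 's assume y: "y \<in> {0..ym}" and ci: "c i > 0"
    \<comment> \<open>For an upward phase the two power series have equal coefficients by
      \<open>boundary\<close>, so the integrand of \<open>H\<close> at level 0 vanishes
      identically.\<close>
    have eq: "(a v* mexp (t *\<^sub>R A)) $ i = (b v* mexp (t *\<^sub>R B)) $ i" for t
      unfolding row_mexp_series boundary [OF ci] ..
    have "IA y i - IB y i = 0"
    proof (cases "y = 0")
      case False
      then have "\<exists>z>0. z < y \<and> (IA y i - IB y i) - (IA 0 i - IB 0 i) = (y - 0) * ((a v* mexp (z *\<^sub>R A)) $ i - (b v* mexp (z *\<^sub>R B)) $ i)"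
        by (intro MVT2 DERIV_diff IA IB) (use y in auto)
      then show ?thesis by (auto simp: eq IA(1) IB(1))
    qed (simp add: IA(1) IB(1))
    then show "H 0 y i = 0" by (simp add: H_def)
  next
    fix v y h :: real and j :: 's
    assume v: "0 \<le> v" and y: "y \<in> {0..ym}" and h: "0 < h" and v': "0 \<le> v - c j * h" and y': "0 \<le> y - \<bar>r j\<bar> * h"
    let ?v = "\<lambda>s. v - c j * s" and ?y = "\<lambda>s. y - \<bar>r j\<bar> * s"
    let ?q = "\<lambda>s. F (?v s) 0 j + (\<Sum>i\<in>UNIV. T $ i $ j * H (?v s) (?y s) i)"
    have "((\<lambda>s. H (?v s) (?y s) j) has_real_derivative - ?q s) (at s)" if s: "0 \<le> s" "s \<le> h" for s
    proof -
      let ?\<alpha> = "(a v* mexp (?y s *\<^sub>R A)) $ j" and ?\<beta> = "(b v* mexp (?y s *\<^sub>R B)) $ j"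
      let ?e = "exp (- lam * ?v s)"
      have "\<bar>r j\<bar> * s \<le> \<bar>r j\<bar> * h" using s by (intro mult_left_mono) auto
      moreover have "0 \<le> \<bar>r j\<bar> * s" using s by simp
      ultimately have ys: "?y s \<in> {0..ym}" using y y' unfolding atLeastAtMost_iff by linarith
      have dy: "(?y has_real_derivative - \<bar>r j\<bar>) (at s)" by (auto intro!: derivative_eq_intros)
      have dA: "((\<lambda>s. IA (?y s) j) has_real_derivative ?\<alpha> * - \<bar>r j\<bar>) (at s)"
        by (rule DERIV_chain2 [OF IA(2) [OF ys] dy])
      have dB: "((\<lambda>s. IB (?y s) j) has_real_derivative ?\<beta> * - \<bar>r j\<bar>) (at s)"
        by (rule DERIV_chain2 [OF IB(2) [OF ys] dy])
      have de: "((\<lambda>s. exp (- lam * ?v s)) has_real_derivative lam * c j * ?e) (at s)"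
        by (auto intro!: derivative_eq_intros)
      have d: "((\<lambda>s. H (?v s) (?y s) j) has_real_derivative
          (?\<alpha> * - \<bar>r j\<bar> - (lam * c j * ?e * IB (?y s) j + ?\<beta> * - \<bar>r j\<bar> * ?e)) / \<bar>r j\<bar>) (at s)"
        unfolding H_def by (intro DERIV_cdivide DERIV_diff dA DERIV_mult de dB)
      have sumA: "(\<Sum>i\<in>UNIV. A $ i $ j * IA (?y s) i) = ?\<alpha> - a $ j" by (rule IA(3) [OF ys])
      have "((\<chi> i. IB (?y s) i) v* B) $ j = ?\<beta> - b $ j"
        using IB(3) [OF ys, of j] by (simp add: vector_matrix_mult_def mult_ac)
      \<comment> \<open>Replacing \<open>B\<close> by \<open>A\<close> leaves the drift term, which
        matches the derivative of \<open>exp (- lam * v)\<close> in \<open>d\<close>.\<close>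
      then have sumB: "(\<Sum>i\<in>UNIV. A $ i $ j * IB (?y s) i) = ?\<beta> - b $ j - lam * (c j / \<bar>r j\<bar> * IB (?y s) j)"
        unfolding B by (simp add: vector_matrix_mult_def mult_ac)
      have "(\<Sum>i\<in>UNIV. T $ i $ j * H (?v s) (?y s) i) =
          (\<Sum>i\<in>UNIV. A $ i $ j * IA (?y s) i) - ?e * (\<Sum>i\<in>UNIV. A $ i $ j * IB (?y s) i)"
        unfolding sum_distrib_left sum_subtractf [symmetric]
        by (intro sum.cong refl) (simp add: H_def A algebra_simps diff_divide_distrib)
      then have q: "?q s = ?\<alpha> - ?e * ?\<beta> + ?e * lam * (c j / \<bar>r j\<bar> * IB (?y s) j)"
        unfolding F_0 sumA sumB by (simp add: algebra_simps)
      have "(?\<alpha> * - \<bar>r j\<bar> - (lam * c j * ?e * IB (?y s) j + ?\<beta> * - \<bar>r j\<bar> * ?e)) / \<bar>r j\<bar> = - ?q s"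
        unfolding q using r [of j] by (simp add: field_simps)
      with d show ?thesis by simp
    qed
    then have "\<exists>z>0. z < h \<and> H (?v h) (?y h) j - H (?v 0) (?y 0) j = (h - 0) * - ?q z"
      by (intro MVT2 h) auto
    then obtain z where "0 < z" "z < h" "H (?v h) (?y h) j - H (?v 0) (?y 0) j = (h - 0) * - ?q z"
      by blast
    then show "\<exists>s\<in>{0..h}. H v y j - H (?v h) (?y h) j = h * ?q s"
      by (intro bexI [of _ z]) (auto simp: algebra_simps)
  qed auto
  with H_deriv show ?thesis by (rule that [rotated])
qed

end


section \<open>Convergence of the window expectations to the explicit solution\<close>

locale fluid_solution =
  fluid_clock T c N Pr \<phi> X \<mu> r + solution T c r a b lam A B
  for T :: "real^'s^('s::finite)" and c :: "'s \<Rightarrow> real"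
    and N :: "'w measure" and Pr :: "'s \<Rightarrow> real \<Rightarrow> 'w measure"
    and \<phi> :: "real \<Rightarrow> 'w \<Rightarrow> 's" and X :: "real \<Rightarrow> 'w \<Rightarrow> real"
    and \<mu> :: "'s \<Rightarrow> real measure" and r :: "'s \<Rightarrow> real"
    and a b :: "real^'s" and lam :: real and A B :: "real^'s^'s" +
  assumes start: "\<And>v j. 0 \<le> v \<Longrightarrow> measure (\<mu> j) {0..v} = F v 0 j"
begin

text \<open>The grid width is \<open>\<epsilon>^2\<close>, so each occupation time is known up to a
  constant times \<open>\<epsilon>^2\<close>; after division by the window width
  \<open>\<epsilon>\<close> the error still tends to 0, and the quotient of \<open>H\<close> tends
  to its derivative times \<open>\<bar>r j\<bar>\<close>.\<close>

lemma window_limit: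
  assumes y: "0 < y" and v: "0 < v" and m: "0 < m" "\<And>i. m \<le> \<bar>r i\<bar>"
    and len: "\<And>n. y + 2 * (1 / real (Suc n)) < real (len n) * (m * (1 / real (Suc n))\<^sup>2)"
    and len_bound: "\<And>n. real (len n) * (1 / real (Suc n))\<^sup>2 \<le> Z"
  shows "(\<lambda>n. \<integral>w. window len y v j n w \<partial>law) \<longlonglongrightarrow> F v y j"
proof -
  let ?\<epsilon> = "\<lambda>n. 1 / real (Suc n)"
  have "0 \<le> y + 2" using y by simp
  from occupation_density [OF this] obtain H L where
    trans: "transport T c (\<lambda>i. \<bar>r i\<bar>) (\<lambda>v. F v 0) H L (y + 2)" and
    H: "\<And>v y' j. y' \<in> {0..y + 2} \<Longrightarrow> ((\<lambda>y. H v y j) has_real_derivative F v y' j / \<bar>r j\<bar>) (at y')"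
    by blast
  interpret transport T c "\<lambda>i. \<bar>r i\<bar>" "\<lambda>v. F v 0" H L "y + 2" by (rule trans)
  obtain K where K: "K \<ge> 0"
    "\<And>h u n v y' j. 0 < h \<Longrightarrow> h \<le> 1 \<Longrightarrow>
       (\<And>v y j. u 0 v y j = 0) \<Longrightarrow>
       (\<And>n v y j. v < 0 \<or> y < 0 \<Longrightarrow> u n v y j = 0) \<Longrightarrow>
       (\<And>n v y j. 0 \<le> v \<Longrightarrow> 0 \<le> y \<Longrightarrow> u (Suc n) v y j =
          h * F v 0 j + (\<Sum>i\<in>UNIV. mexp (h *\<^sub>R T) $ i $ j * u n (v - c i * h) (y - \<bar>r i\<bar> * h) i)) \<Longrightarrow>
       (\<And>i. m \<le> \<bar>r i\<bar>) \<Longrightarrow> 0 \<le> v \<Longrightarrow> y' \<in> {0..y + 2} \<Longrightarrow> y' \<le> real n * (m * h) \<Longrightarrow>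
       \<bar>u n v y' j - H v y' j\<bar> \<le> K * h * (1 + K * h) ^ n"
    using grid_error by blast
  \<comment> \<open>The Gronwall factor \<open>(1 + K * h) ^ len n\<close> is at most the
    exponential of \<open>K\<close> times the time horizon \<open>len n * h\<close>, which stays
    below \<open>Z\<close>.\<close>
  define E where "E = exp (K * Z)"
  have err: "\<bar>occ ((?\<epsilon> n)\<^sup>2) (len n) v y' j - H v y' j\<bar> \<le> K * (?\<epsilon> n)\<^sup>2 * E"
    if y': "y' \<in> {0..y + 2 * ?\<epsilon> n}" for n y'
  proof -
    define h where "h = (?\<epsilon> n)\<^sup>2"
    have h: "0 < h" "h \<le> 1" by (auto simp: h_def power_le_one)
    have "\<bar>occ h (len n) v y' j - H v y' j\<bar> \<le> K * h * (1 + K * h) ^ len n"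
    proof (rule K(2) [OF h])
      have "2 * ?\<epsilon> n \<le> 2" by (simp add: divide_le_eq)
      then show "y' \<in> {0..y + 2}" using y' unfolding atLeastAtMost_iff by (intro conjI) linarith+
      show "y' \<le> real (len n) * (m * h)" using y' len [of n] unfolding h_def atLeastAtMost_iff by linarith
      show "occ h (Suc n) v y j = h * F v 0 j + (\<Sum>i\<in>UNIV. mexp (h *\<^sub>R T) $ i $ j * occ h n (v - c i * h) (y - \<bar>r i\<bar> * h) i)"
        if "0 \<le> v" "0 \<le> y" for n v y j
        using occ_Suc [of h v y n j] that h by (simp add: start)
    qed (use occ_0 occ_neg m v in auto)
    also have "(1 + K * h) ^ len n \<le> exp (K * h) ^ len n"
      using exp_ge_add_one_self [of "K * h"] K(1) h by (intro power_mono) auto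
    also have "\<dots> = exp (K * (real (len n) * h))" by (simp add: exp_of_nat_mult [symmetric] mult_ac)
    also have "\<dots> \<le> E" unfolding E_def h_def using len_bound K(1) by (simp add: mult_left_mono)
    finally show ?thesis using K(1) h unfolding h_def by (simp add: mult_left_mono)
  qed
  have eps0: "?\<epsilon> \<longlonglongrightarrow> 0" by (rule LIMSEQ_Suc [OF lim_1_over_n])
  let ?H = "\<lambda>n. \<bar>r j\<bar> * real (Suc n) * (H v (y + 2 * ?\<epsilon> n) j - H v (y + ?\<epsilon> n) j)"
  have "?H \<longlonglongrightarrow> F v y j"
  proof -
    have d: "((\<lambda>h. (H v (y + h) j - H v y j) / h) \<longlongrightarrow> F v y j / \<bar>r j\<bar>) (at 0)"
      by (rule DERIV_D [OF H]) (use y in auto)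
    have "filterlim ?\<epsilon> (at 0) sequentially" "filterlim (\<lambda>n. 2 * ?\<epsilon> n) (at 0) sequentially"
      using eps0 tendsto_mult_right_zero [OF eps0, of 2] by (auto intro!: filterlim_atI eventuallyI)
    from this [THEN filterlim_compose [OF d]]
    \<comment> \<open>The quotient over the window is twice the quotient with increment
      \<open>2 * \<epsilon>\<close> minus that with increment \<open>\<epsilon>\<close>, both based
      at \<open>y\<close>; differentiability at the single point \<open>y\<close> therefore
      suffices.\<close>
    have lim: "(\<lambda>n. \<bar>r j\<bar> * (2 * ((H v (y + 2 * ?\<epsilon> n) j - H v y j) / (2 * ?\<epsilon> n)) - (H v (y + ?\<epsilon> n) j - H v y j) / ?\<epsilon> n))
       \<longlonglongrightarrow> \<bar>r j\<bar> * (2 * (F v y j / \<bar>r j\<bar>) - F v y j / \<bar>r j\<bar>)"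
      by (intro tendsto_mult tendsto_diff tendsto_const)
    have 1: "\<bar>r j\<bar> * (2 * (F v y j / \<bar>r j\<bar>) - F v y j / \<bar>r j\<bar>) = F v y j"
      using m(1) m(2) [of j] by (simp add: field_simps)
    have 2: "\<bar>r j\<bar> * (2 * ((H v (y + 2 * ?\<epsilon> n) j - H v y j) / (2 * ?\<epsilon> n)) - (H v (y + ?\<epsilon> n) j - H v y j) / ?\<epsilon> n) = ?H n" for n
    proof -
      have "2 * (x / (2 * ?\<epsilon> n)) - z / ?\<epsilon> n = real (Suc n) * (x - z)" for x z
        by (simp del: of_nat_Suc add: field_simps)
      then show ?thesis by (simp del: of_nat_Suc)
    qed
    show ?thesis using lim unfolding 1 2 .
  qed
  moreover have "(\<lambda>n. (\<integral>w. window len y v j n w \<partial>law) - ?H n) \<longlonglongrightarrow> 0"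
  proof (rule Lim_null_comparison)
    show "(\<lambda>n. \<bar>r j\<bar> * (2 * K * E) * ?\<epsilon> n) \<longlonglongrightarrow> 0"
      by (rule tendsto_mult_right_zero [OF eps0])
    show "eventually (\<lambda>n. norm ((\<integral>w. window len y v j n w \<partial>law) - ?H n) \<le> \<bar>r j\<bar> * (2 * K * E) * ?\<epsilon> n) sequentially"
    proof (rule eventuallyI)
      fix n
      define x where "x = occ ((?\<epsilon> n)\<^sup>2) (len n) v (y + 2 * ?\<epsilon> n) j - H v (y + 2 * ?\<epsilon> n) j"
      define z where "z = occ ((?\<epsilon> n)\<^sup>2) (len n) v (y + ?\<epsilon> n) j - H v (y + ?\<epsilon> n) j"
      have pos: "0 < ?\<epsilon> n" by simp
      have "\<bar>x\<bar> \<le> K * (?\<epsilon> n)\<^sup>2 * E" "\<bar>z\<bar> \<le> K * (?\<epsilon> n)\<^sup>2 * E"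
        unfolding x_def z_def by (rule err; use pos y in \<open>simp only: atLeastAtMost_iff\<close>; linarith)+
      then have "\<bar>x - z\<bar> \<le> 2 * (K * (?\<epsilon> n)\<^sup>2 * E)" by linarith
      also have "\<dots> = 2 * K * E * (?\<epsilon> n)\<^sup>2" by (simp only: mult_ac)
      finally have "\<bar>x - z\<bar> \<le> 2 * K * E * (?\<epsilon> n)\<^sup>2" .
      then have "\<bar>r j\<bar> * real (Suc n) * \<bar>x - z\<bar> \<le> \<bar>r j\<bar> * real (Suc n) * (2 * K * E * (?\<epsilon> n)\<^sup>2)"
        by (intro mult_left_mono) auto
      also have "\<dots> = \<bar>r j\<bar> * (2 * K * E) * ?\<epsilon> n"
        by (simp add: power2_eq_square field_simps del: of_nat_Suc)
      finally have "\<bar>\<bar>r j\<bar> * real (Suc n) * (x - z)\<bar> \<le> \<bar>r j\<bar> * (2 * K * E) * ?\<epsilon> n"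
        by (simp add: abs_mult del: of_nat_Suc)
      moreover have "(\<integral>w. window len y v j n w \<partial>law) - ?H n = \<bar>r j\<bar> * real (Suc n) * (x - z)"
        unfolding window_integral(2) [OF y] x_def z_def by (simp add: algebra_simps del: of_nat_Suc)
      ultimately show "norm ((\<integral>w. window len y v j n w \<partial>law) - ?H n) \<le> \<bar>r j\<bar> * (2 * K * E) * ?\<epsilon> n"
        by simp
    qed
  qed
  ultimately have "(\<lambda>n. ?H n + ((\<integral>w. window len y v j n w \<partial>law) - ?H n)) \<longlonglongrightarrow> F v y j + 0"
    by (rule tendsto_add)
  then show ?thesis by simp
qed

lemma law_hit:
  assumes y: "0 < y" and v: "0 < v"
  shows "{w \<in> space N. \<phi> (hit_time r \<phi> y w) w = j \<and> X (hit_time r \<phi> y w) w \<le> v} \<in> sets N"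
    and "measure law {w \<in> space N. \<phi> (hit_time r \<phi> y w) w = j \<and> X (hit_time r \<phi> y w) w \<le> v} = F v y j"
proof -
  define m where "m = Min (range (\<lambda>i. \<bar>r i\<bar>))"
  have m: "m > 0" "\<And>i. m \<le> \<bar>r i\<bar>" using r by (auto simp: m_def)
  \<comment> \<open>Enough steps for the slowest clock to pass \<open>y + 2\<close>; the added 1
    makes the inequality strict, and the horizon \<open>len n * h\<close> remains bounded in
    \<open>n\<close>.\<close>
  define len where "len n = nat \<lceil>(y + 2) / (m * (1 / real (Suc n))\<^sup>2)\<rceil> + 1" for n
  have len: "y + 2 * (1 / real (Suc n)) < real (len n) * (m * (1 / real (Suc n))\<^sup>2)"
    "real (len n) * (1 / real (Suc n))\<^sup>2 \<le> (y + 2) / m + 2" for n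
  proof -
    define h where "h = (1 / real (Suc n))\<^sup>2"
    have h: "0 < h" "h \<le> 1" by (auto simp: h_def power_le_one)
    have q0: "0 \<le> (y + 2) / (m * h)" using y m h by simp
    have l: "(y + 2) / (m * h) < real (len n)" "real (len n) \<le> (y + 2) / (m * h) + 2"
      using q0 unfolding len_def h_def [symmetric] by linarith+
    have "y + 2 < real (len n) * (m * h)" using l(1) m h by (simp add: pos_divide_less_eq)
    moreover have "2 * (1 / real (Suc n)) \<le> 2" by (simp add: divide_le_eq)
    ultimately show "y + 2 * (1 / real (Suc n)) < real (len n) * (m * (1 / real (Suc n))\<^sup>2)"
      unfolding h_def by linarith
    have "real (len n) * h \<le> ((y + 2) / (m * h) + 2) * h" using l(2) h by (intro mult_right_mono) auto
    also have "\<dots> = (y + 2) / m + 2 * h" using h m by (simp add: field_simps)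
    finally show "real (len n) * (1 / real (Suc n))\<^sup>2 \<le> (y + 2) / m + 2"
      using h(2) unfolding h_def [symmetric] by linarith
  qed
  note lim = window_limit [OF y _ m len]
  show "{w \<in> space N. \<phi> (hit_time r \<phi> y w) w = j \<and> X (hit_time r \<phi> y w) w \<le> v} \<in> sets N"
    by (rule hit_event_sets [OF y m(2) len(1) lim])
  have "isCont (\<lambda>v. F v y j) v" unfolding F_def by (intro continuous_intros)
  then show "measure law {w \<in> space N. \<phi> (hit_time r \<phi> y w) w = j \<and> X (hit_time r \<phi> y w) w \<le> v} = F v y j"
    by (intro hit_event_measure [OF y m(2) len(1)] lim v)
qed

end

section \<open>The boundary conditions\<close>

lemma mpow_Suc_row: "a v* mpow A (Suc n) = (a v* mpow A n) v* (A :: real^'s^('s::finite))"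
  by (simp only: mpow.simps mpow_commute vector_matrix_mul_assoc)

text \<open>The form of the \<open>n\<close>-th iterate determines its density, and the definition
  of the operator then gives the form of the next one. Pointwise values of the density are justified
  by the hypothesis on all iterates: each is an integral plus an atom, hence continuous.\<close>

lemma D_iter_exponential:
  fixes T :: "real^'s^('s::finite)"
  assumes c: "\<And>i. c i \<noteq> 0" and r: "\<And>i. r i \<noteq> 0"
    and atoms: "\<And>n. has_density_atom (D_iter T r c \<mu> \<nu> n) (\<nu> n) (P n)"
    and A: "\<And>x j. (x v* A) $ j = (\<Sum>i\<in>UNIV. T $ i $ j / \<bar>r i\<bar> * x $ i)"
    and B: "\<And>x j. (x v* B) $ j = (x v* A) $ j + lam * (c j / \<bar>r j\<bar> * x $ j)"
    and start: "\<And>v j. 0 < v \<Longrightarrow> mass \<mu> {0..v} $ j = a $ j - exp (- lam * v) * b $ j"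
  shows "0 < v \<Longrightarrow> D_iter T r c \<mu> \<nu> n v $ j = (a v* mpow A n) $ j - exp (- lam * v) * (b v* mpow B n) $ j"
    and "0 < v \<Longrightarrow> \<nu> n v $ j = lam * exp (- lam * v) * (b v* mpow B n) $ j"
    and "P n $ j = (a v* mpow A n) $ j - (b v* mpow B n) $ j"
proof -
  let ?D = "D_iter T r c \<mu> \<nu>"
  have int: "set_integrable lborel {0<..v} (\<lambda>x. \<nu> n x $ j)"
    and D: "?D n v $ j = (LBINT x:{0<..v}. \<nu> n x $ j) + P n $ j" if "0 < v" for n v j
    using atoms [of n] that by (auto simp: has_density_atom_def)
  have contD: "isCont (\<lambda>v. ?D n v $ j) v" if v: "0 < v" for n v j
  proof -
    have "isCont (\<lambda>v. (LBINT x:{0<..v}. \<nu> n x $ j) + P n $ j) v"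
      by (intro continuous_intros density_integral_continuous int v)
    moreover have "eventually (\<lambda>v. ?D n v $ j = (LBINT x:{0<..v}. \<nu> n x $ j) + P n $ j) (nhds v)"
      using eventually_nhds_in_open [of "{0<..}" v] v by (auto simp: D elim: eventually_mono)
    ultimately show ?thesis by (simp add: isCont_cong)
  qed
  have rec: "?D (Suc n) v $ j = (\<Sum>i\<in>UNIV. T $ i $ j / \<bar>r i\<bar> * ?D n v $ i) - c j / \<bar>r j\<bar> * \<nu> n v $ j" for n v j
    by (simp add: apply_D_def)
  \<comment> \<open>As \<open>c j\<close> is nonzero, the density can be solved for from two
    successive iterates, and it inherits their continuity.\<close>
  have "\<nu> n v $ j = \<bar>r j\<bar> / c j * ((\<Sum>i\<in>UNIV. T $ i $ j / \<bar>r i\<bar> * ?D n v $ i) - ?D (Suc n) v $ j)" for n v j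
    unfolding rec using c [of j] r [of j] by (simp add: field_simps)
  then have cont: "isCont (\<lambda>v. \<nu> n v $ j) v" if "0 < v" for n v j
    by (simp only:) (intro continuous_mult continuous_diff continuous_sum continuous_const contD that)
  have \<nu>: "\<nu> n v $ j = lam * exp (- lam * v) * (b v* mpow B n) $ j"
    and P: "P n $ j = (a v* mpow A n) $ j - (b v* mpow B n) $ j"
    if form: "\<And>v j. 0 < v \<Longrightarrow> ?D n v $ j = (a v* mpow A n) $ j - exp (- lam * v) * (b v* mpow B n) $ j" and "0 < v"
    for n v j
  proof -
    have eq: "(a v* mpow A n) $ j - exp (- lam * v) * (b v* mpow B n) $ j = (LBINT x:{0<..v}. \<nu> n x $ j) + P n $ j"
      if "0 < v" for v
      using D [OF that, of n j] form [OF that, of j] by simp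
    show "\<nu> n v $ j = lam * exp (- lam * v) * (b v* mpow B n) $ j"
      by (rule exponential_density(1) [where g = "\<lambda>x. \<nu> n x $ j", OF int cont eq that(2)])
    show "P n $ j = (a v* mpow A n) $ j - (b v* mpow B n) $ j"
      by (rule exponential_density(2) [where g = "\<lambda>x. \<nu> n x $ j", OF int cont eq])
  qed
  have form: "?D n v $ j = (a v* mpow A n) $ j - exp (- lam * v) * (b v* mpow B n) $ j" if "0 < v" for n v j
    using that
  proof (induction n arbitrary: v j)
    case 0
    then show ?case by (simp add: start)
  next
    case (Suc n)
    have \<nu>': "\<nu> n v $ j = lam * exp (- lam * v) * (b v* mpow B n) $ j"
      by (rule \<nu> [OF Suc.IH Suc.prems])
    have "?D (Suc n) v $ j = (\<Sum>i\<in>UNIV. T $ i $ j / \<bar>r i\<bar> * ((a v* mpow A n) $ i - exp (- lam * v) * (b v* mpow B n) $ i))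
        - c j / \<bar>r j\<bar> * (lam * exp (- lam * v) * (b v* mpow B n) $ j)"
      unfolding rec Suc.IH [OF Suc.prems] \<nu>' ..
    also have "\<dots> = (a v* mpow A (Suc n)) $ j - exp (- lam * v) * (b v* mpow B (Suc n)) $ j"
      unfolding mpow_Suc_row B A
      by (simp add: right_diff_distrib sum_subtractf sum_distrib_left distrib_left mult_ac)
    finally show ?case .
  qed
  show "0 < v \<Longrightarrow> ?D n v $ j = (a v* mpow A n) $ j - exp (- lam * v) * (b v* mpow B n) $ j"
    by (rule form)
  show "0 < v \<Longrightarrow> \<nu> n v $ j = lam * exp (- lam * v) * (b v* mpow B n) $ j"
    by (rule \<nu> [OF form])
  show "P n $ j = (a v* mpow A n) $ j - (b v* mpow B n) $ j"
    by (rule P [OF form, of 1]) simp_all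
qed

text \<open>Applying \<open>A\<close> to the \<open>n\<close>-th atom involves downward phases only,
  by induction. The boundary condition equates that sum with the drift term
  \<open>lam * c j / \<bar>r j\<bar>\<close> times the \<open>j\<close>-th entry of
  \<open>b B^n\<close>, which is exactly what the next atom subtracts.\<close>

lemma atoms_vanish:
  fixes T :: "real^'s^('s::finite)"
  assumes c: "\<And>i. c i \<noteq> 0" and r: "\<And>i. r i \<noteq> 0"
    and A: "\<And>x j. (x v* A) $ j = (\<Sum>i\<in>UNIV. T $ i $ j / \<bar>r i\<bar> * x $ i)"
    and B: "\<And>x j. (x v* B) $ j = (x v* A) $ j + lam * (c j / \<bar>r j\<bar> * x $ j)"
    and \<nu>: "\<And>n v j. 0 < v \<Longrightarrow> \<nu> n v $ j = lam * exp (- lam * v) * (b v* mpow B n) $ j"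
    and P: "\<And>n j. P n $ j = (a v* mpow A n) $ j - (b v* mpow B n) $ j"
    and P0: "\<And>j. c j > 0 \<Longrightarrow> P 0 $ j = 0"
    and bc: "\<And>n. boundary_condition T r c (\<nu> n) (P n)"
    and "0 < c j"
  shows "P n $ j = 0"
  using \<open>0 < c j\<close>
proof (induction n arbitrary: j)
  case 0
  then show ?case by (rule P0)
next
  case (Suc n)
  let ?b = "(b v* mpow B n) $ j"
  let ?S = "\<Sum>i\<in>{i. c i < 0}. P n $ i * (inverse \<bar>r i\<bar> * T $ i $ j)"
  have "((\<lambda>x. lam * exp (- lam * x) * ?b) \<longlongrightarrow> lam * exp (- lam * 0) * ?b) (at_right 0)"
    by (intro tendsto_intros)
  then have "((\<lambda>x. \<nu> n x $ j) \<longlongrightarrow> lam * ?b) (at_right 0)"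
    by (rule Lim_transform_eventually [THEN tendsto_eq_rhs])
      (auto simp: eventually_at_right_field \<nu> intro!: exI [of _ 1])
  moreover have "((\<lambda>x. \<nu> n x $ j) \<longlongrightarrow> ?S * inverse (inverse \<bar>r j\<bar> * c j)) (at_right 0)"
    using bc [of n] Suc.prems by (simp add: boundary_condition_def)
  ultimately have "lam * ?b = ?S * inverse (inverse \<bar>r j\<bar> * c j)"
    by (rule tendsto_unique [OF trivial_limit_at_right_real])
  then have S: "?S = lam * (c j / \<bar>r j\<bar> * ?b)"
    using r [of j] Suc.prems by (simp add: field_simps)
  \<comment> \<open>The induction hypothesis extends the sum from the downward phases to all
    phases.\<close>
  have "?S = (\<Sum>i\<in>UNIV. T $ i $ j / \<bar>r i\<bar> * P n $ i)"
  proof (rule sum.mono_neutral_cong_left)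
    show "\<forall>i\<in>UNIV - {i. c i < 0}. T $ i $ j / \<bar>r i\<bar> * P n $ i = 0"
    proof
      fix i assume "i \<in> UNIV - {i. c i < 0}"
      then have "0 < c i" using c [of i] by (auto simp: not_less)
      then show "T $ i $ j / \<bar>r i\<bar> * P n $ i = 0" using Suc.IH by simp
    qed
  qed (auto simp: divide_inverse mult_ac)
  also have "\<dots> = (P n v* A) $ j" by (simp add: A)
  also have "\<dots> = ((a v* mpow A n) v* A) $ j - ((b v* mpow B n) v* A) $ j"
    by (simp add: A P right_diff_distrib sum_subtractf)
  finally have "?S = ((a v* mpow A n) v* A) $ j - ((b v* mpow B n) v* A) $ j" .
  moreover have "P (Suc n) $ j = ((a v* mpow A n) v* A) $ j - (((b v* mpow B n) v* A) $ j + lam * (c j / \<bar>r j\<bar> * ?b))"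
    by (simp only: P mpow_Suc_row B)
  ultimately show ?case using S by linarith
qed


section \<open>The exponential initial law, and assembly of the result\<close>

lemma start_exponential:
  fixes \<mu> :: "('s::finite) \<Rightarrow> real measure" and P0 b :: "real^'s"
  assumes finite: "\<And>i. finite_measure (\<mu> i)" and sets: "\<And>i. sets (\<mu> i) = sets borel"
    and lam: "0 < lam" and F: "\<And>v j. 0 < v \<Longrightarrow> mass \<mu> {0..v} $ j = P0 $ j + (1 - exp (- lam * v)) * b $ j"
  shows "mass \<mu> {0..} $ j = P0 $ j + b $ j"
    and "0 \<le> v \<Longrightarrow> measure (\<mu> j) {0..v} = mass \<mu> {0..} $ j - exp (- lam * v) * b $ j"
    and "0 < v \<Longrightarrow> mass \<mu> {v<..} $ j = exp (- lam * v) * b $ j"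
proof -
  have [simp]: "B \<in> sets borel \<Longrightarrow> B \<in> sets (\<mu> i)" for B i by (simp add: sets)
  note F' = F [unfolded mass_def, simplified]
  \<comment> \<open>The masses are known on \<open>[0, v]\<close> for positive \<open>v\<close>
    only; the total mass follows by continuity from below.\<close>
  have "(\<lambda>n. measure (\<mu> j) {0..real (Suc n)}) \<longlonglongrightarrow> measure (\<mu> j) (\<Union>n. {0..real (Suc n)})" for j
    by (rule finite_measure.finite_Lim_measure_incseq [OF finite]) (auto simp: incseq_def)
  moreover have "(\<Union>n. {0..real (Suc n)}) = {0..}"
  proof -
    have "\<exists>n. x \<le> real (Suc n)" for x :: real
    proof -
      obtain n where "x \<le> real n" using real_arch_simple by blast
      then show ?thesis by (intro exI [of _ n]) simp
    qed
    then show ?thesis by (auto simp del: of_nat_Suc)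
  qed
  ultimately have "(\<lambda>n. measure (\<mu> j) {0..real (Suc n)}) \<longlonglongrightarrow> measure (\<mu> j) {0..}" for j by simp
  moreover have "(\<lambda>n. measure (\<mu> j) {0..real (Suc n)}) \<longlonglongrightarrow> P0 $ j + (1 - 0) * b $ j" for j
  proof -
    have "(\<lambda>n. exp (- lam * real (Suc n))) \<longlonglongrightarrow> 0"
      by (intro filterlim_compose [OF exp_at_bot]
          filterlim_tendsto_neg_mult_at_bot [OF tendsto_const] filterlim_compose [OF filterlim_real_sequentially filterlim_Suc])
        (use lam in simp)
    then have "(\<lambda>n. P0 $ j + (1 - exp (- lam * real (Suc n))) * b $ j) \<longlonglongrightarrow> P0 $ j + (1 - 0) * b $ j"
      by (intro tendsto_intros)
    then show ?thesis by (simp add: F' del: of_nat_Suc)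
  qed
  ultimately have total: "measure (\<mu> j) {0..} = P0 $ j + (1 - 0) * b $ j" for j
    by (rule LIMSEQ_unique)
  then show a: "mass \<mu> {0..} $ j = P0 $ j + b $ j" for j by (simp add: mass_def)
  show "measure (\<mu> j) {0..v} = mass \<mu> {0..} $ j - exp (- lam * v) * b $ j" if "0 \<le> v"
  proof (cases "v = 0")
    case True
    \<comment> \<open>At level 0 the mass comes from continuity from above along shrinking
      intervals; the recursion for \<open>occ\<close> needs it there too.\<close>
    have "(\<lambda>n. measure (\<mu> j) {0..1 / real (Suc n)}) \<longlonglongrightarrow> measure (\<mu> j) (\<Inter>n. {0..1 / real (Suc n)})"
      by (rule finite_measure.finite_Lim_measure_decseq [OF finite])
        (auto simp: decseq_def intro: order_trans frac_le)
    moreover have "(\<Inter>n. {0..1 / real (Suc n)}) = {0..0}"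
    proof -
      have le: "x \<le> 0" if "\<forall>n. x \<le> 1 / real (Suc n)" for x
        by (rule LIMSEQ_le_const [OF LIMSEQ_Suc [OF lim_1_over_n]]) (use that in blast)
      have "0 \<le> x \<and> (\<forall>n. x \<le> 1 / real (Suc n)) \<longleftrightarrow> x = 0" for x
        using le [of x] by (metis antisym divide_nonneg_nonneg of_nat_0_le_iff order_refl zero_le_one)
      moreover have "(\<Inter>n. {0..1 / real (Suc n)}) = {x. 0 \<le> x \<and> (\<forall>n. x \<le> 1 / real (Suc n))}"
        by (auto simp del: of_nat_Suc)
      ultimately show ?thesis by (simp only:) simp
    qed
    moreover have "(\<lambda>n. measure (\<mu> j) {0..1 / real (Suc n)}) \<longlonglongrightarrow> P0 $ j + (1 - exp (- lam * 0)) * b $ j"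
    proof -
      have "(\<lambda>n. P0 $ j + (1 - exp (- lam * (1 / real (Suc n)))) * b $ j) \<longlonglongrightarrow> P0 $ j + (1 - exp (- lam * 0)) * b $ j"
        by (intro tendsto_intros LIMSEQ_Suc lim_1_over_n)
      then show ?thesis by (simp add: F' del: of_nat_Suc)
    qed
    ultimately have "measure (\<mu> j) {0..0} = P0 $ j + (1 - exp (- lam * 0)) * b $ j"
      using LIMSEQ_unique by metis
    then show ?thesis using True by (simp add: a)
  next
    case False
    then show ?thesis using that F' [of v j] by (simp add: a algebra_simps)
  qed
  show "mass \<mu> {v<..} $ j = exp (- lam * v) * b $ j" if "0 < v"
  proof -
    have "{0..} = {0..v} \<union> {v<..}" "{0..v} \<inter> {v<..} = {}" using that by auto
    then have "measure (\<mu> j) {0..} = measure (\<mu> j) {0..v} + measure (\<mu> j) {v<..}"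
      using finite_measure.finite_measure_Union [OF finite, of "{0..v}" j "{v<..}"] by auto
    then show ?thesis
      using F' [OF that, of j] total [of j] by (simp add: mass_def algebra_simps)
  qed
qed

lemma set_integral_scaled_exp:
  fixes g :: "real \<Rightarrow> real"
  assumes "0 < l" and g: "\<And>x. 0 < x \<Longrightarrow> g x = q * l * exp (- l * x)"
  shows "(LBINT x:{0<..}. g x) = q" "0 < v \<Longrightarrow> (LBINT x:{0<..v}. g x) = (1 - exp (- l * v)) * q"
proof -
  let ?f = "\<lambda>x. q * l * exp (- l * x)"
  have tail: "(LBINT x:{w<..}. ?f x) = q * exp (- l * w)" for w
    using set_integral_exp_tail(2) [OF assms(1), of w] assms(1) by simp
  have "(LBINT x:{0<..}. g x) = (LBINT x:{0<..}. ?f x)"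
    by (rule set_lebesgue_integral_cong) (auto simp: g)
  then show "(LBINT x:{0<..}. g x) = q" by (simp only: tail) simp
  assume v: "0 < v"
  have int: "set_integrable lborel {0<..} ?f"
    using set_integral_exp_tail(1) [OF assms(1), of 0] by simp
  have "(LBINT x:{0<..v} \<union> {v<..}. ?f x) = (LBINT x:{0<..v}. ?f x) + (LBINT x:{v<..}. ?f x)"
  proof (rule set_integral_Un)
    show "set_integrable lborel {0<..v} ?f" "set_integrable lborel {v<..} ?f"
      by (rule set_integrable_subset [OF int]; use v in auto)+
  qed auto
  moreover have "{0<..v} \<union> {v<..} = {0<..}" using v by auto
  ultimately have "q * exp (- l * 0) = (LBINT x:{0<..v}. ?f x) + q * exp (- l * v)"
    by (simp only: tail)
  moreover have "z = (1 - exp (- l * v)) * q" if "q * exp (- l * 0) = z + q * exp (- l * v)" for z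
    using that by (simp add: algebra_simps)
  ultimately have "(LBINT x:{0<..v}. ?f x) = (1 - exp (- l * v)) * q" by blast
  moreover have "(LBINT x:{0<..v}. g x) = (LBINT x:{0<..v}. ?f x)"
    by (rule set_lebesgue_integral_cong) (auto simp: g)
  ultimately show "(LBINT x:{0<..v}. g x) = (1 - exp (- l * v)) * q" by simp
qed

theorem theorem1:
  fixes T :: "real^'s^('s::finite)"
    and c r :: "'s \<Rightarrow> real"
    and N :: "'w measure"
    and Pr :: "'s \<Rightarrow> real \<Rightarrow> 'w measure"
    and \<phi> :: "real \<Rightarrow> 'w \<Rightarrow> 's"
    and X :: "real \<Rightarrow> 'w \<Rightarrow> real"
    and \<mu> :: "'s \<Rightarrow> real measure"
    and \<nu> :: "nat \<Rightarrow> real \<Rightarrow> real^'s"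
    and P :: "nat \<Rightarrow> real^'s"
    and p :: "'s \<Rightarrow> real"
    and lam y v :: real
  assumes "generator_matrix T" and "irreducible_matrix T"
    and "\<And>i. c i \<noteq> 0" and "\<And>i. r i \<noteq> 0"
    and "fluid_queue N Pr T c \<phi> X"
    and "initial_distribution \<mu>"
    and "\<And>n. has_density_atom (D_iter T r c \<mu> \<nu> n) (\<nu> n) (P n)"
    and "\<And>j. c j > 0 \<Longrightarrow> P 0 $ j = 0"
    and "lam > 0" and "\<And>i. 0 \<le> p i \<and> p i \<le> 1"
    and "\<And>i x. x > 0 \<Longrightarrow> \<nu> 0 x $ i = p i * lam * exp (- lam * x)"
    and "\<And>n. boundary_condition T r c (\<nu> n) (P n)"
    and "y > 0" and "v > 0"
  shows "exp_D Pr r \<phi> X \<mu> y {0..v} =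
           - (mass \<mu> {v<..} v*
                mexp (y *\<^sub>R (matrix_inv (diag_mat (\<lambda>i. \<bar>r i\<bar>)) ** T +
                  lam *\<^sub>R (matrix_inv (diag_mat (\<lambda>i. \<bar>r i\<bar>)) ** diag_mat c))))
           + mass \<mu> {0..} v* mexp (y *\<^sub>R (matrix_inv (diag_mat (\<lambda>i. \<bar>r i\<bar>)) ** T)) \<and>
         mass \<mu> {v<..} =
           (\<chi> j. LBINT x:{0<..}. \<nu> 0 x $ j) - (\<chi> j. LBINT x:{0<..v}. \<nu> 0 x $ j) \<and>
         (\<chi> j. LBINT x:{0<..}. \<nu> 0 x $ j) - (\<chi> j. LBINT x:{0<..v}. \<nu> 0 x $ j) =
           (exp (- lam * v) / lam) *\<^sub>R Lim (at_right 0) (\<nu> 0)"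
proof -
  note c = assms(3) and r = assms(4) and atoms = assms(7) and lam = assms(9) and \<nu>0 = assms(11)
  interpret fluid_clock T c N Pr \<phi> X \<mu> r
    by unfold_locales (use assms in auto)
  define b :: "real^'s" where "b = (\<chi> i. p i)"
  define a where "a = mass \<mu> {0..}"
  define A where "A = matrix_inv (diag_mat (\<lambda>i. \<bar>r i\<bar>)) ** T"
  define B where "B = A + lam *\<^sub>R (matrix_inv (diag_mat (\<lambda>i. \<bar>r i\<bar>)) ** diag_mat c)"
  have A: "(x v* A) $ j = (\<Sum>i\<in>UNIV. T $ i $ j / \<bar>r i\<bar> * x $ i)" for x j
    unfolding A_def by (rule row_scaled_generator [OF r])
  have B: "(x v* B) $ j = (x v* A) $ j + lam * (c j / \<bar>r j\<bar> * x $ j)" for x j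
    unfolding B_def row_mult_add row_mult_scaleR_right by (simp add: row_scaled_rates [OF r])
  have A_entry: "A $ i $ j = T $ i $ j / \<bar>r i\<bar>" for i j
    \<comment> \<open>The action on rows is known; a unit row reads off a single entry.\<close>
    using A [of "axis i 1" j]
    by (simp add: vector_matrix_mult_def axis_def if_distrib [of "\<lambda>x. x * _"]
        if_distrib [of "\<lambda>x. _ * x"] if_distrib [of "\<lambda>x. x / _"] cong: if_cong)
  have total: "(LBINT x:{0<..}. \<nu> 0 x $ j) = b $ j" for j
    by (rule set_integral_scaled_exp(1) [OF lam]) (simp add: \<nu>0 b_def)
  have part: "(LBINT x:{0<..v}. \<nu> 0 x $ j) = (1 - exp (- lam * v)) * b $ j" if "0 < v" for v j
    by (rule set_integral_scaled_exp(2) [OF lam _ that]) (simp add: \<nu>0 b_def)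
  have "mass \<mu> {0..v} $ j = P 0 $ j + (1 - exp (- lam * v)) * b $ j" if "0 < v" for v j
    using atoms [of 0] that by (simp add: has_density_atom_def part)
  note initial = start_exponential [OF finite_\<mu> sets_\<mu> lam this, folded a_def]
  have start_mass: "mass \<mu> {0..v} $ j = a $ j - exp (- lam * v) * b $ j" if "0 < v" for v j
    using initial(2) [of v j] that by (simp add: mass_def)
  note iter = D_iter_exponential [OF c r atoms A B start_mass]
  have "P k $ j = 0" if "0 < c j" for k j
    by (rule atoms_vanish [OF c r A B iter(2,3) assms(8,12) that])
  then have boundary: "(a v* mpow A k) $ j = (b v* mpow B k) $ j" if "0 < c j" for k j
    using iter(3) [of k j] that by simp
  interpret fluid_solution T c N Pr \<phi> X \<mu> r a b lam A B
  proof unfold_locales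
    show "measure (\<mu> j) {0..v} = solution.F a b lam A B v 0 j" if "0 \<le> v" for v j
    proof -
      \<comment> \<open>The remaining hypothesis of the locale mentions \<open>F\<close>, whose
        value at clock 0 is taken from a local interpretation.\<close>
      interpret solution T c r a b lam A B
        by unfold_locales (fact r lam A_entry B boundary)+
      show ?thesis unfolding F_0 by (rule initial(2)) (use that in auto)
    qed
  qed (fact r lam A_entry B boundary)+
  have tail: "mass \<mu> {v<..} = exp (- lam * v) *\<^sub>R b"
    using initial(3) [OF _ assms(14)] by (simp add: vec_eq_iff)
  have "exp_D Pr r \<phi> X \<mu> y {0..v} $ j = F v y j" for j
  proof -
    let ?E = "{w \<in> space N. \<phi> (hit_time r \<phi> y w) w = j \<and> X (hit_time r \<phi> y w) w \<le> v}"
    have "{w \<in> space (Pr i x). \<phi> (hit_time r \<phi> y w) w = j \<and> X (hit_time r \<phi> y w) w \<in> {0..v}} = ?E" if "0 \<le> x" for i x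
    proof -
      \<comment> \<open>Membership in \<open>{0..v}\<close> reduces to \<open>X \<le> v\<close>,
        since the hitting time is positive and levels at such times are nonnegative.\<close>
      have "0 \<le> X (hit_time r \<phi> y w) w" if "w \<in> space N" for w
        by (rule level_nonneg [OF level [OF that]])
          (rule less_imp_le [OF hit_time_unique(1) [where \<phi> = \<phi> and r = r, OF cadlag [OF that] r assms(13)]])
      then show ?thesis unfolding space_Pr [OF that] by auto
    qed
    then have "exp_D Pr r \<phi> X \<mu> y {0..v} $ j = (\<Sum>i\<in>UNIV. LINT x:{0..}|\<mu> i. measure (Pr i x) ?E)"
      unfolding exp_D_def set_lebesgue_integral_def vec_lambda_beta
      by (intro sum.cong refl Bochner_Integration.integral_cong) (auto simp: indicator_def)
    also have "\<dots> = F v y j"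
      using measure_law [OF law_hit(1) [OF assms(13,14)]] law_hit(2) [OF assms(13,14)] by simp
    finally show ?thesis .
  qed
  then have "exp_D Pr r \<phi> X \<mu> y {0..v} = - (mass \<mu> {v<..} v* mexp (y *\<^sub>R B)) + mass \<mu> {0..} v* mexp (y *\<^sub>R A)"
    unfolding tail row_mult_scaleR_left by (simp add: vec_eq_iff F_def a_def [symmetric])
  moreover have "(\<chi> j. LBINT x:{0<..}. \<nu> 0 x $ j) - (\<chi> j. LBINT x:{0<..v}. \<nu> 0 x $ j) = exp (- lam * v) *\<^sub>R b"
    by (simp add: vec_eq_iff total part [OF assms(14)] algebra_simps)
  moreover have "Lim (at_right 0) (\<nu> 0) = lam *\<^sub>R b"
  proof (rule tendsto_Lim [OF trivial_limit_at_right_real], rule vec_tendstoI)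
    fix j
    have "((\<lambda>x. p j * lam * exp (- lam * x)) \<longlongrightarrow> p j * lam * exp (- lam * 0)) (at_right 0)"
      by (intro tendsto_intros)
    then have "((\<lambda>x. \<nu> 0 x $ j) \<longlongrightarrow> p j * lam * exp (- lam * 0)) (at_right 0)"
      by (rule Lim_transform_eventually) (auto simp: eventually_at_right_field \<nu>0 intro!: exI [of _ 1])
    then show "((\<lambda>x. \<nu> 0 x $ j) \<longlongrightarrow> (lam *\<^sub>R b) $ j) (at_right 0)"
      by (simp add: b_def mult.commute)
  qed
  ultimately show ?thesis
    using lam unfolding tail A_def [symmetric] B_def [symmetric] by simp
qed

end
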